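(* Let $\Gamma$ be a countable amenable discrete group, and let $\alpha$ be an action of $\Gamma$ on a compact metrizable abelian group $X$ by automorphisms. Suppose that $\widehat{X}$ is a finitely presented left $\mathbb{Z}\Gamma$-module, and write $\widehat{X}$ as $(\mathbb{Z}\Gamma)^k/(\mathbb{Z}\Gamma)^nA$ for some $k,n\in\mathbb{N}$ and $A\in M_{n\times k}(\mathbb{Z}\Gamma)$. Then the following are equivalent: (1) $\mathrm{h}(X)<+\infty$. (2) $\alpha$ is $1$-expansive. (3) $\alpha$ is $2$-expansive. (4) The linear map $(\mathbb{R}\Gamma)^k\to(\mathbb{R}\Gamma)^n$ sending $a$ to $aA^*$ is injective. (5) The additive map $(\mathbb{Z}\Gamma)^k\to(\mathbb{Z}\Gamma)^n$ sending $a$ to $aA^*$ is injective.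
   Context: $R\Gamma$ is the group ring of $\Gamma$ with coefficients in $R$; elements of $(R\Gamma)^k$ are row vectors. For $f=\sum_s f_s s$, $f^*=\sum_s f_s s^{-1}$, and for a matrix $A=(f_{i,j})\in M_{n\times k}(\mathbb{Z}\Gamma)$, $A^*\in M_{k\times n}(\mathbb{Z}\Gamma)$ has $(i,j)$ entry $f_{j,i}^*$. $\widehat{X}$ is the Pontryagin dual of $X$ with its induced left $\mathbb{Z}\Gamma$-module structure. For $x\in X$ and $\varphi\in\widehat{X}$ let $\Psi_{x,\varphi}:\Gamma\to\mathbb{C}$, $\Psi_{x,\varphi}(s)=\langle sx,\varphi\rangle-1$, where $\langle\cdot,\cdot\rangle:X\times\widehat{X}\to\mathbb{T}$ is the canonical pairing into the unit circle. For $1\le p\le+\infty$ the action is $p$-expansive if there exist a finite $W\subseteq\widehat{X}$ and $\varepsilon>0$ such that $e_X$ is the only $x\in X$ with $\sum_{\varphi\in W}\|\Psi_{x,\varphi}\|_p<\varepsilon$ (the $\ell^p$-norm, equal to $+\infty$ if not $p$-summable). $\mathrm{h}(X)$ is the topological entropy (equal to the measure entropy for normalized Haar measure): with $\rho$ a compatible metric and $(F_n)$ a left F{\o}lner sequence (nonempty finite sets with $|KF_n\setminus F_n|/|F_n|\to0$ for every finite $K\subseteq\Gamma$), $\mathrm{h}(X)=\sup_{\varepsilon>0}\limsup_n|F_n|^{-1}\log N_{\rho,F_n,\varepsilon}(X)$, where $N_{\rho,F,\varepsilon}(X)$ is the maximal cardinality of $Z\subseteq X$ with $\max_{s\in F}\rho(sy,sz)>\varepsilon$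 for all distinct $y,z\in Z$. *)

theory Defs
  imports
    "HOL-Analysis.Analysis"
    "HOL-Library.Poly_Mapping"
    "HOL-Algebra.AbelCoset"
    "Jordan_Normal_Form.Matrix"
begin

text \<open>
  The acting group \<open>\<Gamma>\<close> is a type of class \<^class>\<open>group_add\<close>, which does not assume commutativity;
  the product \<open>st\<close> is written \<open>s + t\<close>, the inverse of \<open>s\<close> is \<open>- s\<close> and the identity is \<open>0\<close>.
  The group ring \<open>R\<Gamma>\<close> is the type \<open>'g \<Rightarrow>\<^sub>0 R\<close> of finitely supported functions; the ring
  multiplication of \<^theory>\<open>HOL-Library.Poly_Mapping\<close> is convolution over \<open>'g\<close>.
  Elements of \<open>(R\<Gamma>)\<^sup>k\<close> are the \<open>1 \<times> k\<close> matrices \<open>carrier_mat 1 k\<close>, so that \<open>a * A\<close> is the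
  product of a row vector with a matrix and \<open>f \<cdot>\<^sub>m a\<close> is left multiplication by a scalar.
\<close>

section \<open>Group rings and modules\<close>

definition gr_star :: "('g::group_add \<Rightarrow>\<^sub>0 'r::comm_monoid_add) \<Rightarrow> ('g \<Rightarrow>\<^sub>0 'r)" where
  "gr_star f = (\<Sum>s\<in>Poly_Mapping.keys f. Poly_Mapping.single (- s) (Poly_Mapping.lookup f s))"

definition mat_star :: "('g::group_add \<Rightarrow>\<^sub>0 'r::comm_monoid_add) mat \<Rightarrow> ('g \<Rightarrow>\<^sub>0 'r) mat" where
  "mat_star A = Matrix.mat (dim_col A) (dim_row A) (\<lambda>(i, j). gr_star (A $$ (j, i)))"

text \<open>The inclusion of matrices over \<open>\<int>\<Gamma>\<close> into matrices over \<open>\<real>\<Gamma>\<close>.\<close>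

definition real_mat :: "('g \<Rightarrow>\<^sub>0 int) mat \<Rightarrow> ('g \<Rightarrow>\<^sub>0 real) mat" where
  "real_mat A = map_mat (Poly_Mapping.map real_of_int) A"

text \<open>
  The locale \<^locale>\<open>module\<close> of HOL-Algebra requires a commutative scalar ring, so only its
  record type is used here.  Its fields \<open>mult\<close> and \<open>one\<close>, inherited from rings, play no role.
\<close>

definition quotient_module :: "('r, 'a) module \<Rightarrow> 'a set \<Rightarrow> ('r, 'a set) module" where
  "quotient_module M N =
     \<lparr>carrier = a_rcosets\<^bsub>M\<^esub> N, mult = undefined, one = undefined,
      zero = N, add = set_add M,
      smult = (\<lambda>r C. \<Union>v\<in>C. N +>\<^bsub>M\<^esub> (r \<odot>\<^bsub>M\<^esub> v))\<rparr>"

text \<open>Isomorphism of left modules over a ring whose carrier is a whole type.\<close>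

definition left_module_iso :: "('r, 'a) module \<Rightarrow> ('r, 'b) module \<Rightarrow> ('a \<Rightarrow> 'b) set" where
  "left_module_iso M N =
     {\<theta>. \<theta> \<in> iso (add_monoid M) (add_monoid N) \<and>
         (\<forall>r. \<forall>m\<in>carrier M. \<theta> (r \<odot>\<^bsub>M\<^esub> m) = r \<odot>\<^bsub>N\<^esub> \<theta> m)}"

text \<open>\<open>(\<int>\<Gamma>)\<^sup>k / (\<int>\<Gamma>)\<^sup>n A\<close>, where \<open>A\<close> has \<open>n\<close> rows and \<open>k\<close> columns.\<close>

definition presented_module ::
    "('g::group_add \<Rightarrow>\<^sub>0 int) mat \<Rightarrow> ('g \<Rightarrow>\<^sub>0 int, ('g \<Rightarrow>\<^sub>0 int) mat set) module" where
  "presented_module A =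
     quotient_module (module_mat TYPE('g \<Rightarrow>\<^sub>0 int) 1 (dim_col A))
       ((\<lambda>b. b * A) ` carrier_mat 1 (dim_row A))"

section \<open>Actions on compact abelian groups and the dual module\<close>

text \<open>
  By the action law each \<open>act s\<close> is invertible with inverse \<open>act (- s)\<close>, so it is an
  automorphism of the topological group.
\<close>

definition automorphism_action ::
    "('g::group_add \<Rightarrow> 'x::topological_ab_group_add \<Rightarrow> 'x) \<Rightarrow> bool" where
  "automorphism_action act \<longleftrightarrow>
     (\<forall>x. act 0 x = x) \<and>
     (\<forall>s t x. act (s + t) x = act s (act t x)) \<and>
     (\<forall>s x y. act s (x + y) = act s x + act s y) \<and>
     (\<forall>s. continuous_on UNIV (act s))"

text \<open>Characters with values in the unit circle; the pairing \<open>\<langle>x, \<phi>\<rangle>\<close> is \<open>\<phi> x\<close>.\<close>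

definition pontryagin_dual :: "('x::topological_ab_group_add \<Rightarrow> complex) set" where
  "pontryagin_dual =
     {\<phi>. continuous_on UNIV \<phi> \<and> (\<forall>x. cmod (\<phi> x) = 1) \<and> (\<forall>x y. \<phi> (x + y) = \<phi> x * \<phi> y)}"

text \<open>
  The induced left module structure is determined by \<open>\<langle>x, s \<phi>\<rangle> = \<langle>s\<^sup>-\<^sup>1 x, \<phi>\<rangle>\<close>.
  The dual is a multiplicative group of functions, so the operation \<open>add\<close> of the module is the
  pointwise product, and an integer multiple is an integer power.
\<close>

definition dual_module ::
    "('g::group_add \<Rightarrow> 'x::topological_ab_group_add \<Rightarrow> 'x)
      \<Rightarrow> ('g \<Rightarrow>\<^sub>0 int, 'x \<Rightarrow> complex) module" where
  "dual_module act =
     \<lparr>carrier = pontryagin_dual, mult = undefined, one = undefined,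
      zero = (\<lambda>x. 1), add = (\<lambda>\<phi> \<psi> x. \<phi> x * \<psi> x),
      smult = (\<lambda>f \<phi> x. \<Prod>s\<in>Poly_Mapping.keys f. \<phi> (act (- s) x) powi Poly_Mapping.lookup f s)\<rparr>"

section \<open>\<open>p\<close>-expansiveness\<close>

definition Psi :: "('g \<Rightarrow> 'x \<Rightarrow> 'x) \<Rightarrow> 'x \<Rightarrow> ('x \<Rightarrow> complex) \<Rightarrow> 'g \<Rightarrow> complex" where
  "Psi act x \<phi> s = \<phi> (act s x) - 1"

definition lp_norm :: "ennreal \<Rightarrow> ('g \<Rightarrow> complex) \<Rightarrow> ennreal" where
  "lp_norm p f =
     (if p = \<infinity> then (SUP s. ennreal (cmod (f s)))
      else if (\<lambda>s. cmod (f s) powr enn2real p) summable_on UNIV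
        then ennreal ((\<Sum>\<^sub>\<infinity>s. cmod (f s) powr enn2real p) powr (1 / enn2real p))
        else \<infinity>)"

text \<open>Intended for \<open>1 \<le> p \<le> \<infinity>\<close>.\<close>

definition p_expansive ::
    "('g::group_add \<Rightarrow> 'x::topological_ab_group_add \<Rightarrow> 'x) \<Rightarrow> ennreal \<Rightarrow> bool" where
  "p_expansive act p \<longleftrightarrow>
     (\<exists>W \<epsilon>. W \<subseteq> pontryagin_dual \<and> finite W \<and> (\<epsilon>::real) > 0 \<and>
        {x. (\<Sum>\<phi>\<in>W. lp_norm p (Psi act x \<phi>)) < ennreal \<epsilon>} = {0})"

section \<open>Amenability and topological entropy\<close>

definition left_Folner_seq :: "(nat \<Rightarrow> 'g::group_add set) \<Rightarrow> bool" where
  "left_Folner_seq F \<longleftrightarrow>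
     (\<forall>n. finite (F n) \<and> F n \<noteq> {}) \<and>
     (\<forall>K. finite K \<longrightarrow>
        (\<lambda>n. real (card ({s + t |s t. s \<in> K \<and> t \<in> F n} - F n)) / real (card (F n)))
          \<longlonglongrightarrow> 0)"

definition amenable :: "'g::group_add itself \<Rightarrow> bool" where
  "amenable _ \<longleftrightarrow> (\<exists>F :: nat \<Rightarrow> 'g set. left_Folner_seq F)"

definition compatible_metric :: "('x::topological_space \<Rightarrow> 'x \<Rightarrow> real) \<Rightarrow> bool" where
  "compatible_metric \<rho> \<longleftrightarrow>
     Metric_space UNIV \<rho> \<and> Metric_space.mtopology UNIV \<rho> = euclidean"

definition separated_set ::
    "('g \<Rightarrow> 'x \<Rightarrow> 'x) \<Rightarrow> ('x \<Rightarrow> 'x \<Rightarrow> real) \<Rightarrow> 'g set \<Rightarrow> real \<Rightarrow> 'x set \<Rightarrow> bool" where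
  "separated_set act \<rho> F \<epsilon> Z \<longleftrightarrow>
     (\<forall>y\<in>Z. \<forall>z\<in>Z. y \<noteq> z \<longrightarrow> Max ((\<lambda>s. \<rho> (act s y) (act s z)) ` F) > \<epsilon>)"

text \<open>
  For a continuous action on a compact space, a compatible metric, finite nonempty \<open>F\<close> and
  \<open>\<epsilon> > 0\<close>, separated sets are finite of bounded cardinality, so this maximum is attained.
\<close>

definition sep_number ::
    "('g \<Rightarrow> 'x \<Rightarrow> 'x) \<Rightarrow> ('x \<Rightarrow> 'x \<Rightarrow> real) \<Rightarrow> 'g set \<Rightarrow> real \<Rightarrow> nat" where
  "sep_number act \<rho> F \<epsilon> = Max (card ` {Z. finite Z \<and> separated_set act \<rho> F \<epsilon> Z})"

definition top_entropy ::
    "('g \<Rightarrow> 'x \<Rightarrow> 'x) \<Rightarrow> ('x \<Rightarrow> 'x \<Rightarrow> real) \<Rightarrow> (nat \<Rightarrow> 'g set) \<Rightarrow> ereal" where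
  "top_entropy act \<rho> F =
     (SUP \<epsilon>\<in>{0<..}.
        limsup (\<lambda>n. ereal (ln (real (sep_number act \<rho> (F n) \<epsilon>)) / real (card (F n)))))"

end

theory Submission
  imports Defs
begin

text \<open>
  Write \<open>\<phi>\<^sub>j\<close> for the characters of \<open>X\<close> given by the generators. Pontryagin duality for \<open>X\<close> makes
  \<open>x \<mapsto> (\<phi>\<^sub>j(s x))\<close> a bijection of \<open>X\<close> onto the families \<open>exp(2\<pi>i y\<^sub>j(s))\<close> for which all relations
  map \<open>y\<close> to integers. A nonzero finitely supported real solution of the relations yields, by scaling,
  nonzero points that are arbitrarily small in \<open>\<ell>\<^sup>1\<close>, and, by superposing translates, arbitrarily large
  entropy. Conversely, if there is none, a small \<open>\<ell>\<^sup>2\<close> point lifts to an \<open>\<ell>\<^sup>2\<close> solution, which has to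
  vanish by comparing dimensions along a Folner sequence; and up to exponentially many integer values
  of the relations, the restriction of a point to a Folner set varies in a space whose dimension
  is bounded by the size of the boundary, which gives finite entropy. Real and integer solutions are
  related by Dirichlet approximation.

  Characters separating the points of \<open>X\<close> are limits \<open>f * f\<^sup>\<sim> * k\<close> along maximisers of
  \<open>\<parallel>f * f\<^sup>\<sim> * k\<parallel>\<^sub>2\<close> over \<open>\<parallel>f\<parallel>\<^sub>2 = 1\<close>, where \<open>k\<close> is chosen orthogonal to the characters that are
  trivial at a given point. The required invariant mean is obtained from averages of translates.
\<close>

section \<open>The invariant mean of a compact abelian group\<close>

text \<open>All five conditions are compared with \<open>rel_injective A\<close>. This property is
  only qualitative: on a finite set of coordinates it yields a bounded inverse, but the norm of that
  inverse is not controlled along a Folner sequence. Both uses of it therefore rest on estimates in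
  which only the number of boundary relations counts: a trace inequality for expansiveness, and for
  entropy a counting bound with that number as exponent. Finite entropy also requires one bound for
  all scales \<epsilon>. The classes of integer values cost a factor whose exponential rate depends
  on \<open>A\<close> alone. The scale enters through the size of the thickened set, eventually at
  most twice the Folner set, and through the boundary factor, whose contribution is eventually at
  most 1. Characters come from a variational problem and not from a spectral theorem: both
  \<open>sqnorm (twisted_conv k f)\<close> and the square of \<open>sqnorm f\<close> are of degree
  four in f, and exactly this homogeneity lets the parallelogram law turn near-maximality into an
  approximate eigenvector equation for translations.\<close>

instance prod :: (topological_monoid_add, topological_monoid_add) topological_monoid_add
proof
  fix a b :: "'a \<times> 'b"
  show "LIM x (nhds a \<times>\<^sub>F nhds b). fst x + snd x :> nhds (a + b)"
    unfolding plus_prod_def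
    by (intro tendsto_Pair tendsto_add tendsto_fst tendsto_snd filterlim_fst filterlim_snd)
qed

instance prod :: (topological_group_add, topological_group_add) topological_group_add
proof
  fix a :: "'a \<times> 'b"
  show "(uminus \<longlongrightarrow> - a) (nhds a)"
    unfolding uminus_prod_def
    by (intro tendsto_Pair tendsto_minus tendsto_fst tendsto_snd filterlim_ident)
qed

instance prod :: (topological_comm_monoid_add, topological_comm_monoid_add) topological_comm_monoid_add
  ..

instance prod :: (topological_ab_group_add, topological_ab_group_add) topological_ab_group_add
  ..

lemma continuous_on_UNIV_compose:
  assumes "continuous_on UNIV f" "continuous_on S g"
  shows "continuous_on S (\<lambda>x. f (g x))"
  using continuous_on_compose2[OF assms] by auto

text \<open>Uniformity is expressed by neighbourhoods of 0. The tube lemma, applied to the slice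
  over 0 in the product, makes one neighbourhood serve all base points.\<close>

lemma uniform_cont_compact_group:
  fixes f :: "'x::topological_ab_group_add \<Rightarrow> 'b::metric_space"
  assumes c: "compact (UNIV :: 'x set)" and f: "continuous_on UNIV f" and e: "e > 0"
  shows "\<exists>U. open U \<and> 0 \<in> U \<and> (\<forall>x. \<forall>u\<in>U. dist (f (x + u)) (f x) < e)"
proof -
  let ?W = "{p::'x\<times>'x. dist (f (snd p + fst p)) (f (snd p)) < e}"
  have "open ?W"
    by (intro open_Collect_less continuous_on_dist continuous_on_UNIV_compose[OF f]
        continuous_on_add continuous_on_snd continuous_on_fst continuous_on_id continuous_on_const)
  moreover have "{0} \<times> UNIV \<subseteq> ?W" using e by auto
  ultimately obtain U where "0 \<in> U" "open U" "U \<times> UNIV \<subseteq> ?W"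
    using Elementary_Topology.tube_lemma[OF c, of ?W 0] by blast
  then have "dist (f (x + u)) (f x) < e" if "u \<in> U" for x u
  proof -
    have "(u, x) \<in> U \<times> UNIV" using that by simp
    then have "(u, x) \<in> ?W" using \<open>U \<times> UNIV \<subseteq> ?W\<close> by blast
    then show ?thesis by simp
  qed
  with \<open>open U\<close> \<open>0 \<in> U\<close> show ?thesis by blast
qed

lemma bounded_cont_compact:
  fixes f :: "'x::topological_space \<Rightarrow> 'b::real_normed_vector"
  assumes c: "compact (UNIV :: 'x set)" and f: "continuous_on UNIV f"
  shows "\<exists>B>0. \<forall>x. norm (f x) \<le> B"
proof -
  have "bounded (range f)" using compact_continuous_image[OF f c] compact_imp_bounded by blast
  then show ?thesis by (auto simp: bounded_pos)
qed

section \<open>Averages over finitely many translates\<close>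

lemma norm_le_add:
  fixes a b :: "'b::real_normed_vector"
  assumes "norm (a - b) \<le> e" "norm a \<le> B" shows "norm b \<le> B + e"
  using norm_triangle_sub[of b a] assms by (simp add: norm_minus_commute)

lemma norm_diff_trans:
  fixes a b c :: "'b::real_normed_vector"
  assumes "norm (a - b) \<le> e" "norm (b - c) \<le> e'" shows "norm (a - c) \<le> e + e'"
  using norm_diff_triangle_le[OF assms] .

text \<open>Lists, not sets, index the translates: repetitions count with multiplicity, so that a
  composition of two averages is again an average.\<close>

definition avg :: "'x::ab_group_add list \<Rightarrow> ('x \<Rightarrow> 'b::real_normed_vector) \<Rightarrow> 'x \<Rightarrow> 'b" where
  "avg xs f y = (\<Sum>x\<leftarrow>xs. f (y + x)) /\<^sub>R real (length xs)"

lemma avg_add: "avg xs (\<lambda>y. f y + g y) y = avg xs f y + avg xs g y"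
  by (simp add: avg_def sum_list_addf scaleR_add_right)

lemma avg_linear:
  assumes "bounded_linear L" shows "avg xs (\<lambda>y. L (f y)) y = L (avg xs f y)"
proof -
  interpret bounded_linear L by fact
  have "(\<Sum>x\<leftarrow>xs. L (f (y + x))) = L (\<Sum>x\<leftarrow>xs. f (y + x))"
    by (induction xs) (auto simp: add zero)
  then show ?thesis by (simp add: avg_def scaleR)
qed

lemma avg_diff: "avg xs (\<lambda>y. f y - g y) y = avg xs f y - avg xs g y"
  using avg_add[of xs f "\<lambda>y. - g y"] avg_linear[OF bounded_linear_minus[OF bounded_linear_ident], of xs g] by simp

lemma avg_const: "xs \<noteq> [] \<Longrightarrow> avg xs (\<lambda>y. c) y = c"
proof -
  assume "xs \<noteq> []"
  have "(\<Sum>x\<leftarrow>xs. c) = real (length xs) *\<^sub>R c"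
    by (induction xs) (auto simp: algebra_simps)
  then show ?thesis using \<open>xs \<noteq> []\<close> by (simp add: avg_def)
qed

lemma avg_shift: "avg xs (\<lambda>y. f (y + a)) y = avg xs f (y + a)"
  by (simp add: avg_def algebra_simps)

lemma avg_bound:
  assumes "\<And>y. norm (f y) \<le> B" "xs \<noteq> []" shows "norm (avg xs f y) \<le> B"
proof -
  have "norm (\<Sum>x\<leftarrow>xs. f (y + x)) \<le> real (length xs) * B"
    by (induction xs) (auto simp: algebra_simps intro!: order_trans[OF norm_triangle_ineq] add_mono assms)
  then show ?thesis using assms(2) by (simp add: avg_def field_simps)
qed

lemma avg_comp:
  "avg xs (avg ys f) = avg (concat (map (\<lambda>x. map (\<lambda>z. x + z) ys) xs)) f"
proof
  fix y
  have 1: "length (concat (map (\<lambda>x. map (\<lambda>z. x + z) ys) xs)) = length xs * length ys"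
    by (induction xs) auto
  have 2: "(\<Sum>u\<leftarrow>concat (map (\<lambda>x. map (\<lambda>z. x + z) ys) xs). f (y + u)) = (\<Sum>x\<leftarrow>xs. \<Sum>z\<leftarrow>ys. f (y + x + z))"
    by (induction xs) (auto simp: o_def add.assoc)
  have 3: "(\<Sum>x\<leftarrow>xs. (\<Sum>z\<leftarrow>ys. f (y + x + z)) /\<^sub>R c) = (\<Sum>x\<leftarrow>xs. (\<Sum>z\<leftarrow>ys. f (y + x + z))) /\<^sub>R c" for c :: real
    by (induction xs) (auto simp: scaleR_add_right)
  show "avg xs (avg ys f) y = avg (concat (map (\<lambda>x. map (\<lambda>z. x + z) ys) xs)) f y"
    by (simp add: avg_def 1 2 3)
qed

lemma avg_comm: "avg xs (avg ys f) y = avg ys (avg xs f) y"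
proof -
  have "(\<Sum>x\<leftarrow>xs. \<Sum>z\<leftarrow>ys. f (y + x + z)) = (\<Sum>z\<leftarrow>ys. \<Sum>x\<leftarrow>xs. f (y + z + x))"
    by (induction xs) (auto simp: sum_list_addf algebra_simps)
  moreover have 3: "(\<Sum>x\<leftarrow>xs. (\<Sum>z\<leftarrow>ys. f (y + x + z)) /\<^sub>R c) = (\<Sum>x\<leftarrow>xs. (\<Sum>z\<leftarrow>ys. f (y + x + z))) /\<^sub>R c" for c :: real and xs ys
    by (induction xs) (auto simp: scaleR_add_right)
  ultimately show ?thesis by (simp add: avg_def 3)
qed

lemma avg_comp_exists: 
  assumes "xs \<noteq> []" "ys \<noteq> []"
  shows "\<exists>zs. zs \<noteq> [] \<and> (\<forall>g :: 'x::ab_group_add \<Rightarrow> 'b::real_normed_vector. avg zs g = avg xs (avg ys g))"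
proof -
  have "concat (map (\<lambda>x. map (\<lambda>z. x + z) ys) xs) \<noteq> []" using assms by (cases xs) auto
  then show ?thesis using avg_comp by metis
qed

text \<open>Von Neumann's mean of an almost periodic function: a constant in the uniform closure of
  the averages of translates. It stands in for the integral against Haar measure.\<close>

definition is_mean :: "('x::ab_group_add \<Rightarrow> 'b::real_normed_vector) \<Rightarrow> 'b \<Rightarrow> bool" where
  "is_mean f c \<longleftrightarrow> (\<forall>e>0. \<exists>xs. xs \<noteq> [] \<and> (\<forall>y. norm (avg xs f y - c) \<le> e))"

definition mean :: "('x::ab_group_add \<Rightarrow> 'b::real_normed_vector) \<Rightarrow> 'b" where
  "mean f = (SOME c. is_mean f c)"

lemma is_meanD:
  assumes "is_mean f c" "e > 0"
  shows "\<exists>xs. xs \<noteq> [] \<and> (\<forall>y. norm (avg xs f y - c) \<le> e)"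
  using assms unfolding is_mean_def by blast

lemma avg_close_trans:
  assumes "\<And>y. norm (avg xs f y - c) \<le> e" "ys \<noteq> []"
  shows "norm (avg ys (avg xs f) y - c) \<le> e"
proof -
  have "avg ys (avg xs f) y - c = avg ys (\<lambda>y. avg xs f y - c) y"
    using assms(2) by (simp add: avg_diff avg_const)
  then show ?thesis using avg_bound[of "\<lambda>y. avg xs f y - c" e ys y] assms by simp
qed

text \<open>The group is abelian, so the two averages commute, and their composition is close to
  both constants.\<close>

lemma avg_close_common:
  assumes "\<And>y. norm (avg xs f y - c) \<le> e" "\<And>y. norm (avg ys f y - c') \<le> e'" "xs \<noteq> []" "ys \<noteq> []"
  shows "norm (c - c') \<le> e + e'"
proof -
  have "norm (avg ys (avg xs f) 0 - c) \<le> e" by (rule avg_close_trans) (use assms in auto)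
  moreover have "norm (avg xs (avg ys f) 0 - c') \<le> e'" by (rule avg_close_trans) (use assms in auto)
  ultimately show ?thesis
    using norm_diff_trans[of c "avg ys (avg xs f) 0" e c' e'] by (simp add: avg_comm[of xs ys] norm_minus_commute)
qed

lemma is_mean_unique: assumes "is_mean f c" "is_mean f c'" shows "c = c'"
proof -
  have "norm (c - c') \<le> e" if "e > 0" for e
  proof -
    have "e/2 > 0" using that by simp
    then obtain xs ys where "xs \<noteq> []" "\<forall>y. norm (avg xs f y - c) \<le> e/2" "ys \<noteq> []" "\<forall>y. norm (avg ys f y - c') \<le> e/2"
      using is_meanD[OF assms(1), of "e/2"] is_meanD[OF assms(2), of "e/2"] by blast
    then show ?thesis using avg_close_common[of xs f c "e/2" ys c' "e/2"] by simp
  qed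
  then have "norm (c - c') \<le> 0" using field_le_epsilon[of "norm (c - c')" 0] by simp
  then show ?thesis by simp
qed

lemma mean_eqI: "is_mean f c \<Longrightarrow> mean f = c"
  unfolding mean_def using is_mean_unique by (metis someI)

text \<open>One list must serve both functions. The composed list does, because averaging once more
  does not spoil closeness to a constant.\<close>

lemma is_mean_add:
  assumes "is_mean f c" "is_mean g d" shows "is_mean (\<lambda>y. f y + g y) (c + d)"
  unfolding is_mean_def
proof (intro allI impI)
  fix e :: real assume "e > 0"
  then have "e/2 > 0" by simp
  then obtain xs ys where "xs \<noteq> []" "\<forall>y. norm (avg xs f y - c) \<le> e/2" "ys \<noteq> []" "\<forall>y. norm (avg ys g y - d) \<le> e/2"
    using is_meanD[OF assms(1), of "e/2"] is_meanD[OF assms(2), of "e/2"] by blast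
  obtain zs where zs: "zs \<noteq> []" "\<And>h. avg zs (h :: 'a \<Rightarrow> 'b) = avg xs (avg ys h)"
    using avg_comp_exists[OF \<open>xs \<noteq> []\<close> \<open>ys \<noteq> []\<close>] by blast
  have "norm (avg zs (\<lambda>y. f y + g y) y - (c + d)) \<le> e" for y
  proof -
    have "avg zs (\<lambda>y. f y + g y) y - (c + d) = (avg zs f y - c) + (avg zs g y - d)"
      by (simp add: avg_add)
    moreover have "norm (avg zs f y - c) \<le> e/2"
      using avg_close_trans[of xs f c "e/2" ys y] \<open>\<forall>y. norm (avg xs f y - c) \<le> e/2\<close> \<open>ys \<noteq> []\<close> by (simp add: zs avg_comm)
    moreover have "norm (avg zs g y - d) \<le> e/2"
      using avg_close_trans[of ys g d "e/2" xs y] \<open>\<forall>y. norm (avg ys g y - d) \<le> e/2\<close> \<open>xs \<noteq> []\<close> by (simp add: zs avg_comm)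
    ultimately show ?thesis using norm_triangle_mono[of "avg zs f y - c" "e/2" "avg zs g y - d" "e/2"] by (metis field_sum_of_halves)
  qed
  then show "\<exists>xs. xs \<noteq> [] \<and> (\<forall>y. norm (avg xs (\<lambda>y. f y + g y) y - (c + d)) \<le> e)" using zs by blast
qed

lemma is_mean_linear:
  assumes "bounded_linear L" "is_mean f c" shows "is_mean (\<lambda>y. L (f y)) (L c)"
  unfolding is_mean_def
proof (intro allI impI)
  interpret bounded_linear L by fact
  obtain K where K: "K > 0" "\<And>x. norm (L x) \<le> norm x * K" using pos_bounded by blast
  fix e :: real assume "e > 0"
  then have "e / K > 0" using K by simp
  then obtain xs where xs: "xs \<noteq> []" "\<And>y. norm (avg xs f y - c) \<le> e / K"
    using is_meanD[OF assms(2)] by blast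
  have "norm (avg xs (\<lambda>y. L (f y)) y - L c) \<le> e" for y
  proof -
    have "norm (L (avg xs f y - c)) \<le> norm (avg xs f y - c) * K" using K by simp
    also have "\<dots> \<le> e / K * K" using xs K by (intro mult_right_mono) auto
    finally show ?thesis using K by (simp add: avg_linear[OF assms(1)] diff)
  qed
  then show "\<exists>xs. xs \<noteq> [] \<and> (\<forall>y. norm (avg xs (\<lambda>y. L (f y)) y - L c) \<le> e)" using xs by blast
qed

lemma is_mean_shift: "is_mean f c \<Longrightarrow> is_mean (\<lambda>y. f (y + a)) c"
  unfolding is_mean_def by (simp add: avg_shift) blast

lemma is_mean_const: "is_mean (\<lambda>y. c) c"
  unfolding is_mean_def by (intro allI impI exI[of _ "[0]"]) (simp add: avg_const)

lemma is_mean_fst: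
  assumes "is_mean f c"
  shows "is_mean (\<lambda>p::'x::ab_group_add \<times> 'y::ab_group_add. f (fst p)) c"
  unfolding is_mean_def
proof (intro allI impI)
  fix e :: real assume "e > 0"
  then obtain xs where xs: "xs \<noteq> []" "\<And>y. norm (avg xs f y - c) \<le> e"
    using is_meanD[OF assms(1)] by blast
  have "avg (map (\<lambda>x. (x, 0)) xs) (\<lambda>p::'x \<times> 'y. f (fst p)) y = avg xs f (fst y)" for y
    by (simp add: avg_def o_def)
  then show "\<exists>xs. xs \<noteq> [] \<and> (\<forall>y. norm (avg xs (\<lambda>p::'x\<times>'y. f (fst p)) y - c) \<le> e)"
    using xs by (intro exI[of _ "map (\<lambda>x. (x, 0)) xs"]) simp
qed

lemma is_mean_snd:
  assumes "is_mean f c"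
  shows "is_mean (\<lambda>p::'y::ab_group_add \<times> 'x::ab_group_add. f (snd p)) c"
  unfolding is_mean_def
proof (intro allI impI)
  fix e :: real assume "e > 0"
  then obtain xs where xs: "xs \<noteq> []" "\<And>y. norm (avg xs f y - c) \<le> e"
    using is_meanD[OF assms(1)] by blast
  have "avg (map (\<lambda>x. (0, x)) xs) (\<lambda>p::'y \<times> 'x. f (snd p)) y = avg xs f (snd y)" for y
    by (simp add: avg_def o_def)
  then show "\<exists>xs. xs \<noteq> [] \<and> (\<forall>y. norm (avg xs (\<lambda>p::'y\<times>'x. f (snd p)) y - c) \<le> e)"
    using xs by (intro exI[of _ "map (\<lambda>x. (0, x)) xs"]) simp
qed

primrec multiples :: "nat \<Rightarrow> 'a::monoid_add \<Rightarrow> 'a" where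
  "multiples 0 d = 0" | "multiples (Suc n) d = multiples n d + d"

text \<open>Translation by d shifts the ladder by one rung, so all but the first and the last term
  cancel.\<close>

lemma ladder:
  fixes f :: "'x::ab_group_add \<Rightarrow> 'b::real_normed_vector"
  assumes B: "\<And>y. norm (f y) \<le> B" and N: "N > 0"
  shows "norm (avg (map (\<lambda>i. multiples i d) [0..<N]) f (y + d) - avg (map (\<lambda>i. multiples i d) [0..<N]) f y) \<le> 2 * B / N"
proof -
  have "(\<Sum>i\<leftarrow>[0..<N]. f (y + d + multiples i d)) - (\<Sum>i\<leftarrow>[0..<N]. f (y + multiples i d)) = f (y + multiples N d) - f y"
    by (induction N) (auto simp: algebra_simps)
  then have "avg (map (\<lambda>i. multiples i d) [0..<N]) f (y + d) - avg (map (\<lambda>i. multiples i d) [0..<N]) f y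
     = (f (y + multiples N d) - f y) /\<^sub>R N"
    by (simp add: avg_def o_def flip: scaleR_diff_right)
  moreover have "norm (f (y + multiples N d) - f y) \<le> 2 * B" using norm_triangle_le_diff[of "f (y + multiples N d)" "f y"] B[of "y + multiples N d"] B[of y] by simp
  ultimately show ?thesis using N by (simp add: divide_simps)
qed

text \<open>Each new direction is treated by composing with a long ladder in that direction.
  Convexity of the norm preserves the near-invariance already obtained in the other
  directions.\<close>

lemma almost_invariant:
  fixes f :: "'x::ab_group_add \<Rightarrow> 'b::real_normed_vector"
  assumes B: "\<And>y. norm (f y) \<le> B" and e: "e > 0"
  shows "\<exists>xs. xs \<noteq> [] \<and> (\<forall>y. \<forall>d\<in>set ds. norm (avg xs f (y + d) - avg xs f y) \<le> e)"
proof (induction ds)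
  case Nil then show ?case by (intro exI[of _ "[0]"]) auto
next
  case (Cons d ds)
  then obtain xs where xs: "xs \<noteq> []" "\<And>y d. d \<in> set ds \<Longrightarrow> norm (avg xs f (y + d) - avg xs f y) \<le> e" by blast
  \<comment> \<open>This length makes the error \<open>2 * B / N\<close> of \<open>ladder\<close> at
    most e.\<close>
  obtain N :: nat where N: "N > 2 * B / e" using reals_Archimedean2 by blast
  have "B \<ge> 0" using B[of 0] norm_ge_zero order_trans by blast
  then have "2 * B / e \<ge> 0" using e by simp
  then have N0: "N > 0" using N by linarith
  let ?l = "map (\<lambda>i. multiples i d) [0..<N]"
  have l0: "?l \<noteq> []" using N0 by simp
  obtain zs where zs: "zs \<noteq> []" "\<And>h. avg zs (h :: 'x \<Rightarrow> 'b) = avg ?l (avg xs h)"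
    using avg_comp_exists[OF l0 xs(1)] by blast
  have "norm (avg zs f (y + d') - avg zs f y) \<le> e" if "d' \<in> set (d # ds)" for y d'
  proof (cases "d' = d")
    case True
    have "norm (avg zs f (y + d') - avg zs f y) \<le> 2 * B / N"
      unfolding zs True by (rule ladder[OF avg_bound[OF B xs(1)] N0])
    also have "\<dots> \<le> e" using N N0 e by (simp add: field_simps)
    finally show ?thesis .
  next
    case False
    then have "d' \<in> set ds" using that by auto
    have "avg zs f (y + d') - avg zs f y = avg ?l (\<lambda>y. avg xs f (y + d') - avg xs f y) y"
      unfolding zs by (simp add: avg_diff avg_shift)
    then show ?thesis using avg_bound[of "\<lambda>y. avg xs f (y + d') - avg xs f y" e ?l y] xs(2)[OF \<open>d' \<in> set ds\<close>] l0 by simp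
  qed
  then show ?case using zs by blast
qed

lemma compact_group_cover:
  fixes U :: "'x::topological_ab_group_add set"
  assumes c: "compact (UNIV :: 'x set)" and U: "open U" "0 \<in> U"
  shows "\<exists>ds. \<forall>y. \<exists>d\<in>set ds. y - d \<in> U"
proof -
  have op: "open {y. y - d \<in> U}" for d
    using open_vimage[OF U(1), of "\<lambda>y. y - d", OF continuous_on_diff[OF continuous_on_id continuous_on_const]]
    by (simp add: vimage_def)
  have "UNIV \<subseteq> (\<Union>d\<in>UNIV. {y. y - d \<in> U})" using U(2) by auto
  then obtain C where C: "finite C" "UNIV \<subseteq> (\<Union>d\<in>C. {y. y - d \<in> U})"
    by (rule compactE_image[OF c op])
  obtain ds where ds: "set ds = C" using C(1) finite_list by blast
  have "\<exists>d\<in>set ds. y - d \<in> U" for y using C(2) ds by auto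
  then show ?thesis by blast
qed

text \<open>Almost invariance is needed only in the finitely many directions \<open>ds\<close> of a
  cover by translates of a small neighbourhood. Within each translate uniform continuity, which
  averaging preserves, takes over.\<close>

lemma avg_nearly_const:
  fixes f :: "'x::topological_ab_group_add \<Rightarrow> 'b::real_normed_vector"
  assumes c: "compact (UNIV :: 'x set)" and f: "continuous_on UNIV f" and e: "e > 0"
  shows "\<exists>xs c. xs \<noteq> [] \<and> (\<forall>y. norm (avg xs f y - c) \<le> e)"
proof -
  obtain B where B: "\<And>x. norm (f x) \<le> B" using bounded_cont_compact[OF c f] by blast
  have e2: "e/2 > 0" using e by simp
  obtain U where U: "open U" "0 \<in> U" "\<And>x u. u \<in> U \<Longrightarrow> dist (f (x + u)) (f x) < e/2"
    using uniform_cont_compact_group[OF c f e2] by blast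
  obtain ds where ds: "\<And>y. \<exists>d\<in>set ds. y - d \<in> U" using compact_group_cover[OF c U(1,2)] by blast
  obtain xs where xs: "xs \<noteq> []" "\<And>y d. d \<in> set ds \<Longrightarrow> norm (avg xs f (y + d) - avg xs f y) \<le> e/2"
    using almost_invariant[of f B "e/2" ds, OF B e2] by blast
  have "norm (avg xs f y - avg xs f 0) \<le> e" for y
  proof -
    obtain d where d: "d \<in> set ds" "y - d \<in> U" using ds by blast
    have "avg xs f y - avg xs f d = avg xs (\<lambda>z. f (z + (y - d)) - f z) d"
      by (simp add: avg_diff avg_shift)
    then have "norm (avg xs f y - avg xs f d) \<le> e/2"
      using avg_bound[of "\<lambda>z. f (z + (y - d)) - f z" "e/2" xs d] less_imp_le[OF U(3)[OF d(2)]] xs(1)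
      unfolding dist_norm by metis
    moreover have "norm (avg xs f d - avg xs f 0) \<le> e/2" using xs(2)[OF d(1), of 0] by simp
    ultimately show ?thesis using norm_diff_trans[of "avg xs f y" "avg xs f d" "e/2" "avg xs f 0" "e/2"] by simp
  qed
  then show ?thesis using xs by blast
qed

section \<open>Existence and rules of the mean\<close>

lemma choice_two: "(\<And>n. \<exists>x y. P n x y) \<Longrightarrow> \<exists>f g. \<forall>n. P n (f n) (g n)"
  by metis

text \<open>The approximating constants are Cauchy, because any two averages can be compared through
  their composition.\<close>

lemma is_mean_exists:
  fixes f :: "'x::topological_ab_group_add \<Rightarrow> 'b::banach"
  assumes c: "compact (UNIV :: 'x set)" and f: "continuous_on UNIV f"
  shows "\<exists>c. is_mean f c"
proof -
  have "\<exists>xs c. xs \<noteq> [] \<and> (\<forall>y. norm (avg xs f y - c) \<le> inverse (real (Suc n)))" for n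
    by (rule avg_nearly_const[OF c f]) simp
  then have "\<exists>xs c. \<forall>n. xs n \<noteq> [] \<and> (\<forall>y. norm (avg (xs n) f y - c n) \<le> inverse (real (Suc n)))"
    by (intro choice_two)
  then obtain xs c where xc: "\<And>n. xs n \<noteq> []" "\<And>n y. norm (avg (xs n) f y - c n) \<le> inverse (real (Suc n))" by blast
  have cc: "norm (c m - c n) \<le> inverse (real (Suc m)) + inverse (real (Suc n))" for m n
    by (rule avg_close_common[OF xc(2) xc(2) xc(1) xc(1)])
  have "Cauchy c"
  proof (rule CauchyI)
    fix e :: real assume "e > 0"
    then obtain N where N: "inverse (real (Suc N)) < e/2" using reals_Archimedean[of "e/2"] by auto
    have "norm (c m - c n) < e" if "m \<ge> N" "n \<ge> N" for m n
    proof -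
      have "inverse (real (Suc m)) \<le> inverse (real (Suc N))" "inverse (real (Suc n)) \<le> inverse (real (Suc N))"
        using that by (auto intro!: le_imp_inverse_le)
      then show ?thesis using cc[of m n] N by linarith
    qed
    then show "\<exists>M. \<forall>m\<ge>M. \<forall>n\<ge>M. norm (c m - c n) < e" by blast
  qed
  then obtain l where l: "c \<longlonglongrightarrow> l" using Cauchy_convergent convergent_def by blast
  have "is_mean f l" unfolding is_mean_def
  proof (intro allI impI)
    fix e :: real assume "e > 0"
    then have "\<forall>\<^sub>F n in sequentially. norm (c n - l) < e/2"
      using l unfolding tendsto_iff dist_norm by (auto dest: spec[of _ "e/2"])
    moreover have "\<forall>\<^sub>F n in sequentially. inverse (real (Suc n)) < e/2"
      using order_tendstoD(2)[OF LIMSEQ_inverse_real_of_nat, of "e/2"] \<open>e > 0\<close> by simp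
    ultimately obtain n where n: "norm (c n - l) < e/2" "inverse (real (Suc n)) < e/2"
      using eventually_happens'[OF sequentially_bot eventually_conj] by blast
    have "norm (avg (xs n) f y - l) \<le> e" for y
      using norm_diff_trans[OF xc(2)[of n y] less_imp_le[OF n(1)]] n(2) by linarith
    then show "\<exists>xs. xs \<noteq> [] \<and> (\<forall>y. norm (avg xs f y - l) \<le> e)" using xc(1) by blast
  qed
  then show ?thesis by blast
qed

lemma mean_is_mean:
  fixes f :: "'x::topological_ab_group_add \<Rightarrow> 'b::banach"
  assumes "compact (UNIV :: 'x set)" "continuous_on UNIV f"
  shows "is_mean f (mean f)"
  using is_mean_exists[OF assms] mean_eqI by metis

text \<open>For one common list the inequality holds termwise; the composition of the two lists
  approximates both means at once.\<close>

lemma is_mean_norm_le: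
  fixes f :: "'x::ab_group_add \<Rightarrow> 'b::real_normed_vector" and g :: "'x \<Rightarrow> real"
  assumes "is_mean f c" "is_mean g d" "\<And>x. norm (f x) \<le> g x"
  shows "norm c \<le> d"
proof (rule field_le_epsilon)
  fix e :: real assume "e > 0"
  then have e2: "e/2 > 0" by simp
  obtain xs where xs: "xs \<noteq> []" "\<forall>y. norm (avg xs f y - c) \<le> e/2" using is_meanD[OF assms(1) e2] by blast
  obtain ys where ys: "ys \<noteq> []" "\<forall>y. norm (avg ys g y - d) \<le> e/2" using is_meanD[OF assms(2) e2] by blast
  have le: "norm (avg zs f y) \<le> avg zs g y" for zs y
  proof -
    have "norm (\<Sum>x\<leftarrow>zs. f (y + x)) \<le> (\<Sum>x\<leftarrow>zs. g (y + x))"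
      by (induction zs) (simp_all add: norm_triangle_mono assms(3))
    then show ?thesis by (simp add: avg_def divide_right_mono field_simps)
  qed
  have le2: "norm (avg xs (avg ys f) 0) \<le> avg xs (avg ys g) 0"
    unfolding avg_comp by (rule le)
  have 1: "norm (avg xs (avg ys f) 0 - c) \<le> e/2"
    unfolding avg_comm[of xs ys] by (rule avg_close_trans) (use xs ys in auto)
  have "norm (avg xs (avg ys g) 0 - d) \<le> e/2"
    by (rule avg_close_trans) (use xs ys in auto)
  then have 2: "avg xs (avg ys g) 0 - d \<le> e/2" unfolding real_norm_def by (rule abs_le_D1)
  have "norm c \<le> norm (avg xs (avg ys f) 0) + e/2" by (rule norm_le_add[OF 1 order_refl])
  then show "norm c \<le> d + e" using 2 le2 by (simp add: field_simps)
qed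

lemma mean_mono:
  fixes f :: "'x::topological_ab_group_add \<Rightarrow> real" and g :: "'x \<Rightarrow> real"
  assumes c: "compact (UNIV :: 'x set)" and f: "continuous_on UNIV f" and g: "continuous_on UNIV g"
    and le: "\<And>x. f x \<le> g x"
  shows "mean f \<le> mean g"
proof -
  have "is_mean (\<lambda>x. g x - f x) (mean g - mean f)"
    using is_mean_add[OF mean_is_mean[OF c g] is_mean_linear[OF bounded_linear_minus[OF bounded_linear_ident] mean_is_mean[OF c f]]]
    by simp
  \<comment> \<open>The nonnegative function \<open>g - f\<close> is its own majorant, so its mean
    bounds a norm and is nonnegative.\<close>
  from is_mean_norm_le[OF this this] show ?thesis using le by simp
qed

lemma mean_add:
  fixes f g :: "'x::topological_ab_group_add \<Rightarrow> 'b::banach"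
  assumes c: "compact (UNIV :: 'x set)" and f: "continuous_on UNIV f" and g: "continuous_on UNIV g"
  shows "mean (\<lambda>x. f x + g x) = mean f + mean g"
  by (rule mean_eqI[OF is_mean_add[OF mean_is_mean[OF c f] mean_is_mean[OF c g]]])

lemma mean_linear:
  fixes f :: "'x::topological_ab_group_add \<Rightarrow> 'b::banach"
  assumes c: "compact (UNIV :: 'x set)" and f: "continuous_on UNIV f" and L: "bounded_linear L"
  shows "mean (\<lambda>x. L (f x)) = L (mean f)"
  by (rule mean_eqI[OF is_mean_linear[OF L mean_is_mean[OF c f]]])

lemma mean_mult_left:
  fixes f :: "'x::topological_ab_group_add \<Rightarrow> 'b::{banach,real_normed_algebra}"
  assumes c: "compact (UNIV :: 'x set)" and f: "continuous_on UNIV f"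
  shows "mean (\<lambda>x. a * f x) = a * mean f"
  by (rule mean_linear[OF c f bounded_linear_mult_right])

lemma mean_diff:
  fixes f g :: "'x::topological_ab_group_add \<Rightarrow> 'b::banach"
  assumes c: "compact (UNIV :: 'x set)" and f: "continuous_on UNIV f" and g: "continuous_on UNIV g"
  shows "mean (\<lambda>x. f x - g x) = mean f - mean g"
proof -
  have "mean (\<lambda>x. f x + - g x) = mean f + mean (\<lambda>x. - g x)"
    by (rule mean_add[OF c f continuous_on_minus[OF g]])
  also have "mean (\<lambda>x. - g x) = - mean g"
    by (rule mean_linear[OF c g bounded_linear_minus[OF bounded_linear_ident]])
  finally show ?thesis by simp
qed

lemma mean_shift:
  fixes f :: "'x::topological_ab_group_add \<Rightarrow> 'b::banach"
  assumes c: "compact (UNIV :: 'x set)" and f: "continuous_on UNIV f"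
  shows "mean (\<lambda>x. f (x + a)) = mean f"
  by (rule mean_eqI[OF is_mean_shift[OF mean_is_mean[OF c f]]])

lemma mean_const: "mean (\<lambda>x. c) = c"
  by (rule mean_eqI[OF is_mean_const])

lemma is_mean_sum_list:
  assumes "\<And>d. d \<in> set ds \<Longrightarrow> is_mean (F d) m"
  shows "is_mean (\<lambda>y. \<Sum>d\<leftarrow>ds. F d y) (real (length ds) *\<^sub>R m)"
  using assms
proof (induction ds)
  case Nil then show ?case using is_mean_const[of 0] by simp
next
  case (Cons d ds)
  then have "is_mean (\<lambda>y. F d y + (\<Sum>d\<leftarrow>ds. F d y)) (m + real (length ds) *\<^sub>R m)"
    by (intro is_mean_add) auto
  then show ?case by (simp add: algebra_simps)
qed

text \<open>Finitely many translates of the open set on which f exceeds half of \<open>f x0\<close>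
  cover the group. The sum of the corresponding translates of f is bounded below by a positive
  constant, and its mean is a multiple of the mean of f.\<close>

lemma mean_pos:
  fixes f :: "'x::topological_ab_group_add \<Rightarrow> real"
  assumes c: "compact (UNIV :: 'x set)" and f: "continuous_on UNIV f"
    and nn: "\<And>x. f x \<ge> 0" and x0: "f x0 > 0"
  shows "mean f > 0"
proof -
  let ?a = "f x0 / 2"
  let ?U = "{u. f (x0 + u) > ?a}"
  have "open ?U"
    by (intro open_Collect_less continuous_on_UNIV_compose[OF f] continuous_on_const continuous_on_add continuous_on_id)
  moreover have "0 \<in> ?U" using x0 by simp
  ultimately obtain ds where ds: "\<And>y. \<exists>d\<in>set ds. y - d \<in> ?U"
    using compact_group_cover[OF c] by blast
  let ?g = "\<lambda>y. \<Sum>d\<leftarrow>ds. f (y + (x0 - d))"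
  have m: "is_mean ?g (real (length ds) *\<^sub>R mean f)"
    by (rule is_mean_sum_list) (rule is_mean_shift[OF mean_is_mean[OF c f]])
  have le: "?a \<le> ?g y" for y
  proof -
    obtain d where d: "d \<in> set ds" "y - d \<in> ?U" using ds by blast
    have "?a \<le> f (y + (x0 - d))" using d(2) by (simp add: algebra_simps)
    also have "\<dots> \<le> ?g y"
      using d(1) by (intro member_le_sum_list) (auto intro: nn)
    finally show ?thesis .
  qed
  have "norm ?a \<le> real (length ds) *\<^sub>R mean f"
    by (rule is_mean_norm_le[OF is_mean_const m]) (use le x0 in auto)
  then have "real (length ds) * mean f > 0" using x0 by auto
  then show ?thesis by (simp add: zero_less_mult_iff)
qed

lemma mean_eq_0_imp:
  fixes f :: "'x::topological_ab_group_add \<Rightarrow> real"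
  assumes "compact (UNIV :: 'x set)" "continuous_on UNIV f" "\<And>x. f x \<ge> 0" "mean f \<le> 0"
  shows "f x = 0"
  using mean_pos[OF assms(1-3), of x] assms(3)[of x] assms(4) by linarith

lemma mean_nonneg:
  fixes f :: "'x::topological_ab_group_add \<Rightarrow> real"
  assumes "compact (UNIV :: 'x set)" "continuous_on UNIV f" "\<And>x. f x \<ge> 0"
  shows "mean f \<ge> 0"
  using mean_mono[OF assms(1) continuous_on_const assms(2), of 0] assms(3) by (simp add: mean_const)

lemma compact_UNIV_prod:
  assumes "compact (UNIV :: 'x::topological_space set)" "compact (UNIV :: 'y::topological_space set)"
  shows "compact (UNIV :: ('x \<times> 'y) set)"
  using compact_Times[OF assms] by (simp add: UNIV_Times_UNIV)

section \<open>Compactness of equicontinuous sequences\<close>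

lemma group_continuousI:
  fixes g :: "'x::topological_ab_group_add \<Rightarrow> 'b::metric_space"
  assumes "\<And>e. e > 0 \<Longrightarrow> \<exists>U. open U \<and> 0 \<in> U \<and> (\<forall>x. \<forall>u\<in>U. dist (g (x + u)) (g x) \<le> e)"
  shows "continuous_on UNIV g"
  unfolding continuous_on_def
proof
  fix x
  show "(g \<longlongrightarrow> g x) (at x within UNIV)"
  proof (rule tendstoI)
    fix e :: real assume "e > 0"
    then have "e/2 > 0" by simp
    from assms[OF this] obtain U where U: "open U" "0 \<in> U" "\<And>x u. u\<in>U \<Longrightarrow> dist (g (x + u)) (g x) \<le> e/2" by blast
    have "open {y. y - x \<in> U}"
      using open_vimage[OF U(1), of "\<lambda>y. y - x", OF continuous_on_diff[OF continuous_on_id continuous_on_const]]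
      by (simp add: vimage_def)
    then have "\<forall>\<^sub>F y in nhds x. y - x \<in> U"
      using eventually_nhds_in_open[of "{y. y - x \<in> U}" x] U(2) by simp
    then have "\<forall>\<^sub>F y in nhds x. dist (g y) (g x) < e"
    proof (rule eventually_mono)
      fix y assume "y - x \<in> U"
      from U(3)[OF this, of x] show "dist (g y) (g x) < e" using \<open>e > 0\<close> by simp
    qed
    then show "\<forall>\<^sub>F y in at x within UNIV. dist (g y) (g x) < e"
      unfolding eventually_at_filter by (rule eventually_mono) auto
  qed
qed

text \<open>Arzela-Ascoli by way of Tychonoff: a cluster point exists in the compact product of
  balls, and equicontinuity turns pointwise closeness on a finite cover into uniform closeness.
  Closeness for arbitrarily large n is all that is needed, so no subsequence is extracted.\<close>

lemma equicont_cluster: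
  fixes G :: "nat \<Rightarrow> 'x::topological_ab_group_add \<Rightarrow> 'b::heine_borel"
  assumes c: "compact (UNIV :: 'x set)" and B: "\<And>n x. dist a (G n x) \<le> B"
    and eq: "\<And>e. e > 0 \<Longrightarrow> \<exists>U. open U \<and> 0 \<in> U \<and> (\<forall>n x. \<forall>u\<in>U. dist (G n (x + u)) (G n x) \<le> e)"
  shows "\<exists>g. continuous_on UNIV g \<and> (\<forall>e>0. \<forall>N. \<exists>n\<ge>N. \<forall>x. dist (G n x) (g x) \<le> e)"
proof -
  let ?K = "PiE UNIV (\<lambda>_::'x. cball a B)"
  have "compactin (product_topology (\<lambda>i. euclidean) UNIV) ?K"
    unfolding compactin_PiE by auto
  then have "compact ?K" unfolding euclidean_product_topology by simp
  moreover have "filtermap G sequentially \<noteq> bot" by (simp add: filtermap_bot_iff)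
  moreover have "\<forall>\<^sub>F h in filtermap G sequentially. h \<in> ?K"
    using B by (auto simp: eventually_filtermap PiE_def)
  ultimately have "\<exists>g\<in>?K. inf (nhds g) (filtermap G sequentially) \<noteq> bot"
    unfolding compact_filter by (elim allE impE)
  then obtain g where g: "inf (nhds g) (filtermap G sequentially) \<noteq> bot" by blast
  have near: "\<exists>n\<ge>N. \<forall>d\<in>D. dist (G n d) (g d) < e" if D: "finite D" and e: "e > 0" for D e and N :: nat
  proof (rule ccontr)
    assume no: "\<not> ?thesis"
    let ?S = "{h. \<forall>d\<in>D. dist (h d) (g d) < e}"
    have "?S = (\<Inter>d\<in>D. (\<lambda>h. h d) -` ball (g d) e)" by (auto simp: dist_commute)
    also have "open \<dots>" 
      using D by (intro open_INT) (auto intro!: open_vimage continuous_on_product_coordinates)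
    finally have "\<forall>\<^sub>F h in nhds g. h \<in> ?S" using e by (intro eventually_nhds_in_open) auto
    moreover have "\<forall>\<^sub>F h in filtermap G sequentially. h \<notin> ?S"
      unfolding eventually_filtermap eventually_sequentially using no by auto
    ultimately have "\<forall>\<^sub>F h in inf (nhds g) (filtermap G sequentially). False"
      unfolding eventually_inf
      by (intro exI[of _ "\<lambda>h. h \<in> ?S"] exI[of _ "\<lambda>h. h \<notin> ?S"] conjI) auto
    then show False using g by (simp add: trivial_limit_def)
  qed
  have geq: "\<exists>U. open U \<and> 0 \<in> U \<and> (\<forall>x. \<forall>u\<in>U. dist (g (x + u)) (g x) \<le> 3 * e) \<and> (\<forall>n x. \<forall>u\<in>U. dist (G n (x + u)) (G n x) \<le> e)"
    if e: "e > 0" for e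
  proof -
    obtain U where U: "open U" "0 \<in> U" "\<forall>n x. \<forall>u\<in>U. dist (G n (x + u)) (G n x) \<le> e"
      using eq[OF e] by blast
    have "dist (g (x + u)) (g x) \<le> 3 * e" if "u \<in> U" for x u
    proof -
      obtain n where "\<forall>d\<in>{x, x + u}. dist (G n d) (g d) < e" using near[of "{x, x+u}" e 0] e by blast
      moreover have "dist (G n (x + u)) (G n x) \<le> e" using U that by blast
      ultimately show ?thesis
        using dist_triangle[of "g (x+u)" "g x" "G n (x+u)"] dist_triangle[of "G n (x+u)" "g x" "G n x"]
        by (simp add: dist_commute)
    qed
    then show ?thesis using U by blast
  qed
  have "continuous_on UNIV g"
  proof (rule group_continuousI)
    fix e :: real assume "e > 0"
    then have "e/3 > 0" by simp
    from geq[OF this] show "\<exists>U. open U \<and> 0 \<in> U \<and> (\<forall>x. \<forall>u\<in>U. dist (g (x + u)) (g x) \<le> e)"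
      by auto
  qed
  moreover have "\<exists>n\<ge>N. \<forall>x. dist (G n x) (g x) \<le> e" if e: "e > 0" for e N
  proof -
    \<comment> \<open>The budget is one fifth for \<open>G n\<close> between x and a cover point,
      one fifth at the cover point, and three fifths for the limit g, which inherits equicontinuity
      with a factor 3.\<close>
    from e have e5: "e/5 > 0" by simp
    from geq[OF e5] obtain U where U: "open U" "0 \<in> U" "\<And>x u. u\<in>U \<Longrightarrow> dist (g (x + u)) (g x) \<le> 3 * (e/5)"
      "\<And>n x u. u\<in>U \<Longrightarrow> dist (G n (x + u)) (G n x) \<le> e/5" by blast
    obtain ds where ds: "\<And>y. \<exists>d\<in>set ds. y - d \<in> U" using compact_group_cover[OF c U(1,2)] by blast
    obtain n where n: "n \<ge> N" "\<And>d. d\<in>set ds \<Longrightarrow> dist (G n d) (g d) < e/5" using near[of "set ds" "e/5" N] e5 by auto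
    have "dist (G n x) (g x) \<le> e" for x
    proof -
      obtain d where d: "d \<in> set ds" "x - d \<in> U" using ds by blast
      show ?thesis using U(3)[OF d(2), of d] U(4)[OF d(2), of n d] n(2)[OF d(1)]
        dist_triangle[of "G n x" "g x" "G n d"] dist_triangle[of "G n d" "g x" "g d"]
        by (simp add: dist_commute)
    qed
    then show ?thesis using n(1) by blast
  qed
  ultimately show ?thesis by blast
qed

section \<open>Characters separate points\<close>

lemma compatible_metric_continuous:
  fixes \<rho> :: "'x::topological_space \<Rightarrow> 'x \<Rightarrow> real" and f g :: "'y::topological_space \<Rightarrow> 'x"
  assumes "compatible_metric \<rho>" and f: "continuous_on UNIV f" and g: "continuous_on UNIV g"
  shows "continuous_on UNIV (\<lambda>x. \<rho> (f x) (g x))"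
proof -
  interpret Metric_space UNIV \<rho> using assms(1) by (simp add: compatible_metric_def)
  have m: "mtopology = euclidean" using assms(1) by (simp add: compatible_metric_def)
  have M: "mtopology_of (metric (UNIV, \<rho>)) = euclidean" using m by (simp add: mtopology_of_def)
  have "continuous_map euclidean euclidean (\<lambda>x. mdist (metric (UNIV, \<rho>)) (f x) (g x))"
    by (rule continuous_map_mdist; unfold M) (use f g in auto)
  then show ?thesis by simp
qed

lemma compatible_metric_ball:
  fixes \<rho> :: "'x::topological_space \<Rightarrow> 'x \<Rightarrow> real"
  assumes "compatible_metric \<rho>" "open V" "x \<in> V"
  shows "\<exists>d>0. \<forall>y. \<rho> x y < d \<longrightarrow> y \<in> V"
proof -
  interpret Metric_space UNIV \<rho> using assms(1) by (simp add: compatible_metric_def)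
  have m: "mtopology = euclidean" using assms(1) by (simp add: compatible_metric_def)
  have "openin mtopology V" using assms(2) m by simp
  then obtain r where "r > 0" "mball x r \<subseteq> V" using assms(3) unfolding openin_mtopology by blast
  then show ?thesis by (auto simp: in_mball subset_iff)
qed

lemma compatible_metric_simps:
  fixes \<rho> :: "'x::topological_space \<Rightarrow> 'x \<Rightarrow> real"
  assumes "compatible_metric \<rho>"
  shows "\<rho> x y \<ge> 0" "\<rho> x y = \<rho> y x" "\<rho> x y = 0 \<longleftrightarrow> x = y" "\<rho> x z \<le> \<rho> x y + \<rho> y z"
proof -
  interpret Metric_space UNIV \<rho> using assms(1) by (simp add: compatible_metric_def)
  show "\<rho> x y \<ge> 0" "\<rho> x y = \<rho> y x" "\<rho> x y = 0 \<longleftrightarrow> x = y" "\<rho> x z \<le> \<rho> x y + \<rho> y z"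
    by (auto simp: commute triangle)
qed

text \<open>A double integral, taken as one mean over the product group; invariance under
  translations of a single argument is then available without interchanging iterated means.\<close>

definition sesq :: "('x::ab_group_add \<Rightarrow> complex) \<Rightarrow> ('x \<times> 'x \<Rightarrow> complex) \<Rightarrow> complex" where
  "sesq f h = mean (\<lambda>p. f (fst p) * cnj (f (snd p)) * h p)"

definition sqnorm :: "('x::ab_group_add \<Rightarrow> complex) \<Rightarrow> real" where
  "sqnorm f = mean (\<lambda>x. (cmod (f x))\<^sup>2)"

text \<open>The convolution of \<open>k\<close> with the positive definite function \<open>f * f\<^sup>\<sim>\<close>.\<close>

definition twisted_conv :: "('x::ab_group_add \<Rightarrow> real) \<Rightarrow> ('x \<Rightarrow> complex) \<Rightarrow> 'x \<Rightarrow> complex" where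
  "twisted_conv k f x = sesq f (\<lambda>p. of_real (k (x - fst p + snd p)))"

lemmas cont_rules = continuous_on_mult continuous_on_cnj continuous_on_of_real continuous_on_norm
  continuous_on_power continuous_on_fst continuous_on_snd continuous_on_id continuous_on_const
  continuous_on_add continuous_on_diff continuous_on_minus

context
  assumes c: "compact (UNIV :: 'x::topological_ab_group_add set)"
begin

lemma compact_square: "compact (UNIV :: ('x \<times> 'x) set)"
  by (rule compact_UNIV_prod[OF c c])

lemma cont_sesq:
  fixes f :: "'x \<Rightarrow> complex"
  assumes f: "continuous_on UNIV f" and h: "continuous_on UNIV h"
  shows "continuous_on UNIV (\<lambda>p. f (fst p) * cnj (f (snd p)) * h p)"
  by (intro cont_rules continuous_on_UNIV_compose[OF f] h)

text \<open>The inequality \<open>2 * a * b \<le> a^2 + b^2\<close> splits the integrand into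
  functions of one argument each, whose means are known; no Cauchy-Schwarz inequality for means is
  required.\<close>

lemma sesq_bound:
  fixes f :: "'x \<Rightarrow> complex"
  assumes f: "continuous_on UNIV f" and h: "continuous_on UNIV h" and B: "\<And>p. cmod (h p) \<le> B"
  shows "cmod (sesq f h) \<le> B * sqnorm f"
proof -
  let ?g = "\<lambda>x. (cmod (f x))\<^sup>2"
  have cg: "continuous_on UNIV ?g" by (intro cont_rules f)
  have m: "is_mean ?g (sqnorm f)" unfolding sqnorm_def by (rule mean_is_mean[OF c cg])
  have 1: "is_mean (\<lambda>p. (B / 2) * (?g (fst p) + ?g (snd p))) (B / 2 * (sqnorm f + sqnorm f))"
    by (rule is_mean_linear[OF bounded_linear_mult_right is_mean_add[OF is_mean_fst[OF m] is_mean_snd[OF m]]])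
  have B0: "B \<ge> 0" using B[of undefined] norm_ge_zero[of "h undefined"] by linarith
  have 2: "cmod (f (fst p) * cnj (f (snd p)) * h p) \<le> (B / 2) * (?g (fst p) + ?g (snd p))" for p
  proof -
    have "2 * (cmod (f (fst p)) * cmod (f (snd p))) \<le> ?g (fst p) + ?g (snd p)"
      using sum_squares_bound[of "cmod (f (fst p))" "cmod (f (snd p))"] by simp
    then have "cmod (f (fst p)) * cmod (f (snd p)) * cmod (h p) \<le> (?g (fst p) + ?g (snd p)) / 2 * B"
      by (intro mult_mono B) auto
    then show ?thesis by (simp add: norm_mult mult.commute)
  qed
  have "cmod (sesq f h) \<le> B / 2 * (sqnorm f + sqnorm f)"
    unfolding sesq_def
    by (rule is_mean_norm_le[OF mean_is_mean[OF compact_square cont_sesq[OF f h]] 1 2])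
  then show ?thesis by simp
qed

lemma sesq_diff:
  fixes f :: "'x \<Rightarrow> complex"
  assumes f: "continuous_on UNIV f" and h: "continuous_on UNIV h" and h': "continuous_on UNIV h'"
  shows "sesq f h - sesq f h' = sesq f (\<lambda>p. h p - h' p)"
  unfolding sesq_def mean_diff[OF compact_square cont_sesq[OF f h] cont_sesq[OF f h'], symmetric]
  by (simp add: algebra_simps)

lemma sesq_sum:
  fixes f :: "'x \<Rightarrow> complex" and n :: nat
  assumes f: "continuous_on UNIV f" and h: "\<And>i. i < n \<Longrightarrow> continuous_on UNIV (h i)"
  shows "(\<Sum>i<n. sesq f (h i)) = sesq f (\<lambda>p. \<Sum>i<n. h i p)"
  using h
proof (induction n)
  case 0 then show ?case by (simp add: sesq_def mean_const)
next
  case (Suc n)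
  have h1: "continuous_on UNIV (\<lambda>p. \<Sum>i<n. h i p)" by (intro continuous_on_sum) (use Suc.prems in auto)
  have h2: "continuous_on UNIV (h n)" using Suc.prems by auto
  have "sesq f (\<lambda>p. \<Sum>i<Suc n. h i p) = sesq f (\<lambda>p. \<Sum>i<n. h i p) + sesq f (h n)"
    unfolding sesq_def mean_add[OF compact_square cont_sesq[OF f h1] cont_sesq[OF f h2], symmetric]
    by (simp add: algebra_simps)
  then show ?case using Suc by simp
qed

context
  fixes k :: "'x \<Rightarrow> real"
  assumes k: "continuous_on UNIV k"
begin

lemma cont_kernel: "continuous_on UNIV (\<lambda>p::'x\<times>'x. complex_of_real (k (x - fst p + snd p)))"
  by (intro cont_rules continuous_on_UNIV_compose[OF k])

lemma twisted_conv_bound: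
  assumes f: "continuous_on UNIV f" and B: "\<And>x. \<bar>k x\<bar> \<le> B"
  shows "cmod (twisted_conv k f x) \<le> B * sqnorm f"
  unfolding twisted_conv_def by (rule sesq_bound[OF f cont_kernel]) (simp add: B)

text \<open>The modulus of continuity is that of the kernel, so one neighbourhood works for all f.
  This makes a maximising sequence equicontinuous.\<close>

lemma twisted_conv_equicont:
  assumes e: "e > 0"
  shows "\<exists>U. open U \<and> 0 \<in> U \<and> (\<forall>f x. \<forall>u\<in>U. continuous_on UNIV f \<longrightarrow>
    cmod (twisted_conv k f (x + u) - twisted_conv k f x) \<le> e * sqnorm f)"
proof -
  obtain U where U: "open U" "0 \<in> U" "\<And>x u. u \<in> U \<Longrightarrow> dist (k (x + u)) (k x) < e"
    using uniform_cont_compact_group[OF c k e] by blast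
  have "cmod (twisted_conv k f (x + u) - twisted_conv k f x) \<le> e * sqnorm f"
    if u: "u \<in> U" and f: "continuous_on UNIV f" for f x u
    unfolding twisted_conv_def sesq_diff[OF f cont_kernel cont_kernel]
  proof (rule sesq_bound[OF f])
    show "continuous_on UNIV (\<lambda>p::'x\<times>'x. complex_of_real (k (x + u - fst p + snd p)) - complex_of_real (k (x - fst p + snd p)))"
      by (intro continuous_on_diff cont_kernel)
    fix p :: "'x\<times>'x"
    have "dist (k (x - fst p + snd p + u)) (k (x - fst p + snd p)) \<le> e" using U(3)[OF u] less_imp_le by blast
    then show "cmod (complex_of_real (k (x + u - fst p + snd p)) - complex_of_real (k (x - fst p + snd p))) \<le> e"
      by (simp add: dist_real_def algebra_simps flip: of_real_diff)
  qed
  then show ?thesis using U by blast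
qed

lemma twisted_conv_cont:
  assumes f: "continuous_on UNIV f"
  shows "continuous_on UNIV (twisted_conv k f)"
proof -
  have s: "sqnorm f \<ge> 0" unfolding sqnorm_def by (rule mean_nonneg[OF c]) (auto intro!: cont_rules f)
  show ?thesis
  proof (rule group_continuousI)
    fix e :: real assume "e > 0"
    then have "e / (sqnorm f + 1) > 0" using s by simp
    from twisted_conv_equicont[OF this] obtain U where U: "open U" "0 \<in> U"
      "\<And>x u. u \<in> U \<Longrightarrow> cmod (twisted_conv k f (x + u) - twisted_conv k f x) \<le> e / (sqnorm f + 1) * sqnorm f" using f by blast
    have "e / (sqnorm f + 1) * sqnorm f \<le> e" using s \<open>e > 0\<close> by (simp add: field_simps)
    then have "\<forall>x. \<forall>u\<in>U. dist (twisted_conv k f (x + u)) (twisted_conv k f x) \<le> e"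
      using U(3) unfolding dist_norm by (meson order_trans)
    then show "\<exists>U. open U \<and> 0 \<in> U \<and> (\<forall>x. \<forall>u\<in>U. dist (twisted_conv k f (x + u)) (twisted_conv k f x) \<le> e)"
      using U by blast
  qed
qed

text \<open>Translating both arguments of f leaves the kernel unchanged, while translating only one
  of them moves x by a or by -a. All four terms of the expansion are thus translates on the product
  group, and invariance of the mean evaluates them.\<close>

lemma twisted_conv_parallelogram:
  assumes f: "continuous_on UNIV f" and w: "cmod w = 1"
  shows "twisted_conv k (\<lambda>y. f y + w * f (y + a)) x =
    2 * twisted_conv k f x + (w * twisted_conv k f (x + a) + cnj w * twisted_conv k f (x - a))"
proof -
  let ?K = "\<lambda>x (p::'x\<times>'x). complex_of_real (k (x - fst p + snd p))"
  let ?F = "\<lambda>x p. f (fst p) * cnj (f (snd p)) * ?K x p"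
  let ?s = "\<lambda>x a (p::'x\<times>'x). ?F x (p + a)"
  have cF: "continuous_on UNIV (?F x)" for x by (rule cont_sesq[OF f cont_kernel])
  have cs: "continuous_on UNIV (?s x a)" for x a
    by (rule continuous_on_UNIV_compose[OF cF]) (intro cont_rules)
  have m: "mean (?s x a) = twisted_conv k f x" for x a
    unfolding twisted_conv_def sesq_def by (rule mean_shift[OF compact_square cF])
  have ww: "w * cnj w = 1" using w by (simp add: complex_norm_square[symmetric])
  have "(f (fst p) + w * f (fst p + a)) * cnj (f (snd p) + w * f (snd p + a)) * ?K x p
      = (?s x 0 p + ?s x (a, a) p) + (w * ?s (x + a) (a, 0) p + cnj w * ?s (x - a) (0, a) p)" for p
  proof -
    have "x - (fst p + a) + (snd p + a) = x - fst p + snd p" "x + a - (fst p + a) + snd p = x - fst p + snd p"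
      "x - a - fst p + (snd p + a) = x - fst p + snd p" by (simp_all add: algebra_simps)
    moreover have "(A + w * B) * cnj (C + w * D) = A * cnj C + B * cnj D + w * (B * cnj C) + cnj w * (A * cnj D)" for A B C D
    proof -
      have "(A + w * B) * cnj (C + w * D) = A * cnj C + (w * cnj w) * (B * cnj D) + w * (B * cnj C) + cnj w * (A * cnj D)"
        by (simp add: algebra_simps)
      then show ?thesis by (simp add: ww)
    qed
    ultimately show ?thesis by (simp only: fst_add snd_add fst_conv snd_conv add_0_right fst_zero snd_zero) (simp add: algebra_simps)
  qed
  then have "twisted_conv k (\<lambda>y. f y + w * f (y + a)) x = mean (\<lambda>p.
     (?s x 0 p + ?s x (a, a) p) + (w * ?s (x + a) (a, 0) p + cnj w * ?s (x - a) (0, a) p))"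
    unfolding twisted_conv_def sesq_def by simp
  also have "\<dots> = (mean (?s x 0) + mean (?s x (a, a))) + (w * mean (?s (x + a) (a, 0)) + cnj w * mean (?s (x - a) (0, a)))"
    by (subst mean_add[OF compact_square], (intro continuous_on_add continuous_on_mult_left cs)+,
        subst mean_add[OF compact_square cs cs],
        subst mean_add[OF compact_square continuous_on_mult_left[OF cs] continuous_on_mult_left[OF cs]],
        subst mean_mult_left[OF compact_square cs], subst mean_mult_left[OF compact_square cs], rule refl)
  finally show ?thesis unfolding m by simp
qed

end
end

text \<open>This is strict convexity of the squared norm as an exact identity: the left side
  measures how far P and Q are from the ratio s : t.\<close>

lemma convex_comb_norm_sq:
  fixes P Q :: complex and s t :: real
  assumes "s + t = 1"
  shows "(cmod (of_real t * P - of_real s * Q))\<^sup>2 = t * (cmod P)\<^sup>2 + s * (cmod Q)\<^sup>2 - s * t * (cmod (P + Q))\<^sup>2"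
proof -
  have t: "t = 1 - s" using assms by simp
  show ?thesis unfolding t cmod_power2 by (simp add: power2_eq_square algebra_simps)
qed

context
  assumes c: "compact (UNIV :: 'x::topological_ab_group_add set)"
begin

lemma sqnorm_nonneg: "continuous_on UNIV f \<Longrightarrow> sqnorm (f :: 'x \<Rightarrow> complex) \<ge> 0"
  unfolding sqnorm_def by (rule mean_nonneg[OF c]) (auto intro!: cont_rules)

lemma sqnorm_parallelogram:
  fixes u v :: "'x \<Rightarrow> complex"
  assumes u: "continuous_on UNIV u" and v: "continuous_on UNIV v"
  shows "sqnorm (\<lambda>x. u x + v x) + sqnorm (\<lambda>x. u x - v x) = 2 * sqnorm u + 2 * sqnorm v"
proof -
  have cu: "continuous_on UNIV (\<lambda>x. (cmod (u x))\<^sup>2)" "continuous_on UNIV (\<lambda>x. (cmod (v x))\<^sup>2)"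
    "continuous_on UNIV (\<lambda>x. (cmod (u x + v x))\<^sup>2)" "continuous_on UNIV (\<lambda>x. (cmod (u x - v x))\<^sup>2)"
    by (auto intro!: continuous_on_power continuous_on_norm continuous_on_add continuous_on_diff u v)
  have eq: "(cmod (u x + v x))\<^sup>2 + (cmod (u x - v x))\<^sup>2 = 2 * (cmod (u x))\<^sup>2 + 2 * (cmod (v x))\<^sup>2" for x
    unfolding cmod_power2 by (simp add: power2_eq_square algebra_simps)
  have "sqnorm (\<lambda>x. u x + v x) + sqnorm (\<lambda>x. u x - v x) = mean (\<lambda>x. 2 * (cmod (u x))\<^sup>2 + 2 * (cmod (v x))\<^sup>2)"
    unfolding sqnorm_def mean_add[OF c cu(3,4), symmetric] eq ..
  also have "\<dots> = 2 * sqnorm u + 2 * sqnorm v"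
    unfolding sqnorm_def mean_add[OF c continuous_on_mult_left[OF cu(1)] continuous_on_mult_left[OF cu(2)]]
      mean_mult_left[OF c cu(1)] mean_mult_left[OF c cu(2)] ..
  finally show ?thesis .
qed

lemma sqnorm_scale:
  fixes f :: "'x \<Rightarrow> complex"
  assumes f: "continuous_on UNIV f"
  shows "sqnorm (\<lambda>x. s * f x) = (cmod s)\<^sup>2 * sqnorm f"
proof -
  have cf: "continuous_on UNIV (\<lambda>x. (cmod (f x))\<^sup>2)" by (intro cont_rules f)
  show ?thesis unfolding sqnorm_def norm_mult power_mult_distrib by (rule mean_mult_left[OF c cf])
qed

lemma sqnorm_shift:
  fixes f :: "'x \<Rightarrow> complex"
  assumes f: "continuous_on UNIV f"
  shows "sqnorm (\<lambda>x. f (x + a)) = sqnorm f"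
proof -
  have cf: "continuous_on UNIV (\<lambda>x. (cmod (f x))\<^sup>2)" by (intro cont_rules f)
  show ?thesis unfolding sqnorm_def by (rule mean_shift[OF c cf])
qed

lemma sqnorm_le_const:
  fixes f :: "'x \<Rightarrow> complex"
  assumes f: "continuous_on UNIV f" and le: "\<And>x. cmod (f x) \<le> B"
  shows "sqnorm f \<le> B\<^sup>2"
proof -
  have "sqnorm f \<le> mean (\<lambda>x::'x. B\<^sup>2)"
    unfolding sqnorm_def by (rule mean_mono[OF c]) (auto intro!: cont_rules f power_mono le)
  then show ?thesis by (simp add: mean_const)
qed

lemma sqnorm_eq_0_imp:
  fixes f :: "'x \<Rightarrow> complex"
  assumes f: "continuous_on UNIV f" and "sqnorm f \<le> 0"
  shows "f x = 0"
proof -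
  have "(cmod (f x))\<^sup>2 = 0"
    by (rule mean_eq_0_imp[OF c]) (use assms in \<open>auto intro!: cont_rules simp: sqnorm_def\<close>)
  then show ?thesis by simp
qed

text \<open>The parallelogram law replaces the triangle inequality of the mean-square norm, at the
  price of the factors 2.\<close>

lemma sqnorm_approx:
  fixes u v :: "'x \<Rightarrow> complex"
  assumes u: "continuous_on UNIV u" and v: "continuous_on UNIV v" and e: "\<And>x. cmod (u x - v x) \<le> e"
  shows "sqnorm u \<le> 2 * sqnorm v + 2 * e\<^sup>2"
proof -
  have d: "continuous_on UNIV (\<lambda>x. u x - v x)" by (intro continuous_on_diff u v)
  have "sqnorm (\<lambda>x. v x + (u x - v x)) + sqnorm (\<lambda>x. v x - (u x - v x)) = 2 * sqnorm v + 2 * sqnorm (\<lambda>x. u x - v x)"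
    by (rule sqnorm_parallelogram[OF v d])
  moreover have "sqnorm (\<lambda>x. v x - (u x - v x)) \<ge> 0"
    by (rule sqnorm_nonneg) (intro continuous_on_diff u v)
  moreover have "sqnorm (\<lambda>x. u x - v x) \<le> e\<^sup>2" by (rule sqnorm_le_const[OF d e])
  ultimately show ?thesis by simp
qed

context
  fixes k :: "'x \<Rightarrow> real"
  assumes k: "continuous_on UNIV k"
begin

lemma twisted_conv_scale:
  assumes f: "continuous_on UNIV f"
  shows "twisted_conv k (\<lambda>x. s * f x) x = (cmod s)\<^sup>2 * twisted_conv k f x"
proof -
  have "s * a * cnj (s * b) * h = (cmod s)\<^sup>2 * (a * cnj b * h)" for a b h
    using complex_norm_square[of s] by (simp add: algebra_simps)
  then show ?thesis unfolding twisted_conv_def sesq_def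
    by (simp only: mean_mult_left[OF compact_square[OF c] cont_sesq[OF c f cont_kernel[OF c k]]])
qed

text \<open>The parallelogram law makes the averaged twisted convolution of \<open>f \<plusminus> w f(\<cdot> + a)\<close> equal to
  that of \<open>f\<close>, so a near-maximiser of a uniformly convex functional must be nearly proportional to
  each of the two summands.\<close>

lemma twisted_conv_near_max:
  assumes f: "continuous_on UNIV f" and n1: "sqnorm f = 1" and w: "cmod w = 1"
    and S: "\<And>h. continuous_on UNIV h \<Longrightarrow> sqnorm (twisted_conv k h) \<le> S * (sqnorm h)\<^sup>2"
  shows "\<exists>r. \<bar>r\<bar> \<le> 1 \<and> sqnorm (\<lambda>x. w * twisted_conv k f (x + a) + cnj w * twisted_conv k f (x - a)
      - 2 * of_real r * twisted_conv k f x) \<le> 4 * (S - sqnorm (twisted_conv k f))"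
proof -
  define fp where "fp = (\<lambda>y. f y + w * f (y + a))"
  define fm where "fm = (\<lambda>y. f y + (-w) * f (y + a))"
  have ca: "continuous_on UNIV (\<lambda>y. f (y + a))"
    by (intro continuous_on_UNIV_compose[OF f] cont_rules)
  have cp: "continuous_on UNIV fp" unfolding fp_def by (intro continuous_on_add continuous_on_mult_left f ca)
  have cm: "continuous_on UNIV fm" unfolding fm_def by (intro continuous_on_add continuous_on_mult_left f ca)
  \<comment> \<open>The parallelogram law gives \<open>fp\<close> and \<open>fm\<close> the total
    square norm 4, so these quarters are convex weights.\<close>
  define s where "s = sqnorm fp / 4"
  define t where "t = sqnorm fm / 4"
  have "sqnorm fp + sqnorm fm = 2 * sqnorm f + 2 * sqnorm (\<lambda>y. w * f (y + a))"
    using sqnorm_parallelogram[OF f continuous_on_mult_left[OF ca, of w]] by (simp add: fp_def fm_def)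
  then have st: "s + t = 1" using w by (simp add: s_def t_def sqnorm_scale[OF ca] sqnorm_shift[OF f] n1)
  have s0: "s \<ge> 0" "t \<ge> 0" using sqnorm_nonneg[OF cp] sqnorm_nonneg[OF cm] by (auto simp: s_def t_def)
  let ?P = "twisted_conv k fp" and ?Q = "twisted_conv k fm" and ?T = "twisted_conv k f"
  define E where "E = (\<lambda>x. w * ?T (x + a) + cnj w * ?T (x - a))"
  have P: "?P x = 2 * ?T x + E x" for x
    unfolding fp_def E_def by (rule twisted_conv_parallelogram[OF c k f w])
  have Q: "?Q x = 2 * ?T x - E x" for x
  proof -
    have "cmod (- w) = 1" using w by simp
    from twisted_conv_parallelogram[OF c k f this] show ?thesis unfolding fm_def E_def by simp
  qed
  have cT: "continuous_on UNIV ?T" "continuous_on UNIV ?P" "continuous_on UNIV ?Q"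
    using twisted_conv_cont[OF c k] f cp cm by auto
  have c2: "continuous_on UNIV (\<lambda>x. (cmod (?T x))\<^sup>2)" "continuous_on UNIV (\<lambda>x. (cmod (?P x))\<^sup>2)"
    "continuous_on UNIV (\<lambda>x. (cmod (?Q x))\<^sup>2)"
    by (auto intro!: continuous_on_power continuous_on_norm cT)
  have D: "E x - 2 * of_real (s - t) * ?T x = of_real t * ?P x - of_real s * ?Q x" for x
  proof -
    have "of_real t * ?P x - of_real s * ?Q x = of_real (s + t) * E x - 2 * of_real (s - t) * ?T x"
      unfolding P Q by (simp add: algebra_simps)
    then show ?thesis by (simp only: st of_real_1 mult_1)
  qed
  have "(cmod (E x - 2 * of_real (s - t) * ?T x))\<^sup>2
      = t * (cmod (?P x))\<^sup>2 + s * (cmod (?Q x))\<^sup>2 - (16 * (s * t)) * (cmod (?T x))\<^sup>2" for x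
  proof -
    have "?P x + ?Q x = 4 * ?T x" unfolding P Q by simp
    then show ?thesis unfolding D convex_comb_norm_sq[OF st] by (simp add: norm_mult power_mult_distrib)
  qed
  then have "sqnorm (\<lambda>x. E x - 2 * of_real (s - t) * ?T x)
     = mean (\<lambda>x. t * (cmod (?P x))\<^sup>2 + s * (cmod (?Q x))\<^sup>2 - (16 * (s * t)) * (cmod (?T x))\<^sup>2)"
    unfolding sqnorm_def by simp
  also have "\<dots> = (t * sqnorm ?P + s * sqnorm ?Q) - (16 * (s * t)) * sqnorm ?T"
    unfolding sqnorm_def
    mean_diff[OF c continuous_on_add[OF continuous_on_mult_left[OF c2(2)] continuous_on_mult_left[OF c2(3)]] continuous_on_mult_left[OF c2(1)]]
    mean_add[OF c continuous_on_mult_left[OF c2(2)] continuous_on_mult_left[OF c2(3)]]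
    mean_mult_left[OF c c2(1)] mean_mult_left[OF c c2(2)] mean_mult_left[OF c c2(3)] ..
  \<comment> \<open>The bound of degree two in \<open>sqnorm\<close> produces
    \<open>16 * s^2 * t\<close> and \<open>16 * s * t^2\<close>. Together with
    \<open>s + t = 1\<close> this leaves the common factor \<open>16 * (s * t)\<close> in front of
    the defect of f.\<close>
  also have "\<dots> \<le> (t * (S * (4 * s)\<^sup>2) + s * (S * (4 * t)\<^sup>2)) - (16 * (s * t)) * sqnorm ?T"
    using S[OF cp] S[OF cm] s0 by (intro diff_mono add_mono mult_left_mono order_refl) (auto simp: s_def t_def)
  also have "\<dots> = 16 * (s * t) * (S * (s + t) - sqnorm ?T)"
    by (simp add: power2_eq_square algebra_simps)
  also have "\<dots> = 16 * (s * t) * (S - sqnorm ?T)" by (simp add: st)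
  \<comment> \<open>The product of weights with sum 1 is at most 1/4.\<close>
  also have "\<dots> \<le> 4 * (S - sqnorm ?T)"
  proof (rule mult_right_mono)
    have "0 \<le> (s - t)\<^sup>2" by simp
    then have "4 * (s * t) \<le> (s + t)\<^sup>2" by (simp add: power2_eq_square algebra_simps)
    then show "16 * (s * t) \<le> 4" by (simp add: st)
    show "0 \<le> S - sqnorm ?T" using S[OF f] n1 by simp
  qed
  finally show ?thesis using s0 st by (intro exI[of _ "s - t"]) (auto simp: E_def abs_le_iff)
qed

text \<open>The factor r supplied by \<open>twisted_conv_near_max\<close> varies with the
  approximating function. Instead of extracting a limit of these factors, the defect
  \<open>q\<close> of the limit g is regarded as a quadratic polynomial in r and minimised over the
  compact interval that contains them all; its minimum is arbitrarily small, hence zero.\<close>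

lemma quadratic_limit:
  assumes g: "continuous_on UNIV g" and w: "cmod w = 1" and S: "\<And>h. continuous_on UNIV h \<Longrightarrow> sqnorm (twisted_conv k h) \<le> S * (sqnorm h)\<^sup>2"
    and approx: "\<And>e. e > 0 \<Longrightarrow> \<exists>f. continuous_on UNIV f \<and> sqnorm f = 1 \<and> S - sqnorm (twisted_conv k f) \<le> e
        \<and> (\<forall>x. cmod (twisted_conv k f x - g x) \<le> e)"
  shows "\<exists>r::real. \<forall>x. w * g (x + a) + cnj w * g (x - a) = 2 * of_real r * g x"
proof -
  define u where "u = (\<lambda>x. w * g (x + a) + cnj w * g (x - a))"
  have cu: "continuous_on UNIV u" unfolding u_def
    by (intro continuous_on_add continuous_on_mult_left continuous_on_UNIV_compose[OF g] cont_rules)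
  define q where "q = (\<lambda>r::real. sqnorm (\<lambda>x. u x - 2 * of_real r * g x))"
  have cq: "continuous_on UNIV (\<lambda>x. u x - 2 * of_real r * g x)" for r :: real
    by (intro continuous_on_diff cu continuous_on_mult_left g)
  define \<beta> where "\<beta> = mean (\<lambda>x. Re (u x * cnj (g x)))"
  have q: "q r = (sqnorm u + (-4 * r) * \<beta>) + (4 * r\<^sup>2) * sqnorm g" for r
  proof -
    have 1: "continuous_on UNIV (\<lambda>x. (cmod (u x))\<^sup>2)" "continuous_on UNIV (\<lambda>x. (cmod (g x))\<^sup>2)"
      "continuous_on UNIV (\<lambda>x. Re (u x * cnj (g x)))"
      using continuous_on_Re[OF continuous_on_mult[OF cu continuous_on_cnj[OF g]]]
      by (auto intro!: continuous_on_power continuous_on_norm cu g simp del: complex_mult_cnj times_complex.sel)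
    have "(cmod (u x - 2 * of_real r * g x))\<^sup>2 = ((cmod (u x))\<^sup>2 + (-4 * r) * Re (u x * cnj (g x))) + (4 * r\<^sup>2) * (cmod (g x))\<^sup>2" for x
      unfolding cmod_power2 by (simp add: power2_eq_square algebra_simps)
    then have "q r = mean (\<lambda>x. ((cmod (u x))\<^sup>2 + (-4 * r) * Re (u x * cnj (g x))) + (4 * r\<^sup>2) * (cmod (g x))\<^sup>2)"
      unfolding q_def sqnorm_def by simp
    also have "\<dots> = (sqnorm u + (-4 * r) * \<beta>) + (4 * r\<^sup>2) * sqnorm g"
      unfolding sqnorm_def \<beta>_def
        mean_add[OF c continuous_on_add[OF 1(1) continuous_on_mult_left[OF 1(3)]] continuous_on_mult_left[OF 1(2)]]
        mean_add[OF c 1(1) continuous_on_mult_left[OF 1(3)]]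
        mean_mult_left[OF c 1(2)] mean_mult_left[OF c 1(3)] ..
    finally show ?thesis .
  qed
  have "continuous_on {-1..1} q" unfolding q by (intro continuous_intros)
  then obtain r0 where r0: "r0 \<in> {-1..1}" "\<And>r. r \<in> {-1..1} \<Longrightarrow> q r0 \<le> q r"
    using continuous_attains_inf[of "{-1..1::real}" q] by auto
  \<comment> \<open>Replacing the twisted convolution by g changes the defect by at most
    \<open>4 * e\<close> pointwise, so \<open>sqnorm_approx\<close> gives
    \<open>8 * e + 32 * e^2\<close>, which is at most \<open>40 * e\<close> as e is at most
    1.\<close>
  have small: "q r0 \<le> 40 * e" if e: "0 < e" "e \<le> 1" for e
  proof -
    obtain f where f: "continuous_on UNIV f" "sqnorm f = 1" "S - sqnorm (twisted_conv k f) \<le> e"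
        "\<And>x. cmod (twisted_conv k f x - g x) \<le> e" using approx[OF e(1)] by blast
    let ?T = "twisted_conv k f"
    obtain r where r: "\<bar>r\<bar> \<le> 1" "sqnorm (\<lambda>x. w * ?T (x + a) + cnj w * ?T (x - a)
      - 2 * of_real r * ?T x) \<le> 4 * (S - sqnorm ?T)"
      using twisted_conv_near_max[OF f(1,2) w S, of a] by blast
    have cT: "continuous_on UNIV ?T" by (rule twisted_conv_cont[OF c k f(1)])
    have "q r \<le> 2 * sqnorm (\<lambda>x. w * ?T (x + a) + cnj w * ?T (x - a) - 2 * of_real r * ?T x) + 2 * (4 * e)\<^sup>2"
      unfolding q_def
    proof (rule sqnorm_approx[OF cq])
      show "continuous_on UNIV (\<lambda>x. w * ?T (x + a) + cnj w * ?T (x - a) - 2 * of_real r * ?T x)"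
        by (intro continuous_on_diff continuous_on_add continuous_on_mult_left continuous_on_UNIV_compose[OF cT] cT cont_rules)
      fix x
      have eq: "u x - 2 * of_real r * g x - (w * ?T (x + a) + cnj w * ?T (x - a) - 2 * of_real r * ?T x)
        = w * (g (x + a) - ?T (x + a)) + cnj w * (g (x - a) - ?T (x - a)) + (2 * of_real r) * (?T x - g x)"
        by (simp add: u_def algebra_simps)
      have "cmod (w * (g (x + a) - ?T (x + a))) \<le> e" "cmod (cnj w * (g (x - a) - ?T (x - a))) \<le> e"
        using f(4) w by (simp_all add: norm_mult norm_minus_commute)
      moreover have "cmod ((2 * of_real r) * (?T x - g x)) \<le> 2 * e"
      proof -
        have "\<bar>r\<bar> * cmod (?T x - g x) \<le> 1 * e" using r(1) f(4) by (intro mult_mono) auto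
        then show ?thesis by (simp add: norm_mult)
      qed
      ultimately have "cmod (w * (g (x + a) - ?T (x + a)) + cnj w * (g (x - a) - ?T (x - a)) + (2 * of_real r) * (?T x - g x)) \<le> (e + e) + 2 * e"
        by (intro norm_triangle_mono)
      then show "cmod (u x - 2 * of_real r * g x - (w * ?T (x + a) + cnj w * ?T (x - a) - 2 * of_real r * ?T x)) \<le> 4 * e"
        unfolding eq by simp
    qed
    also have "\<dots> \<le> 2 * (4 * e) + 2 * (4 * e)\<^sup>2" using r(2) f(3) by simp
    also have "\<dots> \<le> 40 * e" using e by (simp add: power2_eq_square mult_left_le)
    finally show ?thesis using r0(2)[of r] r(1) by (simp add: abs_le_iff)
  qed
  have "q r0 \<le> 0"
  proof (rule ccontr)
    assume "\<not> q r0 \<le> 0"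
    \<comment> \<open>A value of at least 80 contradicts e = 1; for a smaller value the choice
      \<open>q r0 / 80\<close> yields half of \<open>q r0\<close> as an upper bound for it.\<close>
    then show False using small[of 1] small[of "q r0 / 80"] by (cases "q r0 \<ge> 80") auto
  qed
  then have "u x - 2 * of_real r0 * g x = 0" for x
    unfolding q_def by (rule sqnorm_eq_0_imp[OF cq])
  then show ?thesis unfolding u_def by (intro exI[of _ r0]) simp
qed

end
end

section \<open>Construction of a separating character\<close>

lemma pontryagin_dual_iff:
  "\<phi> \<in> pontryagin_dual \<longleftrightarrow> continuous_on UNIV \<phi> \<and> (\<forall>x. cmod (\<phi> x) = 1) \<and> (\<forall>x y. \<phi> (x + y) = \<phi> x * \<phi> y)"
  by (simp add: pontryagin_dual_def)

text \<open>This makes the supremum in \<open>peter_weyl\<close> positive. A bump concentrated where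
  the differences of its arguments keep the kernel positive has an integrand of one sign.\<close>

lemma exists_bump:
  fixes \<rho> :: "'x::topological_ab_group_add \<Rightarrow> 'x \<Rightarrow> real" and k :: "'x \<Rightarrow> real"
  assumes c: "compact (UNIV :: 'x set)" and rho: "compatible_metric \<rho>"
    and k: "continuous_on UNIV k" and k0: "k 0 > 0"
  shows "\<exists>f. continuous_on UNIV f \<and> twisted_conv k f 0 \<noteq> 0"
proof -
  define W where "W = {x. k x > k 0 / 2}"
  have "open {p::'x\<times>'x. 0 - fst p + snd p \<in> W}"
    unfolding W_def mem_Collect_eq by (intro open_Collect_less continuous_on_UNIV_compose[OF k] cont_rules)
  moreover have "(0, 0) \<in> {p::'x\<times>'x. 0 - fst p + snd p \<in> W}" using k0 by (simp add: W_def)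
  ultimately obtain A B where AB: "open A" "open B" "(0, 0) \<in> A \<times> B" "A \<times> B \<subseteq> {p::'x\<times>'x. 0 - fst p + snd p \<in> W}"
    by (rule open_prod_elim)
  then have "open (A \<inter> B)" "0 \<in> A \<inter> B" by auto
  then obtain d where d: "d > 0" "\<And>y. \<rho> 0 y < d \<Longrightarrow> y \<in> A \<inter> B"
    using compatible_metric_ball[OF rho, of "A \<inter> B" 0] by blast
  define b where "b = (\<lambda>y. max 0 (d - \<rho> 0 y))"
  have cb: "continuous_on UNIV b" unfolding b_def
    by (intro continuous_on_max continuous_on_const continuous_on_diff
        compatible_metric_continuous[OF rho] continuous_on_id)
  define f where "f = (\<lambda>y. complex_of_real (b y))"
  have cf: "continuous_on UNIV f" unfolding f_def by (intro cont_rules cb)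
  define F where "F = (\<lambda>p::'x\<times>'x. b (fst p) * b (snd p) * k (0 - fst p + snd p))"
  have cF: "continuous_on UNIV F" unfolding F_def
    by (intro cont_rules continuous_on_UNIV_compose[OF cb] continuous_on_UNIV_compose[OF k])
  have b0: "b y \<ge> 0" for y by (simp add: b_def)
  have inAB: "y \<in> A \<inter> B" if "b y > 0" for y using that d(2) by (auto simp: b_def max_def split: if_splits)
  have "F p \<ge> 0" for p
  proof (cases "b (fst p) > 0 \<and> b (snd p) > 0")
    case True
    then have "fst p \<in> A" "snd p \<in> B" using inAB by auto
    then have "0 - fst p + snd p \<in> W" using AB(4) by (cases p) auto
    then have "k (0 - fst p + snd p) > 0" using k0 by (simp add: W_def)
    then show ?thesis using b0 by (simp add: F_def)
  next
    case False
    then have "b (fst p) = 0 \<or> b (snd p) = 0" using b0 by (metis less_eq_real_def)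
    then show ?thesis by (auto simp: F_def)
  qed
  moreover have "F 0 > 0" using d(1) k0 compatible_metric_simps(3)[OF rho, of 0 0] by (simp add: F_def b_def)
  ultimately have "mean F > 0" by (rule mean_pos[OF compact_square[OF c] cF])
  moreover have "twisted_conv k f 0 = mean (\<lambda>p. complex_of_real (F p))"
    unfolding twisted_conv_def sesq_def F_def f_def by simp
  moreover have "mean (\<lambda>p. complex_of_real (F p)) = complex_of_real (mean F)"
    by (rule mean_linear[OF compact_square[OF c] cF bounded_linear_of_real])
  ultimately show ?thesis using cf by force
qed

text \<open>The kernel is a coboundary along \<open>x0\<close>, so its sums over the multiples of
  \<open>x0\<close> telescope and stay bounded uniformly in N. A limit function that is constant
  along these multiples would make them grow linearly.\<close>

lemma twisted_conv_telescope:
  fixes \<psi> :: "'x::topological_ab_group_add \<Rightarrow> real"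
  assumes c: "compact (UNIV :: 'x set)" and psi: "continuous_on UNIV \<psi>" and R: "\<And>x. \<bar>\<psi> x\<bar> \<le> R"
    and f: "continuous_on UNIV f"
  shows "cmod (\<Sum>i<N. twisted_conv (\<lambda>x. \<psi> x - \<psi> (x + x0)) f (x + multiples i x0)) \<le> 2 * R * sqnorm f"
proof -
  let ?k = "\<lambda>x. \<psi> x - \<psi> (x + x0)"
  have ck: "continuous_on UNIV ?k"
    by (intro continuous_on_diff psi continuous_on_UNIV_compose[OF psi] cont_rules)
  let ?h = "\<lambda>i (p::'x\<times>'x). complex_of_real (?k (x + multiples i x0 - fst p + snd p))"
  have ch: "continuous_on UNIV (?h i)" for i by (rule cont_kernel[OF c ck])
  have "(\<Sum>i<N. twisted_conv ?k f (x + multiples i x0)) = sesq f (\<lambda>p. \<Sum>i<N. ?h i p)"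
    unfolding twisted_conv_def by (rule sesq_sum[OF c f ch])
  moreover have "cmod (sesq f (\<lambda>p. \<Sum>i<N. ?h i p)) \<le> 2 * R * sqnorm f"
  proof (rule sesq_bound[OF c f])
    show "continuous_on UNIV (\<lambda>p. \<Sum>i<N. ?h i p)" by (intro continuous_on_sum ch)
    fix p :: "'x \<times> 'x"
    have "(\<Sum>i<N. ?k (x + multiples i x0 - fst p + snd p)) = \<psi> (x - fst p + snd p) - \<psi> (x + multiples N x0 - fst p + snd p)"
      by (induction N) (auto simp: algebra_simps)
    moreover have "\<bar>\<psi> (x - fst p + snd p) - \<psi> (x + multiples N x0 - fst p + snd p)\<bar> \<le> 2 * R"
      using R[of "x - fst p + snd p"] R[of "x + multiples N x0 - fst p + snd p"] by linarith
    ultimately show "cmod (\<Sum>i<N. ?h i p) \<le> 2 * R"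
      unfolding of_real_sum[symmetric] norm_of_real by simp
  qed
  ultimately show ?thesis by simp
qed

text \<open>A value of modulus above 1 would have unbounded powers; applied to x and to -x this
  forces modulus 1.\<close>

lemma bounded_hom_is_character:
  fixes \<kappa> :: "'x::topological_ab_group_add \<Rightarrow> complex"
  assumes c: "compact (UNIV :: 'x set)" and cont: "continuous_on UNIV \<kappa>"
    and mult: "\<And>x y. \<kappa> (x + y) = \<kappa> x * \<kappa> y" and one: "\<kappa> 0 = 1"
  shows "\<kappa> \<in> pontryagin_dual"
proof -
  obtain M where M: "\<And>x. cmod (\<kappa> x) \<le> M" using bounded_cont_compact[OF c cont] by blast
  have pw: "\<kappa> (multiples n x) = \<kappa> x ^ n" for n x by (induction n) (auto simp: one mult)
  have le: "cmod (\<kappa> x) \<le> 1" for x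
  proof (rule ccontr)
    assume "\<not> cmod (\<kappa> x) \<le> 1"
    then obtain n where "M < cmod (\<kappa> x) ^ n" using real_arch_pow[of "cmod (\<kappa> x)" M] by auto
    then show False using M[of "multiples n x"] by (simp add: pw norm_power)
  qed
  have "cmod (\<kappa> x) = 1" for x
  proof -
    have "\<kappa> x * \<kappa> (- x) = 1" using mult[of x "- x"] one by simp
    then have "cmod (\<kappa> x) * cmod (\<kappa> (- x)) = 1" by (metis norm_mult norm_one)
    moreover have "cmod (\<kappa> x) * cmod (\<kappa> (- x)) \<le> cmod (\<kappa> x) * 1" using le by (intro mult_left_mono) auto
    ultimately show ?thesis using le[of x] by simp
  qed
  then show ?thesis using cont mult by (simp add: pontryagin_dual_iff)
qed

text \<open>S is the supremum over functions of square norm 1. Scaling by s multiplies the twisted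
  convolution by \<open>(cmod s)^2\<close> and hence its square norm by the fourth power, which
  explains the square on \<open>sqnorm h\<close>.\<close>

lemma twisted_conv_sup:
  fixes k :: "'x::topological_ab_group_add \<Rightarrow> real"
  assumes c: "compact (UNIV :: 'x set)" and k: "continuous_on UNIV k"
  obtains S where "\<And>h. continuous_on UNIV h \<Longrightarrow> sqnorm (twisted_conv k h) \<le> S * (sqnorm h)\<^sup>2"
    "\<And>e. e > 0 \<Longrightarrow> \<exists>h. continuous_on UNIV h \<and> sqnorm h = 1 \<and> S - sqnorm (twisted_conv k h) < e"
proof -
  obtain B where B: "\<And>x. \<bar>k x\<bar> \<le> B" using bounded_cont_compact[OF c k] by auto
  let ?A = "{sqnorm (twisted_conv k h) | h. continuous_on UNIV h \<and> sqnorm h = 1}"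
  have Tb: "sqnorm (twisted_conv k h) \<le> (B * sqnorm h)\<^sup>2" if h: "continuous_on UNIV h" for h
    by (rule sqnorm_le_const[OF c twisted_conv_cont[OF c k h] twisted_conv_bound[OF c k h B]])
  have bdd: "bdd_above ?A" by (rule bdd_aboveI[of _ "B\<^sup>2"]) (use Tb in fastforce)
  have "sqnorm (\<lambda>x::'x. 1) = 1" by (simp add: sqnorm_def mean_const)
  then have ne: "?A \<noteq> {}" using continuous_on_const by blast
  let ?S = "Sup ?A"
  have 1: "sqnorm (twisted_conv k h) \<le> ?S * (sqnorm h)\<^sup>2" if h: "continuous_on UNIV h" for h
  proof (cases "sqnorm h = 0")
    case True then show ?thesis using Tb[OF h] by simp
  next
    case False
    then have pos: "sqnorm h > 0" using sqnorm_nonneg[OF c h] by simp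
    define s where "s = complex_of_real (1 / sqrt (sqnorm h))"
    have s2: "(cmod s)\<^sup>2 = 1 / sqnorm h" using pos by (simp add: s_def norm_divide power_divide)
    have ch: "continuous_on UNIV (\<lambda>x. s * h x)" by (intro continuous_on_mult_left h)
    have "sqnorm (\<lambda>x. s * h x) = 1" using pos by (simp add: sqnorm_scale[OF c h] s2)
    then have "sqnorm (twisted_conv k (\<lambda>x. s * h x)) \<le> ?S" using ch bdd by (intro cSup_upper) auto
    moreover have "twisted_conv k (\<lambda>x. s * h x) = (\<lambda>x. (cmod s)\<^sup>2 * twisted_conv k h x)"
      using twisted_conv_scale[OF c k h] by auto
    moreover have "sqnorm (\<lambda>x. complex_of_real ((cmod s)\<^sup>2) * twisted_conv k h x) = (cmod (complex_of_real ((cmod s)\<^sup>2)))\<^sup>2 * sqnorm (twisted_conv k h)"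
      by (rule sqnorm_scale[OF c twisted_conv_cont[OF c k h]])
    ultimately have "(1 / sqnorm h)\<^sup>2 * sqnorm (twisted_conv k h) \<le> ?S"
      using pos by (simp add: s2 norm_divide del: of_real_power)
    then show ?thesis using pos by (simp add: field_simps power2_eq_square)
  qed
  have 2: "\<exists>h. continuous_on UNIV h \<and> sqnorm h = 1 \<and> ?S - sqnorm (twisted_conv k h) < e" if "e > 0" for e
  proof -
    have "?S - e < ?S" using that by simp
    then obtain y where "y \<in> ?A" "?S - e < y" using less_cSup_iff[OF ne bdd] by blast
    then show ?thesis by force
  qed
  show ?thesis using that 1 2 by blast
qed

text \<open>The limit of a maximising sequence is multiplied by a scalar under every translation, so
  it is a multiple of a character. Positivity of the supremum keeps it from vanishing, and the
  telescoping kernel keeps the character from being trivial at \<open>x0\<close>.\<close>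

theorem peter_weyl:
  fixes \<rho> :: "'x::topological_ab_group_add \<Rightarrow> 'x \<Rightarrow> real" and x0 :: 'x
  assumes c: "compact (UNIV :: 'x set)" and rho: "compatible_metric \<rho>" and x0: "x0 \<noteq> 0"
  shows "\<exists>\<kappa>\<in>pontryagin_dual. \<kappa> x0 \<noteq> 1"
proof -
  define \<psi> where "\<psi> = (\<lambda>x. \<rho> x x0)"
  define k where "k = (\<lambda>x. \<psi> x - \<psi> (x + x0))"
  have cpsi: "continuous_on UNIV \<psi>" unfolding \<psi>_def
    by (intro compatible_metric_continuous[OF rho] continuous_on_id continuous_on_const)
  have ck: "continuous_on UNIV k" unfolding k_def
    by (intro continuous_on_diff cpsi continuous_on_UNIV_compose[OF cpsi] cont_rules)
  have k0: "k 0 > 0"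
    using x0 compatible_metric_simps(1)[OF rho, of 0 x0] compatible_metric_simps(3)[OF rho, of 0 x0]
      compatible_metric_simps(3)[OF rho, of x0 x0] by (simp add: k_def \<psi>_def)
  obtain R where R: "\<And>x. \<bar>\<psi> x\<bar> \<le> R" using bounded_cont_compact[OF c cpsi] by auto
  obtain B where B: "\<And>x. \<bar>k x\<bar> \<le> B" using bounded_cont_compact[OF c ck] by auto
  let ?T = "twisted_conv k"
  obtain S where S: "\<And>h. continuous_on UNIV h \<Longrightarrow> sqnorm (?T h) \<le> S * (sqnorm h)\<^sup>2"
    "\<And>e. e > 0 \<Longrightarrow> \<exists>h. continuous_on UNIV h \<and> sqnorm h = 1 \<and> S - sqnorm (?T h) < e"
    using twisted_conv_sup[OF c ck] by metis
  have Spos: "S > 0"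
  proof -
    obtain f where f: "continuous_on UNIV f" "?T f 0 \<noteq> 0" using exists_bump[OF c rho ck k0] by blast
    have "sqnorm (?T f) > 0"
      using sqnorm_eq_0_imp[OF c twisted_conv_cont[OF c ck f(1)], of 0] f(2) by force
    then have "S * (sqnorm f)\<^sup>2 > 0" using S(1)[OF f(1)] by linarith
    then show ?thesis by (simp add: zero_less_mult_iff)
  qed
  have "\<forall>n. \<exists>h. continuous_on UNIV h \<and> sqnorm h = 1 \<and> S - sqnorm (?T h) < inverse (real (Suc n))"
    using S(2) by simp
  then obtain f where "\<forall>n. continuous_on UNIV (f n) \<and> sqnorm (f n) = 1 \<and> S - sqnorm (?T (f n)) < inverse (real (Suc n))"
    by (rule choice[THEN exE])
  then have f: "continuous_on UNIV (f n)" "sqnorm (f n) = 1"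
    "S - sqnorm (?T (f n)) < inverse (real (Suc n))" for n by blast+
  have "\<exists>g. continuous_on UNIV g \<and> (\<forall>e>0. \<forall>N. \<exists>n\<ge>N. \<forall>x. dist (?T (f n) x) (g x) \<le> e)"
  proof (rule equicont_cluster[OF c, where a=0 and B=B])
    show "dist 0 (?T (f n) x) \<le> B" for n x using twisted_conv_bound[OF c ck f(1)[of n] B, of x] by (simp add: f(2))
    fix e :: real assume "e > 0"
    from twisted_conv_equicont[OF c ck this] show "\<exists>U. open U \<and> 0 \<in> U \<and> (\<forall>n x. \<forall>u\<in>U. dist (?T (f n) (x + u)) (?T (f n) x) \<le> e)"
      unfolding dist_norm using f(1,2) by (metis mult.right_neutral)
  qed
  then obtain g where g: "continuous_on UNIV g" "\<And>e N. e > 0 \<Longrightarrow> \<exists>n\<ge>N. \<forall>x. dist (?T (f n) x) (g x) \<le> e" by blast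
  have approx: "\<exists>h. continuous_on UNIV h \<and> sqnorm h = 1 \<and> S - sqnorm (?T h) \<le> e \<and> (\<forall>x. cmod (?T h x - g x) \<le> e)"
    if e: "e > 0" for e
  proof -
    obtain N where N: "inverse (real (Suc N)) < e" using reals_Archimedean[OF e] by auto
    obtain n where n: "n \<ge> N" "\<forall>x. dist (?T (f n) x) (g x) \<le> e" using g(2)[OF e] by blast
    have "inverse (real (Suc n)) \<le> inverse (real (Suc N))" using n(1) by (intro le_imp_inverse_le) auto
    then have "S - sqnorm (?T (f n)) \<le> e" using f(3)[of n] N by linarith
    then show ?thesis using f(1,2) n(2) by (intro exI[of _ "f n"]) (auto simp: dist_norm)
  qed
  have "\<exists>m. \<forall>x. g (x + a) = m * g x" for a
  proof -
    \<comment> \<open>The choice w = 1 controls the sum of the translates by a and -a, the choice w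
      = \<i> their difference; together they determine the translate by a alone.\<close>
    obtain r1 :: real where r1: "\<And>x. 1 * g (x + a) + cnj 1 * g (x - a) = 2 * of_real r1 * g x"
      using quadratic_limit[OF c ck g(1) _ S(1) approx, of 1 a] by auto
    obtain r2 :: real where r2: "\<And>x. \<i> * g (x + a) + cnj \<i> * g (x - a) = 2 * of_real r2 * g x"
      using quadratic_limit[OF c ck g(1) _ S(1) approx, of \<i> a] by auto
    have "g (x + a) = (of_real r1 - \<i> * of_real r2) * g x" for x
    proof -
      have "\<i> * (\<i> * g (x + a) + cnj \<i> * g (x - a)) = \<i> * (2 * of_real r2 * g x)" by (simp only: r2)
      then have "- g (x + a) + g (x - a) = 2 * (\<i> * of_real r2 * g x)" by (simp add: algebra_simps)
      moreover have "g (x + a) + g (x - a) = 2 * (of_real r1 * g x)" using r1[of x] by simp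
      ultimately have "2 * g (x + a) = 2 * ((of_real r1 - \<i> * of_real r2) * g x)" by (simp add: algebra_simps)
      then show ?thesis by simp
    qed
    then show ?thesis by blast
  qed
  then obtain m where m: "\<And>x a. g (x + a) = m a * g x" by metis
  have g0: "g 0 \<noteq> 0"
  proof
    assume "g 0 = 0"
    then have z: "g x = 0" for x using m[of 0 x] by simp
    \<comment> \<open>If g vanished, the near-maximal square norm would be at most
      \<open>e^2 \<le> e\<close>, so that \<open>S \<le> 2 * e \<le> 2 * S / 3\<close>.\<close>
    define e where "e = min 1 (S / 3)"
    have e: "e > 0" "e \<le> 1" "e \<le> S / 3" using Spos by (auto simp: e_def)
    obtain h where h: "continuous_on UNIV h" "S - sqnorm (?T h) \<le> e" "\<And>x. cmod (?T h x - g x) \<le> e" using approx[OF e(1)] by blast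
    have "sqnorm (?T h) \<le> e\<^sup>2" by (rule sqnorm_le_const[OF c twisted_conv_cont[OF c ck h(1)]]) (use h(3) z in simp)
    also have "\<dots> \<le> e" using e by (simp add: power2_eq_square mult_left_le)
    finally show False using h(2) e Spos by linarith
  qed
  define \<kappa> where "\<kappa> = (\<lambda>x. g x / g 0)"
  have gm: "g (x + a) = \<kappa> a * g x" for x a using m[of 0 a] m[of x a] g0 by (simp add: \<kappa>_def)
  have "\<kappa> \<in> pontryagin_dual"
  proof (rule bounded_hom_is_character[OF c])
    show "continuous_on UNIV \<kappa>" unfolding \<kappa>_def using g0 by (intro continuous_on_divide g(1) continuous_on_const) auto
    show "\<kappa> 0 = 1" using g0 by (simp add: \<kappa>_def)
    show "\<kappa> (x + y) = \<kappa> x * \<kappa> y" for x y using gm[of x y] by (simp add: \<kappa>_def)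
  qed
  moreover have "\<kappa> x0 \<noteq> 1"
  proof
    assume 1: "\<kappa> x0 = 1"
    have gs: "g (multiples i x0) = g 0" for i
      by (induction i) (simp_all add: gm 1)
    \<comment> \<open>With half the modulus of \<open>g 0\<close> as error, N terms of g add up to
      \<open>2 * N * e\<close> and the approximants differ from them by at most
      \<open>N * e\<close>, so the bounded telescoping sum would be at least
      \<open>N * e\<close>.\<close>
    define e where "e = cmod (g 0) / 2"
    have e: "e > 0" using g0 by (simp add: e_def)
    obtain h where h: "continuous_on UNIV h" "sqnorm h = 1" "\<And>x. cmod (?T h x - g x) \<le> e" using approx[OF e] by blast
    obtain N :: nat where N: "real N > 2 * R / e" using reals_Archimedean2 by blast
    have t: "cmod (\<Sum>i<N. ?T h (0 + multiples i x0)) \<le> 2 * R"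
      using twisted_conv_telescope[OF c cpsi R h(1), of x0 0 N] by (simp add: h(2) k_def)
    have "cmod ((\<Sum>i<N. ?T h (multiples i x0)) - (\<Sum>i<N. g (multiples i x0))) \<le> real N * e"
      unfolding sum_subtractf[symmetric] by (rule order_trans[OF sum_norm_bound[of _ _ e]]) (auto simp: h(3))
    moreover have "cmod (\<Sum>i<N. g (multiples i x0)) = 2 * (real N * e)" by (simp add: gs norm_mult e_def)
    moreover have "cmod (\<Sum>i<N. ?T h (multiples i x0)) \<le> 2 * R" using t by simp
    ultimately have "real N * e \<le> 2 * R"
      using norm_triangle_sub[of "\<Sum>i<N. g (multiples i x0)" "\<Sum>i<N. ?T h (multiples i x0)"]
      unfolding norm_minus_commute[of "\<Sum>i<N. g (multiples i x0)"] by linarith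
    then show False using N e by (simp add: field_simps)
  qed
  ultimately show ?thesis by blast
qed

section \<open>Pontryagin duality\<close>

lemma dual_zero: "(\<phi> :: 'x::topological_ab_group_add \<Rightarrow> complex) \<in> pontryagin_dual \<Longrightarrow> \<phi> 0 = 1"
proof -
  assume p: "\<phi> \<in> pontryagin_dual"
  then have "\<phi> 0 = \<phi> 0 * \<phi> 0" "cmod (\<phi> 0) = 1" unfolding pontryagin_dual_iff by (metis add_0, metis)
  then show ?thesis by (metis mult_cancel_right1 norm_zero zero_neq_one)
qed

context
  assumes c: "compact (UNIV :: 'x::topological_ab_group_add set)"
begin

lemma mean_nontrivial_character:
  assumes p: "(\<phi> :: 'x \<Rightarrow> complex) \<in> pontryagin_dual" and "\<phi> \<noteq> (\<lambda>x. 1)"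
  shows "mean \<phi> = 0"
proof -
  have cont: "continuous_on UNIV \<phi>" and m: "\<And>x y. \<phi> (x + y) = \<phi> x * \<phi> y" using p by (auto simp: pontryagin_dual_iff)
  obtain a where a: "\<phi> a \<noteq> 1" using assms(2) by auto
  have "mean \<phi> = mean (\<lambda>x. \<phi> (x + a))" by (rule mean_shift[OF c cont, symmetric])
  also have "\<dots> = \<phi> a * mean \<phi>" unfolding m mult.commute[of _ "\<phi> a"] by (rule mean_mult_left[OF c cont])
  finally show ?thesis using a by simp
qed

lemma dual_mult: "\<phi> \<in> pontryagin_dual \<Longrightarrow> \<psi> \<in> pontryagin_dual \<Longrightarrow> (\<lambda>x::'x. \<phi> x * \<psi> x) \<in> pontryagin_dual"
  by (auto simp: pontryagin_dual_iff norm_mult intro!: continuous_on_mult)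

lemma dual_cnj: "\<phi> \<in> pontryagin_dual \<Longrightarrow> (\<lambda>x::'x. cnj (\<phi> x)) \<in> pontryagin_dual"
  by (auto simp: pontryagin_dual_iff intro!: continuous_on_cnj)

lemma dual_mult_cnj: assumes "\<phi> \<in> pontryagin_dual" shows "\<phi> x * cnj (\<phi> x) = 1"
  using assms complex_norm_square[of "\<phi> x"] by (simp add: pontryagin_dual_iff)

context
  fixes h :: "('x \<Rightarrow> complex) \<Rightarrow> complex"
  assumes h_mult: "\<And>\<phi> \<psi>. \<phi> \<in> pontryagin_dual \<Longrightarrow> \<psi> \<in> pontryagin_dual \<Longrightarrow> h (\<lambda>x. \<phi> x * \<psi> x) = h \<phi> * h \<psi>"
    and h_norm: "\<And>\<phi>. \<phi> \<in> pontryagin_dual \<Longrightarrow> cmod (h \<phi>) = 1"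
begin

text \<open>Meant for trigonometric polynomials: \<open>F'\<close> arises from \<open>F\<close> by replacing every character \<open>\<phi>\<close>
  by \<open>cnj (h \<phi>) * \<phi>\<close>.\<close>

definition twin :: "('x \<Rightarrow> complex) \<Rightarrow> ('x \<Rightarrow> complex) \<Rightarrow> bool" where
  "twin F F' \<longleftrightarrow> continuous_on UNIV F \<and> continuous_on UNIV F' \<and>
    (\<forall>\<psi>\<in>pontryagin_dual. mean (\<lambda>x. F' x * \<psi> x) = h \<psi> * mean (\<lambda>x. F x * \<psi> x))"

lemma h_one: "h (\<lambda>x. 1) = 1"
proof -
  have o: "(\<lambda>x::'x. 1) \<in> pontryagin_dual" by (simp add: pontryagin_dual_iff continuous_on_const)
  then have "h (\<lambda>x. 1) = h (\<lambda>x. 1) * h (\<lambda>x. 1)" using h_mult[OF o o] by simp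
  then show ?thesis using h_norm[OF o] by (metis mult_cancel_right1 norm_zero zero_neq_one)
qed

lemma h_cnj: assumes p: "\<phi> \<in> pontryagin_dual" shows "h (\<lambda>x. cnj (\<phi> x)) = cnj (h \<phi>)"
proof -
  have "h \<phi> * h (\<lambda>x. cnj (\<phi> x)) = 1"
    using h_mult[OF p dual_cnj[OF p]] h_one by (simp add: dual_mult_cnj[OF p])
  moreover have "h \<phi> * cnj (h \<phi>) = 1" using complex_norm_square[of "h \<phi>"] h_norm[OF p] by simp
  ultimately show ?thesis by (metis mult_cancel_left mult_zero_left zero_neq_one)
qed

lemma twin_one: "twin (\<lambda>x. 1) (\<lambda>x. 1)"
  unfolding twin_def
proof (intro conjI ballI continuous_on_const)
  fix \<psi> :: "'x \<Rightarrow> complex" assume p: "\<psi> \<in> pontryagin_dual"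
  show "mean (\<lambda>x. 1 * \<psi> x) = h \<psi> * mean (\<lambda>x. 1 * \<psi> x)"
    using mean_nontrivial_character[OF p] by (cases "\<psi> = (\<lambda>x. 1)") (auto simp: h_one)
qed

text \<open>Expanding the factor moves \<phi> and its conjugate into the test character.
  Multiplicativity of \<open>h\<close> then produces exactly the unimodular numbers that the
  inserted coefficients cancel. Testing against characters in this way avoids Fourier
  expansions.\<close>

lemma twin_factor:
  assumes t: "twin F F'" and p: "\<phi> \<in> pontryagin_dual"
  shows "twin (\<lambda>x. (2 + \<phi> x + cnj (\<phi> x)) * F x) (\<lambda>x. (2 + cnj (h \<phi>) * \<phi> x + h \<phi> * cnj (\<phi> x)) * F' x)"
proof -
  have cp: "continuous_on UNIV \<phi>" "continuous_on UNIV (\<lambda>x. cnj (\<phi> x))" using p dual_cnj[OF p] by (auto simp: pontryagin_dual_iff)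
  have cF: "continuous_on UNIV F" "continuous_on UNIV F'" using t by (auto simp: twin_def)
  have hh: "h \<phi> * cnj (h \<phi>) = 1" using complex_norm_square[of "h \<phi>"] h_norm[OF p] by simp
  have "mean (\<lambda>x. (2 + cnj (h \<phi>) * \<phi> x + h \<phi> * cnj (\<phi> x)) * F' x * \<psi> x) = h \<psi> * mean (\<lambda>x. (2 + \<phi> x + cnj (\<phi> x)) * F x * \<psi> x)"
    if q: "\<psi> \<in> pontryagin_dual" for \<psi>
  proof -
    have expand: "mean (\<lambda>x. (2 + b * \<phi> x + b' * cnj (\<phi> x)) * G x * \<psi> x)
      = 2 * mean (\<lambda>x. G x * \<psi> x) + b * mean (\<lambda>x. G x * (\<phi> x * \<psi> x)) + b' * mean (\<lambda>x. G x * (cnj (\<phi> x) * \<psi> x))"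
      if G: "continuous_on UNIV G" for G b b'
    proof -
      have cq: "continuous_on UNIV \<psi>" using q by (simp add: pontryagin_dual_iff)
      have 1: "continuous_on UNIV (\<lambda>x. G x * \<psi> x)" "continuous_on UNIV (\<lambda>x. G x * (\<phi> x * \<psi> x))" "continuous_on UNIV (\<lambda>x. G x * (cnj (\<phi> x) * \<psi> x))"
        by (auto intro!: continuous_on_mult G cq cp)
      have "(\<lambda>x. (2 + b * \<phi> x + b' * cnj (\<phi> x)) * G x * \<psi> x) = (\<lambda>x. (2 * (G x * \<psi> x) + b * (G x * (\<phi> x * \<psi> x))) + b' * (G x * (cnj (\<phi> x) * \<psi> x)))"
        by (simp add: algebra_simps)
      then show ?thesis
        by (simp only: mean_add[OF c continuous_on_add[OF continuous_on_mult_left[OF 1(1)] continuous_on_mult_left[OF 1(2)]] continuous_on_mult_left[OF 1(3)]]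
          mean_add[OF c continuous_on_mult_left[OF 1(1)] continuous_on_mult_left[OF 1(2)]]
          mean_mult_left[OF c 1(1)] mean_mult_left[OF c 1(2)] mean_mult_left[OF c 1(3)])
    qed
    have t1: "mean (\<lambda>x. F' x * \<psi> x) = h \<psi> * mean (\<lambda>x. F x * \<psi> x)"
      "mean (\<lambda>x. F' x * (\<phi> x * \<psi> x)) = (h \<phi> * h \<psi>) * mean (\<lambda>x. F x * (\<phi> x * \<psi> x))"
      "mean (\<lambda>x. F' x * (cnj (\<phi> x) * \<psi> x)) = (cnj (h \<phi>) * h \<psi>) * mean (\<lambda>x. F x * (cnj (\<phi> x) * \<psi> x))"
      using t q dual_mult[OF p q] dual_mult[OF dual_cnj[OF p] q] h_mult[OF p q] h_mult[OF dual_cnj[OF p] q] h_cnj[OF p]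
      by (auto simp: twin_def)
    have e1: "cnj (h \<phi>) * ((h \<phi> * h \<psi>) * A) = h \<psi> * A" "h \<phi> * ((cnj (h \<phi>) * h \<psi>) * A) = h \<psi> * A" for A
    proof -
      have "cnj (h \<phi>) * ((h \<phi> * h \<psi>) * A) = (h \<phi> * cnj (h \<phi>)) * (h \<psi> * A)" "h \<phi> * ((cnj (h \<phi>) * h \<psi>) * A) = (h \<phi> * cnj (h \<phi>)) * (h \<psi> * A)"
        by (simp_all only: mult.assoc mult.left_commute)
      then show "cnj (h \<phi>) * ((h \<phi> * h \<psi>) * A) = h \<psi> * A" "h \<phi> * ((cnj (h \<phi>) * h \<psi>) * A) = h \<psi> * A" by (simp_all only: hh mult_1)
    qed
    show ?thesis
      using expand[OF cF(1), of 1 1] by (simp only: expand[OF cF(2)] t1 e1 mult_1 distrib_left mult.left_commute)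
  qed
  then show ?thesis unfolding twin_def
    by (auto intro!: continuous_on_mult continuous_on_add continuous_on_const cp cF)
qed

lemma twin_factor_power:
  assumes t: "twin F F'" and p: "\<phi> \<in> pontryagin_dual"
  shows "twin (\<lambda>x. (2 + \<phi> x + cnj (\<phi> x)) ^ N * F x) (\<lambda>x. (2 + cnj (h \<phi>) * \<phi> x + h \<phi> * cnj (\<phi> x)) ^ N * F' x)"
proof (induction N)
  case 0 then show ?case using t by simp
next
  case (Suc N)
  from twin_factor[OF this p] show ?case by (simp add: mult.assoc)
qed

lemma twin_prod:
  assumes "finite \<Phi>" "\<Phi> \<subseteq> pontryagin_dual"
  shows "twin (\<lambda>x. \<Prod>\<phi>\<in>\<Phi>. (2 + \<phi> x + cnj (\<phi> x)) ^ N) (\<lambda>x. \<Prod>\<phi>\<in>\<Phi>. (2 + cnj (h \<phi>) * \<phi> x + h \<phi> * cnj (\<phi> x)) ^ N)"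
  using assms
proof (induction \<Phi> rule: finite_induct)
  case empty then show ?case using twin_one by simp
next
  case (insert \<phi> \<Phi>)
  then have "twin (\<lambda>x. \<Prod>\<phi>\<in>\<Phi>. (2 + \<phi> x + cnj (\<phi> x)) ^ N) (\<lambda>x. \<Prod>\<phi>\<in>\<Phi>. (2 + cnj (h \<phi>) * \<phi> x + h \<phi> * cnj (\<phi> x)) ^ N)" by auto
  from twin_factor_power[OF this, of \<phi> N] insert show ?case by simp
qed

lemma factor_norm:
  assumes "cmod w = 1" "cmod z = 1"
  shows "2 + cnj w * z + w * cnj z = complex_of_real ((cmod (w + z))\<^sup>2)"
proof -
  have "w * cnj w = 1" "z * cnj z = 1" using complex_norm_square[of w] complex_norm_square[of z] assms by auto
  then show ?thesis unfolding complex_norm_square by (simp add: algebra_simps)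
qed

text \<open>Bohr's proof of Kronecker's theorem: the means of the \<open>N\<close>-th powers of
  \<open>\<Prod>\<bar>h \<phi> + \<phi>\<bar>\<^sup>2\<close> and of \<open>\<Prod>\<bar>1 + \<phi>\<bar>\<^sup>2\<close> agree, and their growth rates determine the suprema.\<close>

lemma finite_interpolation:
  assumes fin: "finite \<Phi>" and sub: "\<Phi> \<subseteq> pontryagin_dual"
  shows "\<exists>x. \<forall>\<phi>\<in>\<Phi>. \<phi> x = h \<phi>"
proof (rule ccontr)
  assume no: "\<not> ?thesis"
  define P where "P = (\<lambda>x. \<Prod>\<phi>\<in>\<Phi>. (cmod (h \<phi> + \<phi> x))\<^sup>2)"
  define P0 where "P0 = (\<lambda>x. \<Prod>\<phi>\<in>\<Phi>. (cmod (1 + \<phi> x))\<^sup>2)"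
  have cphi: "continuous_on UNIV \<phi>" and nphi: "cmod (\<phi> x) = 1" and nh: "cmod (h \<phi>) = 1" if "\<phi> \<in> \<Phi>" for \<phi> x
    using that sub h_norm by (auto simp: pontryagin_dual_iff)
  have cP: "continuous_on UNIV P" unfolding P_def
    by (intro continuous_on_prod continuous_on_power continuous_on_norm continuous_on_add continuous_on_const cphi)
  have cP0: "continuous_on UNIV P0" unfolding P0_def
    by (intro continuous_on_prod continuous_on_power continuous_on_norm continuous_on_add continuous_on_const cphi)
  have f4: "(cmod (w + z))\<^sup>2 \<le> 4" if "cmod w = 1" "cmod z = 1" for w z
  proof -
    have "cmod (w + z) \<le> 2" using norm_triangle_ineq[of w z] that by simp
    then have "(cmod (w + z))\<^sup>2 \<le> 2\<^sup>2" by (intro power_mono) auto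
    then show ?thesis by simp
  qed
  have P0b: "0 \<le> P0 x" "P0 x \<le> 4 ^ card \<Phi>" for x
  proof -
    show "0 \<le> P0 x" unfolding P0_def by (intro prod_nonneg) auto
    have "P0 x \<le> (\<Prod>\<phi>\<in>\<Phi>. 4)" unfolding P0_def by (intro prod_mono conjI) (use f4[of 1] nphi in auto)
    then show "P0 x \<le> 4 ^ card \<Phi>" by simp
  qed
  have Pn: "0 \<le> P x" for x unfolding P_def by (intro prod_nonneg) auto
  have Plt: "P x < 4 ^ card \<Phi>" for x
  proof -
    obtain \<phi> where p: "\<phi> \<in> \<Phi>" "\<phi> x \<noteq> h \<phi>" using no by blast
    have "(cmod (h \<phi> + \<phi> x))\<^sup>2 < 4"
    proof -
      have "(cmod (h \<phi> + \<phi> x))\<^sup>2 + (cmod (h \<phi> - \<phi> x))\<^sup>2 = 2 * (cmod (h \<phi>))\<^sup>2 + 2 * (cmod (\<phi> x))\<^sup>2"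
        unfolding cmod_power2 by (simp add: power2_eq_square algebra_simps)
      moreover have "(cmod (h \<phi> - \<phi> x))\<^sup>2 > 0" using p(2) by (intro zero_less_power) simp
      ultimately have "(cmod (h \<phi> + \<phi> x))\<^sup>2 < 2 * 1\<^sup>2 + 2 * 1\<^sup>2" unfolding nphi[OF p(1)] nh[OF p(1)] by linarith
      then show ?thesis by simp
    qed
    then have "(cmod (h \<phi> + \<phi> x))\<^sup>2 * (4 ^ card (\<Phi> - {\<phi>})) < 4 * 4 ^ card (\<Phi> - {\<phi>})"
      by (intro mult_strict_right_mono) auto
    moreover have "(\<Prod>\<phi>\<in>\<Phi> - {\<phi>}. (cmod (h \<phi> + \<phi> x))\<^sup>2) \<le> (\<Prod>\<phi>\<in>\<Phi> - {\<phi>}. 4)"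
      by (intro prod_mono conjI f4) (auto simp: nphi nh)
    then have "(cmod (h \<phi> + \<phi> x))\<^sup>2 * (\<Prod>\<phi>\<in>\<Phi> - {\<phi>}. (cmod (h \<phi> + \<phi> x))\<^sup>2) \<le> (cmod (h \<phi> + \<phi> x))\<^sup>2 * 4 ^ card (\<Phi> - {\<phi>})"
      by (intro mult_left_mono) auto
    moreover have "P x = (cmod (h \<phi> + \<phi> x))\<^sup>2 * (\<Prod>\<phi>\<in>\<Phi> - {\<phi>}. (cmod (h \<phi> + \<phi> x))\<^sup>2)"
      unfolding P_def by (rule prod.remove[OF fin p(1)])
    moreover have "(4::real) ^ card \<Phi> = 4 * 4 ^ card (\<Phi> - {\<phi>})"
      using prod.remove[OF fin p(1), of "\<lambda>_. 4::real"] by (simp only: prod_constant)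
    ultimately show ?thesis by linarith
  qed
  have "\<exists>x1\<in>UNIV. \<forall>x\<in>UNIV. P x \<le> P x1" by (rule continuous_attains_sup[OF c UNIV_not_empty cP])
  then obtain x1 where x1: "\<And>x. P x \<le> P x1" by blast
  \<comment> \<open>The number p separates the maximum of \<open>P\<close> from the value
    \<open>4 ^ card \<Phi>\<close>, which \<open>P0\<close> attains at 0.\<close>
  obtain p where p: "P x1 < p" "p < 4 ^ card \<Phi>" using dense[OF Plt[of x1]] by blast
  have pp: "p > 0" using p(1) Pn[of x1] by linarith
  \<comment> \<open>A continuous stand-in for the indicator of the set where \<open>P0\<close>
    exceeds p: a multiple of \<open>p ^ N * u\<close> lies below \<open>P0 ^ N\<close>, so the mean
    of the latter decays no faster than \<open>p ^ N\<close>.\<close>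
  define u where "u = (\<lambda>x. max 0 (P0 x - p))"
  have cu: "continuous_on UNIV u" unfolding u_def by (intro continuous_on_max continuous_on_const continuous_on_diff cP0)
  have "P0 0 = 4 ^ card \<Phi>"
  proof -
    have "P0 0 = (\<Prod>\<phi>\<in>\<Phi>. 4)" unfolding P0_def 
    proof (intro prod.cong refl)
      fix \<phi> assume "\<phi> \<in> \<Phi>"
      then have "\<phi> 0 = 1" using sub dual_zero by blast
      then show "(cmod (1 + \<phi> 0))\<^sup>2 = 4" by simp
    qed
    then show ?thesis by simp
  qed
  then have "u 0 > 0" using p(2) by (simp add: u_def)
  then have mu: "mean u > 0" by (intro mean_pos[OF c cu]) (auto simp: u_def)
  define d where "d = mean u / 4 ^ card \<Phi>"
  have d: "d > 0" using mu by (simp add: d_def)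
  have "d \<le> (P x1 / p) ^ N" for N
  proof -
    have cN: "continuous_on UNIV (\<lambda>x. P x ^ N)" "continuous_on UNIV (\<lambda>x. P0 x ^ N)" by (intro continuous_on_power cP cP0)+
    have t: "twin (\<lambda>x. \<Prod>\<phi>\<in>\<Phi>. (2 + \<phi> x + cnj (\<phi> x)) ^ N) (\<lambda>x. \<Prod>\<phi>\<in>\<Phi>. (2 + cnj (h \<phi>) * \<phi> x + h \<phi> * cnj (\<phi> x)) ^ N)"
      by (rule twin_prod[OF fin sub])
    have 1: "(\<Prod>\<phi>\<in>\<Phi>. (2 + \<phi> x + cnj (\<phi> x)) ^ N) = of_real (P0 x ^ N)" for x
    proof -
      have "2 + \<phi> x + cnj (\<phi> x) = of_real ((cmod (1 + \<phi> x))\<^sup>2)" if "\<phi> \<in> \<Phi>" for \<phi>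
        using factor_norm[OF norm_one nphi[OF that]] by simp
      then show ?thesis unfolding P0_def of_real_power of_real_prod prod_power_distrib
        by (intro prod.cong refl) (simp only:)
    qed
    have 2: "(\<Prod>\<phi>\<in>\<Phi>. (2 + cnj (h \<phi>) * \<phi> x + h \<phi> * cnj (\<phi> x)) ^ N) = of_real (P x ^ N)" for x
      unfolding P_def of_real_power of_real_prod prod_power_distrib
      by (intro prod.cong refl) (simp only: factor_norm[OF nh nphi] of_real_power)
    have one: "(\<lambda>x::'x. 1) \<in> pontryagin_dual" by (simp add: pontryagin_dual_iff continuous_on_const)
    have "mean (\<lambda>x. complex_of_real (P x ^ N)) = mean (\<lambda>x. complex_of_real (P0 x ^ N))"
      using t one unfolding twin_def 1 2 by (auto simp: h_one)
    then have "complex_of_real (mean (\<lambda>x. P x ^ N)) = complex_of_real (mean (\<lambda>x. P0 x ^ N))"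
      unfolding mean_linear[OF c cN(1) bounded_linear_of_real] mean_linear[OF c cN(2) bounded_linear_of_real] .
    then have eq: "mean (\<lambda>x. P x ^ N) = mean (\<lambda>x. P0 x ^ N)" by (simp only: of_real_eq_iff)
    have "mean (\<lambda>x. P x ^ N) \<le> mean (\<lambda>x::'x. P x1 ^ N)"
      by (rule mean_mono[OF c cN(1) continuous_on_const]) (intro power_mono x1 Pn)
    then have up: "mean (\<lambda>x. P x ^ N) \<le> P x1 ^ N" by (simp add: mean_const)
    have "mean (\<lambda>x. (p ^ N / 4 ^ card \<Phi>) * u x) \<le> mean (\<lambda>x. P0 x ^ N)"
    proof (rule mean_mono[OF c continuous_on_mult_left[OF cu] cN(2)])
      fix x
      show "(p ^ N / 4 ^ card \<Phi>) * u x \<le> P0 x ^ N"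
      proof (cases "P0 x \<ge> p")
        case True
        have "u x \<le> 4 ^ card \<Phi>" using P0b[of x] pp by (simp add: u_def)
        moreover have "u x \<ge> 0" by (simp add: u_def)
        ultimately have "(p ^ N / 4 ^ card \<Phi>) * u x \<le> (p ^ N / 4 ^ card \<Phi>) * 4 ^ card \<Phi>" using pp by (intro mult_left_mono) auto
        also have "\<dots> = p ^ N" by simp
        also have "\<dots> \<le> P0 x ^ N" using True pp by (intro power_mono) auto
        finally show ?thesis .
      next
        case False then show ?thesis using P0b(1)[of x] by (simp add: u_def)
      qed
    qed
    then have "(p ^ N / 4 ^ card \<Phi>) * mean u \<le> P x1 ^ N" using up eq by (simp only: mean_mult_left[OF c cu])
    then show ?thesis using pp by (simp add: d_def power_divide field_simps)
  qed
  moreover have "(\<lambda>N. (P x1 / p) ^ N) \<longlonglongrightarrow> 0"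
    using p(1) pp Pn[of x1] by (intro LIMSEQ_realpow_zero) auto
  ultimately have "d \<le> 0" by (intro LIMSEQ_le_const) auto
  then show False using d by simp
qed

text \<open>Here \<open>h\<close> is an arbitrary character of the discrete dual group, and it is
  shown to be evaluation at a point. The closed solution sets of single equations have the finite
  intersection property by \<open>finite_interpolation\<close>.\<close>

theorem pontryagin_surj: "\<exists>x. \<forall>\<phi>\<in>pontryagin_dual. \<phi> x = h \<phi>"
proof -
  have "UNIV \<inter> (\<Inter>\<phi>\<in>pontryagin_dual. {x. \<phi> x = h \<phi>}) \<noteq> {}"
  proof (rule compact_imp_fip_image[OF c])
    fix \<phi> :: "'x \<Rightarrow> complex" assume "\<phi> \<in> pontryagin_dual"
    then have "continuous_on UNIV \<phi>" by (simp add: pontryagin_dual_iff)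
    then show "closed {x. \<phi> x = h \<phi>}" by (intro closed_Collect_eq continuous_on_const)
  next
    fix \<Phi> assume "finite \<Phi>" "\<Phi> \<subseteq> (pontryagin_dual :: ('x \<Rightarrow> complex) set)"
    from finite_interpolation[OF this] show "UNIV \<inter> (\<Inter>\<phi>\<in>\<Phi>. {x. \<phi> x = h \<phi>}) \<noteq> {}" by auto
  qed
  then show ?thesis by auto
qed

end
end

section \<open>The relations of a presented module\<close>

alias lookup = Poly_Mapping.lookup
alias keys = Poly_Mapping.keys
alias single = Poly_Mapping.single

lemma poly_mapping_sum_single: "f = (\<Sum>s\<in>keys f. single s (lookup f s))"
  by (rule poly_mapping_eqI) (simp add: lookup_sum lookup_single when_def in_keys_iff)

lemma lookup_mult_group:
  fixes f g :: "'g::group_add \<Rightarrow>\<^sub>0 'r::semiring_0"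
  shows "lookup (f * g) s =
    (\<Sum>v\<in>keys g. lookup f (s - v) * lookup g v)"
proof -
  have 1: "lookup (f * single v c) s = lookup f (s - v) * c" for v c
  proof -
    have "f * single v c = (\<Sum>u\<in>keys f. single (u + v) (lookup f u * c))"
      by (subst poly_mapping_sum_single[of f]) (simp add: sum_distrib_right mult_single)
    then have "lookup (f * single v c) s
        = (\<Sum>u\<in>keys f. if u = s - v then lookup f u * c else 0)"
      by (simp add: lookup_sum lookup_single when_def eq_diff_eq)
    also have "\<dots> = lookup f (s - v) * c"
      by (simp add: in_keys_iff)
    finally show ?thesis .
  qed
  have "f * g = (\<Sum>v\<in>keys g. f * single v (lookup g v))"
    by (subst poly_mapping_sum_single[of g]) (simp add: sum_distrib_left)
  then show ?thesis by (simp add: lookup_sum 1)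
qed

lemma lookup_gr_star: "lookup (gr_star f) s = lookup f (- s)"
proof -
  have eq: "- t = s \<longleftrightarrow> t = - s" for t by auto
  have "lookup (gr_star f) s = (\<Sum>t\<in>keys f. if t = - s then lookup f t else 0)"
    unfolding gr_star_def by (simp only: lookup_sum lookup_single when_def eq)
  also have "\<dots> = lookup f (- s)" by (simp add: in_keys_iff)
  finally show ?thesis .
qed

text \<open>The \<open>i\<close>-th entry of \<open>a A\<^sup>*\<close> at \<open>- s\<close>, where \<open>a\<^sub>j(u) = y\<^sub>j(- u)\<close>; this reflection turns right into left
  translations.\<close>

definition rel_form :: "('g::group_add \<Rightarrow>\<^sub>0 int) mat \<Rightarrow> (nat \<Rightarrow> 'g \<Rightarrow> real) \<Rightarrow> nat \<Rightarrow> 'g \<Rightarrow> real" where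
  "rel_form A y i s = (\<Sum>j<dim_col A. \<Sum>t\<in>keys (A $$ (i, j)).
     of_int (lookup (A $$ (i, j)) t) * y j (- t + s))"

text \<open>Families are plain functions, with finite support as a separate predicate, because lifts
  of points and square summable solutions are put into the same relations.\<close>

definition fin_supp :: "nat \<Rightarrow> (nat \<Rightarrow> 'g \<Rightarrow> real) \<Rightarrow> bool" where
  "fin_supp k y \<longleftrightarrow> (\<forall>j<k. finite {s. y j s \<noteq> 0})"

definition rel_injective :: "('g::group_add \<Rightarrow>\<^sub>0 int) mat \<Rightarrow> bool" where
  "rel_injective A \<longleftrightarrow> (\<forall>y. fin_supp (dim_col A) y \<longrightarrow> (\<forall>i<dim_row A. \<forall>s. rel_form A y i s = 0) \<longrightarrow>
     (\<forall>j<dim_col A. \<forall>s. y j s = 0))"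

lemma lookup_map_of_int: "lookup (Poly_Mapping.map real_of_int f) s = of_int (lookup f s)"
  by (simp add: Poly_Mapping.map.rep_eq when_def)

lemma row_mult_entry:
  assumes "a \<in> carrier_mat 1 k" "B \<in> carrier_mat k n" "i < n"
  shows "(a * B) $$ (0, i) = (\<Sum>j<k. a $$ (0, j) * B $$ (j, i))"
  using assms by (auto simp: scalar_prod_def atLeast0LessThan)

text \<open>Stated with \<open>of_int\<close> over an arbitrary ring, it serves the real and the
  integral condition alike.\<close>

lemma mult_star_entry:
  fixes B :: "('g::group_add \<Rightarrow>\<^sub>0 'r::ring_1) mat" and h :: "int \<Rightarrow> 'r"
  assumes a: "a \<in> carrier_mat 1 (dim_col A)" and B: "B \<in> carrier_mat (dim_col A) (dim_row A)"
    and BA: "\<And>i j s. i < dim_row A \<Longrightarrow> j < dim_col A \<Longrightarrow> lookup (B $$ (j, i)) s = of_int (lookup (A $$ (i, j)) (- s))"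
    and i: "i < dim_row A"
  shows "lookup ((a * B) $$ (0, i)) s =
    (\<Sum>j<dim_col A. \<Sum>t\<in>keys (A $$ (i, j)). lookup (a $$ (0, j)) (s + t) * of_int (lookup (A $$ (i, j)) t))"
  unfolding row_mult_entry[OF a B i] lookup_sum lookup_mult_group
proof (rule sum.cong[OF refl])
  fix j assume "j \<in> {..<dim_col A}"
  then have j: "j < dim_col A" by simp
  have "(\<Sum>v\<in>keys (B $$ (j, i)). lookup (a $$ (0, j)) (s - v) * lookup (B $$ (j, i)) v)
    = (\<Sum>v\<in>uminus ` keys (A $$ (i, j)). lookup (a $$ (0, j)) (s - v) * lookup (B $$ (j, i)) v)"
  proof (rule sum.mono_neutral_left)
    show "keys (B $$ (j, i)) \<subseteq> uminus ` keys (A $$ (i, j))"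
    proof
      fix v assume "v \<in> keys (B $$ (j, i))"
      then have "lookup (A $$ (i, j)) (- v) \<noteq> 0" by (auto simp: in_keys_iff BA[OF i j])
      then have "- v \<in> keys (A $$ (i, j))" by (simp add: in_keys_iff)
      then show "v \<in> uminus ` keys (A $$ (i, j))" by (metis image_eqI minus_minus)
    qed
  qed (auto simp: in_keys_iff)
  also have "\<dots> = (\<Sum>t\<in>keys (A $$ (i, j)). lookup (a $$ (0, j)) (s + t) * of_int (lookup (A $$ (i, j)) t))"
    by (subst sum.reindex) (auto simp: BA[OF i j] inj_on_def)
  finally show "(\<Sum>v\<in>keys (B $$ (j, i)). lookup (a $$ (0, j)) (s - v) * lookup (B $$ (j, i)) v)
    = (\<Sum>t\<in>keys (A $$ (i, j)). lookup (a $$ (0, j)) (s + t) * of_int (lookup (A $$ (i, j)) t))" .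
qed

lemma inj_on_row_mult_iff:
  fixes B :: "'r::ring mat"
  assumes B: "B \<in> carrier_mat k n"
  shows "inj_on (\<lambda>a. a * B) (carrier_mat 1 k) \<longleftrightarrow>
    (\<forall>a\<in>carrier_mat 1 k. (\<forall>i<n. (a * B) $$ (0, i) = 0) \<longrightarrow> (\<forall>j<k. a $$ (0, j) = 0))"
proof
  assume inj: "inj_on (\<lambda>a. a * B) (carrier_mat 1 k)"
  show "\<forall>a\<in>carrier_mat 1 k. (\<forall>i<n. (a * B) $$ (0, i) = 0) \<longrightarrow> (\<forall>j<k. a $$ (0, j) = 0)"
  proof (intro ballI impI)
    fix a assume a: "a \<in> carrier_mat 1 k" "\<forall>i<n. (a * B) $$ (0, i) = 0"
    have "a * B = 0\<^sub>m 1 k * B"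
    proof (rule eq_matI)
      fix i j assume "i < dim_row (0\<^sub>m 1 k * B)" "j < dim_col (0\<^sub>m 1 k * B)"
      then have ij: "i = 0" "j < n" using B by auto
      have "(0\<^sub>m 1 k * B) $$ (0, j) = 0" using row_mult_entry[OF _ B ij(2), of "0\<^sub>m 1 k"] by simp
      then show "(a * B) $$ (i, j) = (0\<^sub>m 1 k * B) $$ (i, j)" using a ij by simp
    qed (use a B in auto)
    then have "a = 0\<^sub>m 1 k" using inj a by (auto simp: inj_on_def)
    then show "\<forall>j<k. a $$ (0, j) = 0" by simp
  qed
next
  assume ker: "\<forall>a\<in>carrier_mat 1 k. (\<forall>i<n. (a * B) $$ (0, i) = 0) \<longrightarrow> (\<forall>j<k. a $$ (0, j) = 0)"
  show "inj_on (\<lambda>a. a * B) (carrier_mat 1 k)"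
  proof (rule inj_onI)
    fix a a' assume a: "a \<in> carrier_mat 1 k" "a' \<in> carrier_mat 1 k" "a * B = a' * B"
    define d where "d = Matrix.mat 1 k (\<lambda>(i, j). a $$ (i, j) - a' $$ (i, j))"
    have d: "d \<in> carrier_mat 1 k" by (simp add: d_def)
    have "(d * B) $$ (0, i) = 0" if i: "i < n" for i
    proof -
      have "(d * B) $$ (0, i) = (\<Sum>j<k. (a $$ (0, j) - a' $$ (0, j)) * B $$ (j, i))"
        unfolding row_mult_entry[OF d B i] by (intro sum.cong) (auto simp: d_def)
      also have "\<dots> = (a * B) $$ (0, i) - (a' * B) $$ (0, i)"
        unfolding row_mult_entry[OF a(1) B i] row_mult_entry[OF a(2) B i] by (simp add: left_diff_distrib sum_subtractf)
      finally show ?thesis using a(3) by simp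
    qed
    then have "d $$ (0, j) = 0" if "j < k" for j using ker d that by blast
    then have "a $$ (0, j) = a' $$ (0, j)" if "j < k" for j using that by (simp add: d_def)
    then show "a = a'" using a by (intro eq_matI) auto
  qed
qed

text \<open>The reflection undoes the one built into \<open>rel_form\<close>.\<close>

definition pm_of :: "('g::group_add \<Rightarrow> 'r::zero) \<Rightarrow> 'g \<Rightarrow>\<^sub>0 'r" where
  "pm_of f = Abs_poly_mapping (\<lambda>s. f (- s))"

lemma lookup_pm_of:
  assumes "finite {s. f s \<noteq> 0}" shows "lookup (pm_of f) s = f (- s)"
proof -
  have "{s. f (- s) \<noteq> 0} \<subseteq> uminus ` {s. f s \<noteq> 0}" 
  proof
    fix s assume "s \<in> {s. f (- s) \<noteq> 0}"
    then show "s \<in> uminus ` {s. f s \<noteq> 0}" by (intro image_eqI[of _ _ "- s"]) auto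
  qed
  then have "finite {s. f (- s) \<noteq> 0}" using assms finite_surj by blast
  then show ?thesis by (simp add: pm_of_def)
qed

lemma finite_reflect_lookup: "finite {s. lookup f (- s :: 'g::group_add) \<noteq> 0}"
proof -
  have "{s. lookup f (- s) \<noteq> 0} \<subseteq> uminus ` keys f"
  proof
    fix s assume "s \<in> {s. lookup f (- s) \<noteq> 0}"
    then have "- s \<in> keys f" by (simp add: in_keys_iff)
    then show "s \<in> uminus ` keys f" by (metis image_eqI minus_minus)
  qed
  then show ?thesis using finite_surj finite_keys by blast
qed

lemma real_inj_iff:
  fixes A :: "('g::group_add \<Rightarrow>\<^sub>0 int) mat"
  assumes A: "A \<in> carrier_mat n k"
  shows "inj_on (\<lambda>a. a * real_mat (mat_star A)) (carrier_mat 1 k) \<longleftrightarrow> rel_injective A"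
proof -
  let ?B = "real_mat (mat_star A)"
  have dims: "dim_row A = n" "dim_col A = k" using A by auto
  have B: "?B \<in> carrier_mat k n" using A by (auto simp: real_mat_def mat_star_def)
  have BA: "lookup (?B $$ (j, i)) s = of_int (lookup (A $$ (i, j)) (- s))"
    if "i < n" "j < k" for i j s
    using that A by (simp add: real_mat_def mat_star_def lookup_map_of_int lookup_gr_star)
  have entry: "lookup ((a * ?B) $$ (0, i)) s = rel_form A (\<lambda>j u. lookup (a $$ (0, j)) (- u)) i (- s)"
    if a: "a \<in> carrier_mat 1 k" and i: "i < n" for a i s
    using mult_star_entry[of a A ?B i s] a B BA i
    by (simp add: dims rel_form_def minus_add mult.commute)
  show ?thesis unfolding inj_on_row_mult_iff[OF B]
  proof
    assume L: "\<forall>a\<in>carrier_mat 1 k. (\<forall>i<n. (a * ?B) $$ (0, i) = 0) \<longrightarrow> (\<forall>j<k. a $$ (0, j) = 0)"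
    show "rel_injective A" unfolding rel_injective_def dims
    proof (intro allI impI)
      fix y j s assume y: "fin_supp k y" "\<forall>i<n. \<forall>s. rel_form A y i s = 0" and j: "j < k"
      define a where "a = Matrix.mat 1 k (\<lambda>(_, j). pm_of (y j))"
      have a: "a \<in> carrier_mat 1 k" by (simp add: a_def)
      have la: "lookup (a $$ (0, j)) u = y j (- u)" if "j < k" for j u
        using that y(1) by (simp add: a_def lookup_pm_of fin_supp_def)
      have "(a * ?B) $$ (0, i) = 0" if i: "i < n" for i
      proof (rule poly_mapping_eqI)
        fix s
        have "rel_form A (\<lambda>j u. lookup (a $$ (0, j)) (- u)) i (- s) = rel_form A y i (- s)"
          unfolding rel_form_def dims by (intro sum.cong refl) (simp add: la minus_add)
        then show "lookup ((a * ?B) $$ (0, i)) s = lookup 0 s"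
          using entry[OF a i] y(2) i by simp
      qed
      then have "a $$ (0, j) = 0" using L a j by blast
      then show "y j s = 0" using la[OF j, of "- s"] by simp
    qed
  next
    assume R: "rel_injective A"
    show "\<forall>a\<in>carrier_mat 1 k. (\<forall>i<n. (a * ?B) $$ (0, i) = 0) \<longrightarrow> (\<forall>j<k. a $$ (0, j) = 0)"
    proof (intro ballI impI allI)
      fix a j assume a: "a \<in> carrier_mat 1 k" "\<forall>i<n. (a * ?B) $$ (0, i) = 0" and j: "j < k"
      let ?y = "\<lambda>j u. lookup (a $$ (0, j)) (- u)"
      have "fin_supp k ?y" unfolding fin_supp_def using finite_reflect_lookup by blast
      moreover have "rel_form A ?y i s = 0" if "i < n" for i s
        using entry[OF a(1) that, of "- s"] a(2) that by simp
      ultimately have "?y j s = 0" for s using R j unfolding rel_injective_def dims by blast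
      from this[of "- s" for s] show "a $$ (0, j) = 0" by (intro poly_mapping_eqI) simp
    qed
  qed
qed

definition int_rel_injective :: "('g::group_add \<Rightarrow>\<^sub>0 int) mat \<Rightarrow> bool" where
  "int_rel_injective A \<longleftrightarrow> (\<forall>y :: nat \<Rightarrow> 'g \<Rightarrow> int. fin_supp (dim_col A) (\<lambda>j s. of_int (y j s)) \<longrightarrow>
     (\<forall>i<dim_row A. \<forall>s. rel_form A (\<lambda>j s. of_int (y j s)) i s = 0) \<longrightarrow> (\<forall>j<dim_col A. \<forall>s. y j s = 0))"

lemma int_inj_iff:
  fixes A :: "('g::group_add \<Rightarrow>\<^sub>0 int) mat"
  assumes A: "A \<in> carrier_mat n k"
  shows "inj_on (\<lambda>a. a * mat_star A) (carrier_mat 1 k) \<longleftrightarrow> int_rel_injective A"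
proof -
  let ?B = "mat_star A"
  have dims: "dim_row A = n" "dim_col A = k" using A by auto
  have B: "?B \<in> carrier_mat k n" using A by (auto simp: mat_star_def)
  have BA: "lookup (?B $$ (j, i)) s = of_int (lookup (A $$ (i, j)) (- s))"
    if "i < n" "j < k" for i j s
    using that A by (simp add: mat_star_def lookup_gr_star)
  have entry: "of_int (lookup ((a * ?B) $$ (0, i)) s) = rel_form A (\<lambda>j u. of_int (lookup (a $$ (0, j)) (- u))) i (- s)"
    if a: "a \<in> carrier_mat 1 k" and i: "i < n" for a i s
    using mult_star_entry[of a A ?B i s] a B BA i
    by (simp add: dims rel_form_def minus_add mult.commute)
  show ?thesis unfolding inj_on_row_mult_iff[OF B]
  proof
    assume L: "\<forall>a\<in>carrier_mat 1 k. (\<forall>i<n. (a * ?B) $$ (0, i) = 0) \<longrightarrow> (\<forall>j<k. a $$ (0, j) = 0)"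
    show "int_rel_injective A" unfolding int_rel_injective_def dims
    proof (intro allI impI)
      fix y :: "nat \<Rightarrow> 'g \<Rightarrow> int" and j s
      assume y: "fin_supp k (\<lambda>j s. of_int (y j s))" "\<forall>i<n. \<forall>s. rel_form A (\<lambda>j s. of_int (y j s)) i s = 0" and j: "j < k"
      define a where "a = Matrix.mat 1 k (\<lambda>(_, j). pm_of (y j))"
      have a: "a \<in> carrier_mat 1 k" by (simp add: a_def)
      have la: "lookup (a $$ (0, j)) u = y j (- u)" if "j < k" for j u
        using that y(1) by (simp add: a_def lookup_pm_of fin_supp_def)
      have "(a * ?B) $$ (0, i) = 0" if i: "i < n" for i
      proof (rule poly_mapping_eqI)
        fix s
        have "rel_form A (\<lambda>j u. of_int (lookup (a $$ (0, j)) (- u))) i (- s) = rel_form A (\<lambda>j s. of_int (y j s)) i (- s)"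
          unfolding rel_form_def dims by (intro sum.cong refl) (simp add: la minus_add)
        then have "real_of_int (lookup ((a * ?B) $$ (0, i)) s) = 0"
          using entry[OF a i] y(2) i by simp
        then show "lookup ((a * ?B) $$ (0, i)) s = lookup 0 s" by simp
      qed
      then have "a $$ (0, j) = 0" using L a j by blast
      then show "y j s = 0" using la[OF j, of "- s"] by simp
    qed
  next
    assume R: "int_rel_injective A"
    show "\<forall>a\<in>carrier_mat 1 k. (\<forall>i<n. (a * ?B) $$ (0, i) = 0) \<longrightarrow> (\<forall>j<k. a $$ (0, j) = 0)"
    proof (intro ballI impI allI)
      fix a j assume a: "a \<in> carrier_mat 1 k" "\<forall>i<n. (a * ?B) $$ (0, i) = 0" and j: "j < k"
      let ?y = "\<lambda>j u. lookup (a $$ (0, j)) (- u)"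
      have "fin_supp k (\<lambda>j s. real_of_int (?y j s))" unfolding fin_supp_def of_int_eq_0_iff by (intro allI impI finite_reflect_lookup)
      moreover have "rel_form A (\<lambda>j s. real_of_int (?y j s)) i s = 0" if "i < n" for i s
        using entry[OF a(1) that, of "- s"] a(2) that by simp
      ultimately have "?y j s = 0" for s
        using R[unfolded int_rel_injective_def dims, THEN spec[of _ ?y]] j by blast
      from this[of "- s" for s] show "a $$ (0, j) = 0" by (intro poly_mapping_eqI) simp
    qed
  qed
qed


lemma rel_form_diff: "rel_form A (\<lambda>j s. y j s - y' j s) i s = rel_form A y i s - rel_form A y' i s"
  by (simp add: rel_form_def algebra_simps sum_subtractf)

lemma rel_form_scale: "rel_form A (\<lambda>j s. c * y j s) i s = c * rel_form A y i s"
  by (simp add: rel_form_def algebra_simps sum_distrib_left)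

lemma rel_form_cong:
  "(\<And>j t. j < dim_col A \<Longrightarrow> t \<in> keys (A $$ (i, j)) \<Longrightarrow> y j (- t + s) = y' j (- t + s)) \<Longrightarrow>
    rel_form A y i s = rel_form A y' i s"
  unfolding rel_form_def by (intro sum.cong refl) auto

lemma rel_form_shift: "rel_form A (\<lambda>j s. y j (s + u)) i s = rel_form A y i (s + u)"
  unfolding rel_form_def by (simp add: add.assoc)

text \<open>The sum of the absolute values of all coefficients. The added 1 keeps it positive for
  every matrix, so that it can be divided by.\<close>

definition rel_bound :: "('g::group_add \<Rightarrow>\<^sub>0 int) mat \<Rightarrow> real" where
  "rel_bound A = 1 + (\<Sum>i<dim_row A. \<Sum>j<dim_col A. \<Sum>t\<in>keys (A $$ (i, j)). of_int \<bar>lookup (A $$ (i, j)) t\<bar>)"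

lemma rel_bound_ge_1: "rel_bound A \<ge> 1"
  by (auto simp: rel_bound_def intro!: sum_nonneg)

lemma rel_form_bound:
  assumes i: "i < dim_row A" and B0: "B \<ge> 0" and B: "\<And>j t. j < dim_col A \<Longrightarrow> \<bar>y j t\<bar> \<le> B"
  shows "\<bar>rel_form A y i s\<bar> \<le> rel_bound A * B"
proof -
  let ?S = "\<lambda>i. \<Sum>j<dim_col A. \<Sum>t\<in>keys (A $$ (i, j)). real_of_int \<bar>lookup (A $$ (i, j)) t\<bar>"
  have "\<bar>rel_form A y i s\<bar> \<le> (\<Sum>j<dim_col A. \<bar>\<Sum>t\<in>keys (A $$ (i, j)).
     of_int (lookup (A $$ (i, j)) t) * y j (- t + s)\<bar>)" unfolding rel_form_def by (rule sum_abs)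
  also have "\<dots> \<le> (\<Sum>j<dim_col A. \<Sum>t\<in>keys (A $$ (i, j)). real_of_int \<bar>lookup (A $$ (i, j)) t\<bar> * B)"
  proof (rule sum_mono)
    fix j assume "j \<in> {..<dim_col A}"
    then have j: "j < dim_col A" by simp
    have "\<bar>\<Sum>t\<in>keys (A $$ (i, j)). of_int (lookup (A $$ (i, j)) t) * y j (- t + s)\<bar>
      \<le> (\<Sum>t\<in>keys (A $$ (i, j)). \<bar>of_int (lookup (A $$ (i, j)) t) * y j (- t + s)\<bar>)" by (rule sum_abs)
    also have "\<dots> \<le> (\<Sum>t\<in>keys (A $$ (i, j)). real_of_int \<bar>lookup (A $$ (i, j)) t\<bar> * B)"
      by (rule sum_mono) (simp add: abs_mult mult_left_mono B[OF j])
    finally show "\<bar>\<Sum>t\<in>keys (A $$ (i, j)). of_int (lookup (A $$ (i, j)) t) * y j (- t + s)\<bar>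
      \<le> (\<Sum>t\<in>keys (A $$ (i, j)). real_of_int \<bar>lookup (A $$ (i, j)) t\<bar> * B)" .
  qed
  also have "\<dots> = ?S i * B" by (simp only: sum_distrib_right)
  also have "\<dots> \<le> rel_bound A * B"
  proof (rule mult_right_mono[OF _ B0])
    have "?S i \<le> (\<Sum>i<dim_row A. ?S i)"
      by (rule member_le_sum) (use i in \<open>auto intro!: sum_nonneg\<close>)
    then show "?S i \<le> rel_bound A" by (simp add: rel_bound_def)
  qed
  finally show ?thesis .
qed

lemma rel_form_int:
  "rel_form A (\<lambda>j s. of_int (y j s)) i s \<in> \<int>"
  by (simp add: rel_form_def) (intro Ints_sum Ints_mult Ints_of_int)

text \<open>Dirichlet approximation turns a real solution of the integral linear system into an
  integral one: for a sufficiently good approximation the integer residuals are less than one.\<close>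

lemma rel_injective_iff_int: "rel_injective A \<longleftrightarrow> int_rel_injective A"
proof
  assume R: "rel_injective A"
  show "int_rel_injective A" unfolding int_rel_injective_def
  proof (intro allI impI)
    fix y :: "nat \<Rightarrow> 'a \<Rightarrow> int" and j s
    assume y: "fin_supp (dim_col A) (\<lambda>j s. of_int (y j s))"
      "\<forall>i<dim_row A. \<forall>s. rel_form A (\<lambda>j s. of_int (y j s)) i s = 0" and j: "j < dim_col A"
    have "real_of_int (y j s) = 0" using R[unfolded rel_injective_def, THEN spec[of _ "\<lambda>j s. of_int (y j s)"]] y j by blast
    then show "y j s = 0" by simp
  qed
next
  assume Z: "int_rel_injective A"
  show "rel_injective A" unfolding rel_injective_def
  proof (intro allI impI, rule ccontr)
    fix y j0 s0 assume fs: "fin_supp (dim_col A) y" and rel: "\<forall>i<dim_row A. \<forall>s. rel_form A y i s = 0"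
      and j0: "j0 < dim_col A" and ne: "y j0 s0 \<noteq> (0::real)"
    define P where "P = (SIGMA j:{..<dim_col A}. {s. y j s \<noteq> 0})"
    have finP: "finite P" unfolding P_def using fs by (intro finite_SigmaI) (auto simp: fin_supp_def)
    then obtain e :: "nat \<Rightarrow> nat \<times> 'a" and m where e: "bij_betw e {..<m} P"
      using bij_betw_from_nat_into_finite by blast
    \<comment> \<open>Normalises the chosen nonzero value to modulus 1; multiplied by the common
      denominator q it has modulus at least 1 and cannot be approximated by 0.\<close>
    define c where "c = 1 / \<bar>y j0 s0\<bar>"
    \<comment> \<open>Beyond \<open>rel_bound A\<close>, so that approximation errors below
      \<open>1 / N\<close> change each relation by less than 1.\<close>
    define N :: nat where "N = nat \<lceil>rel_bound A\<rceil> + 1"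
    have N: "real N > rel_bound A" "N > 0" unfolding N_def using rel_bound_ge_1[of A] by linarith+
    obtain q p where qp: "0 < q" "\<And>i. i < m \<Longrightarrow> \<bar>of_int q * (c * y (fst (e i)) (snd (e i))) - of_int (p i)\<bar> < 1 / real N"
      using Dirichlet_approx_simult[OF N(2), of m "\<lambda>i. c * y (fst (e i)) (snd (e i))"] by metis
    define z where "z = (\<lambda>j s. if (j, s) \<in> P then p (the_inv_into {..<m} e (j, s)) else 0)"
    have close: "\<bar>of_int (z j s) - of_int q * (c * y j s)\<bar> < 1 / real N" if j: "j < dim_col A" for j s
    proof (cases "(j, s) \<in> P")
      case True
      define i where "i = the_inv_into {..<m} e (j, s)"
      have "i < m" using e True unfolding i_def by (metis bij_betw_def lessThan_iff order_refl the_inv_into_into)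
      moreover have "e i = (j, s)" using e True unfolding i_def by (metis bij_betw_def f_the_inv_into_f)
      ultimately show ?thesis using qp(2)[of i] True by (simp add: z_def i_def[symmetric] abs_minus_commute)
    next
      case False
      then have "y j s = 0" using j by (simp add: P_def)
      then show ?thesis using False N by (simp add: z_def)
    qed
    have "{s. z j s \<noteq> 0} \<subseteq> snd ` P" for j unfolding z_def by (auto simp: image_iff split: if_splits) (metis snd_conv)
    then have fz: "fin_supp (dim_col A) (\<lambda>j s. of_int (z j s))"
      unfolding fin_supp_def of_int_eq_0_iff
      by (intro allI impI finite_subset[OF _ finite_imageI[OF finP]])
    have "rel_form A (\<lambda>j s. of_int (z j s)) i s = 0" if i: "i < dim_row A" for i s
    proof -
      have "rel_form A (\<lambda>j s. of_int (z j s) - of_int q * (c * y j s)) i s = rel_form A (\<lambda>j s. of_int (z j s)) i s"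
        unfolding rel_form_diff rel_form_scale using rel i by simp
      moreover have "\<bar>rel_form A (\<lambda>j s. of_int (z j s) - of_int q * (c * y j s)) i s\<bar> \<le> rel_bound A * (1 / real N)"
        by (rule rel_form_bound[OF i _ less_imp_le[OF close]]) (use N in simp_all)
      moreover have "rel_bound A * (1 / real N) < 1" using N by (simp add: field_simps)
      ultimately have "\<bar>rel_form A (\<lambda>j s. of_int (z j s)) i s\<bar> < 1" by linarith
      then show ?thesis using rel_form_int[of A z i s] by (rule Ints_nonzero_abs_less1[rotated])
    qed
    then have "z j0 s0 = 0" using Z[unfolded int_rel_injective_def, THEN spec[of _ z]] fz j0 by blast
    then have "of_int q * (c * \<bar>y j0 s0\<bar>) < 1 / real N" using close[OF j0, of s0] qp(1) ne by (simp add: abs_mult c_def)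
    moreover have "c * \<bar>y j0 s0\<bar> = 1" using ne by (simp add: c_def)
    moreover have "1 / real N \<le> 1" using N by simp
    ultimately show False using qp(1) by simp
  qed
qed

section \<open>Realising families of phases by points\<close>

text \<open>The value at x of the element \<open>\<Sum>j. a j \<cdot> \<phi> j\<close> of the dual
  module, in multiplicative notation.\<close>

definition pairing :: "(nat \<Rightarrow> 'x \<Rightarrow> complex) \<Rightarrow> ('g::group_add \<Rightarrow> 'x \<Rightarrow> 'x) \<Rightarrow> nat \<Rightarrow> (nat \<Rightarrow> 'g \<Rightarrow>\<^sub>0 int) \<Rightarrow> 'x \<Rightarrow> complex" where
  "pairing \<phi> act k a x = (\<Prod>j<k. \<Prod>t\<in>keys (a j). \<phi> j (act (- t) x) powi lookup (a j) t)"

text \<open>The module isomorphism in the only form used later: generating characters whose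
  relations are exactly the combinations of the rows of A.\<close>

definition dual_presentation ::
  "('g::group_add \<Rightarrow> 'x::topological_ab_group_add \<Rightarrow> 'x) \<Rightarrow> ('g \<Rightarrow>\<^sub>0 int) mat \<Rightarrow> (nat \<Rightarrow> 'x \<Rightarrow> complex) \<Rightarrow> bool" where
  "dual_presentation act A \<phi> \<longleftrightarrow>
    (\<forall>j<dim_col A. \<phi> j \<in> pontryagin_dual) \<and>
    (\<forall>\<kappa>\<in>pontryagin_dual. \<exists>a. \<kappa> = pairing \<phi> act (dim_col A) a) \<and>
    (\<forall>a. pairing \<phi> act (dim_col A) a = (\<lambda>x. 1) \<longleftrightarrow>
      (\<exists>b. \<forall>j<dim_col A. a j = (\<Sum>i<dim_row A. b i * A $$ (i, j))))"

text \<open>The generators are the images of the cosets of the unit row vectors. Quotient and dual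
  are bare records, so compatibility of cosets with addition and scalars is verified first; after
  that \<open>E\<close> behaves like a homomorphism with kernel \<open>N\<close>.\<close>

lemma dual_presentation_exists:
  fixes act :: "'g::group_add \<Rightarrow> 'x::topological_ab_group_add \<Rightarrow> 'x" and A :: "('g \<Rightarrow>\<^sub>0 int) mat"
  assumes "left_module_iso (presented_module A) (dual_module act) \<noteq> {}"
  shows "\<exists>\<phi>. dual_presentation act A \<phi>"
proof -
  define n where "n = dim_row A"
  define k where "k = dim_col A"
  have A: "A \<in> carrier_mat n k" by (simp add: n_def k_def)
  let ?M = "module_mat TYPE('g \<Rightarrow>\<^sub>0 int) 1 k"
  define N where "N = (\<lambda>b. b * A) ` carrier_mat 1 n"
  define cos where "cos = (\<lambda>a. (\<lambda>h. h + a) ` N)"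
  have cos_eq: "N +>\<^bsub>?M\<^esub> a = cos a" for a
    unfolding a_r_coset_def' cos_def by (auto simp: module_mat_simps)
  obtain \<theta> where th: "\<theta> \<in> left_module_iso (presented_module A) (dual_module act)" using assms by blast
  have P: "presented_module A = \<lparr>carrier = cos ` carrier_mat 1 k, mult = undefined, one = undefined,
      zero = N, add = set_add ?M, smult = (\<lambda>r C. \<Union>v\<in>C. cos (r \<cdot>\<^sub>m v))\<rparr>"
    unfolding presented_module_def quotient_module_def n_def[symmetric] k_def[symmetric] N_def[symmetric]
      A_RCOSETS_def' cos_eq module_mat_simps UNION_singleton_eq_range ..
  have NR: "h \<in> carrier_mat 1 k" if "h \<in> N" for h using that A by (auto simp: N_def)
  have N0: "0\<^sub>m 1 k \<in> N" unfolding N_def using A by (intro image_eqI[of _ _ "0\<^sub>m 1 n"]) auto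
  have Nadd: "h + h' \<in> N" if hh: "h \<in> N" "h' \<in> N" for h h'
  proof -
    obtain b b' where b: "b \<in> carrier_mat 1 n" "b' \<in> carrier_mat 1 n" "h = b * A" "h' = b' * A" using hh by (auto simp: N_def)
    then have "h + h' = (b + b') * A" using add_mult_distrib_mat[OF b(1,2) A] by simp
    then show ?thesis using b unfolding N_def by (intro image_eqI[of _ _ "b + b'"]) auto
  qed
  have Nsm: "r \<cdot>\<^sub>m h \<in> N" if hh: "h \<in> N" for h r
  proof -
    obtain b where b: "b \<in> carrier_mat 1 n" "h = b * A" using hh by (auto simp: N_def)
    have rb: "r \<cdot>\<^sub>m b \<in> carrier_mat 1 n" using b by simp
    have "r \<cdot>\<^sub>m h = (r \<cdot>\<^sub>m b) * A"
    proof (rule eq_matI)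
      fix i j assume "i < dim_row (r \<cdot>\<^sub>m b * A)" "j < dim_col (r \<cdot>\<^sub>m b * A)"
      then have ij: "i = 0" "j < k" using b A by auto
      have "(r \<cdot>\<^sub>m h) $$ (0, j) = r * (b * A) $$ (0, j)" using b A ij by simp
      also have "\<dots> = (\<Sum>l<n. r * (b $$ (0, l) * A $$ (l, j)))"
        unfolding row_mult_entry[OF b(1) A ij(2)] by (rule sum_distrib_left)
      also have "\<dots> = (r \<cdot>\<^sub>m b * A) $$ (0, j)"
        unfolding row_mult_entry[OF rb A ij(2)] by (intro sum.cong refl) (use b in \<open>simp add: mult.assoc\<close>)
      finally show "(r \<cdot>\<^sub>m h) $$ (i, j) = (r \<cdot>\<^sub>m b * A) $$ (i, j)" using ij by simp
    qed (use b A in auto)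
    then show ?thesis using rb unfolding N_def by (intro image_eqI[of _ _ "r \<cdot>\<^sub>m b"]) auto
  qed
  have Nmin: "- h \<in> N" if hh: "h \<in> N" for h
  proof -
    obtain b where b: "b \<in> carrier_mat 1 n" "h = b * A" using hh by (auto simp: N_def)
    then have "- h = (- b) * A" using A by simp
    then show ?thesis using b unfolding N_def by (intro image_eqI[of _ _ "- b"]) auto
  qed
  have cos_add: "cos a <+>\<^bsub>?M\<^esub> cos a' = cos (a + a')" if a: "a \<in> carrier_mat 1 k" "a' \<in> carrier_mat 1 k" for a a'
  proof
    show "cos a <+>\<^bsub>?M\<^esub> cos a' \<subseteq> cos (a + a')"
    proof
      fix v assume "v \<in> cos a <+>\<^bsub>?M\<^esub> cos a'"
      then obtain h h' where h: "h \<in> N" "h' \<in> N" "v = (h + a) + (h' + a')"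
        by (auto simp: set_add_def' cos_def module_mat_simps)
      have "v = (h + h') + (a + a')" unfolding h(3)
        by (rule eq_matI) (use a NR[OF h(1)] NR[OF h(2)] in auto)
      then show "v \<in> cos (a + a')" unfolding cos_def using Nadd[OF h(1,2)] by blast
    qed
    show "cos (a + a') \<subseteq> cos a <+>\<^bsub>?M\<^esub> cos a'"
    proof
      fix v assume "v \<in> cos (a + a')"
      then obtain h where h: "h \<in> N" "v = h + (a + a')" by (auto simp: cos_def)
      have "v = (h + a) + (0\<^sub>m 1 k + a')" unfolding h(2)
        by (rule eq_matI) (use a NR[OF h(1)] in auto)
      then show "v \<in> cos a <+>\<^bsub>?M\<^esub> cos a'"
        using h(1) N0 by (auto simp: set_add_def' cos_def module_mat_simps)
    qed
  qed
  have cos_N: "cos (h + a) = cos a" if h: "h \<in> N" and a: "a \<in> carrier_mat 1 k" for h a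
  proof
    show "cos (h + a) \<subseteq> cos a"
    proof
      fix v assume "v \<in> cos (h + a)"
      then obtain h' where h': "h' \<in> N" "v = h' + (h + a)" by (auto simp: cos_def)
      have "v = (h' + h) + a" unfolding h'(2) by (rule eq_matI) (use a NR[OF h] NR[OF h'(1)] in auto)
      then show "v \<in> cos a" unfolding cos_def using Nadd[OF h'(1) h] by blast
    qed
    show "cos a \<subseteq> cos (h + a)"
    proof
      fix v assume "v \<in> cos a"
      then obtain h' where h': "h' \<in> N" "v = h' + a" by (auto simp: cos_def)
      have "v = (h' + - h) + (h + a)" unfolding h'(2) by (rule eq_matI) (use a NR[OF h] NR[OF h'(1)] in auto)
      then show "v \<in> cos (h + a)" unfolding cos_def using Nadd[OF h'(1) Nmin[OF h]] by blast
    qed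
  qed
  have cos_sm: "(\<Union>v\<in>cos a. cos (r \<cdot>\<^sub>m v)) = cos (r \<cdot>\<^sub>m a)" if a: "a \<in> carrier_mat 1 k" for a r
  proof -
    have ra: "r \<cdot>\<^sub>m a \<in> carrier_mat 1 k" using a by simp
    have "cos (r \<cdot>\<^sub>m v) = cos (r \<cdot>\<^sub>m a)" if v: "v \<in> cos a" for v
    proof -
      obtain h where h: "h \<in> N" "v = h + a" using v by (auto simp: cos_def)
      have "r \<cdot>\<^sub>m v = r \<cdot>\<^sub>m h + r \<cdot>\<^sub>m a" unfolding h(2)
        by (rule eq_matI) (use a NR[OF h(1)] in \<open>auto simp: distrib_left\<close>)
      then show ?thesis using cos_N[OF Nsm[OF h(1)] ra] by simp
    qed
    moreover have "cos a \<noteq> {}" using N0 by (auto simp: cos_def)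
    ultimately show ?thesis by auto
  qed
  define E where "E = (\<lambda>a. \<theta> (cos a))"
  have iso: "\<theta> \<in> iso (add_monoid (presented_module A)) (add_monoid (dual_module act))"
    and smult: "\<forall>r. \<forall>m\<in>carrier (presented_module A). \<theta> (r \<odot>\<^bsub>presented_module A\<^esub> m) = r \<odot>\<^bsub>dual_module act\<^esub> \<theta> m"
    using th unfolding left_module_iso_def by blast+
  have bij: "bij_betw \<theta> (cos ` carrier_mat 1 k) pontryagin_dual"
    using iso unfolding iso_def P dual_module_def by (simp del: One_nat_def)
  have "\<forall>C\<in>cos ` carrier_mat 1 k. \<forall>C'\<in>cos ` carrier_mat 1 k. \<theta> (C <+>\<^bsub>?M\<^esub> C') = (\<lambda>x. \<theta> C x * \<theta> C' x)"
    using iso unfolding iso_def hom_def P dual_module_def by (simp del: One_nat_def)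
  then have hom: "\<theta> (C <+>\<^bsub>?M\<^esub> C') = (\<lambda>x. \<theta> C x * \<theta> C' x)"
    if "C \<in> cos ` carrier_mat 1 k" "C' \<in> cos ` carrier_mat 1 k" for C C' using that by blast
  have "\<forall>r. \<forall>C\<in>cos ` carrier_mat 1 k. \<theta> (\<Union>v\<in>C. cos (r \<cdot>\<^sub>m v)) =
        (\<lambda>x. \<Prod>s\<in>keys r. \<theta> C (act (- s) x) powi lookup r s)"
    using smult unfolding P dual_module_def by (simp del: One_nat_def)
  then have sm: "\<theta> (\<Union>v\<in>C. cos (r \<cdot>\<^sub>m v)) =
        (\<lambda>x. \<Prod>s\<in>keys r. \<theta> C (act (- s) x) powi lookup r s)"
    if "C \<in> cos ` carrier_mat 1 k" for r C using that by blast
  have Edual: "E a \<in> pontryagin_dual" if "a \<in> carrier_mat 1 k" for a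
    unfolding E_def by (rule bij_betw_apply[OF bij imageI[OF that]])
  have Eadd: "E (a + a') = (\<lambda>x. E a x * E a' x)" if "a \<in> carrier_mat 1 k" "a' \<in> carrier_mat 1 k" for a a'
    unfolding E_def cos_add[OF that, symmetric] by (rule hom[OF imageI[OF that(1)] imageI[OF that(2)]])
  have Esm: "E (r \<cdot>\<^sub>m a) = (\<lambda>x. \<Prod>s\<in>keys r. E a (act (- s) x) powi lookup r s)" if "a \<in> carrier_mat 1 k" for r a
    unfolding E_def cos_sm[OF that, symmetric] by (rule sm[OF imageI[OF that]])
  have E0: "E (0\<^sub>m 1 k) = (\<lambda>x. 1)"
  proof
    fix x
    have z: "0\<^sub>m 1 k \<in> carrier_mat 1 k" by simp
    have "E (0\<^sub>m 1 k) x = E (0\<^sub>m 1 k) x * E (0\<^sub>m 1 k) x" using fun_cong[OF Eadd[OF z z], of x] by simp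
    moreover have "cmod (E (0\<^sub>m 1 k) x) = 1" using Edual[OF z] unfolding pontryagin_dual_def by blast
    then have "E (0\<^sub>m 1 k) x \<noteq> 0" by force
    ultimately show "E (0\<^sub>m 1 k) x = 1" by simp
  qed
  have Eker: "E a = (\<lambda>x. 1) \<longleftrightarrow> a \<in> N" if a: "a \<in> carrier_mat 1 k" for a
  proof
    assume "E a = (\<lambda>x. 1)"
    then have "\<theta> (cos a) = \<theta> (cos (0\<^sub>m 1 k))" using E0 by (simp add: E_def)
    then have "cos a = cos (0\<^sub>m 1 k)"
      by (rule inj_onD[OF bij_betw_imp_inj_on[OF bij] _ imageI[OF a] imageI]) simp
    moreover have "a \<in> cos a" unfolding cos_def using N0 a by (intro image_eqI[of _ _ "0\<^sub>m 1 k"]) auto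
    ultimately obtain h where "h \<in> N" "a = h + 0\<^sub>m 1 k" by (auto simp: cos_def)
    then show "a \<in> N" using NR[of h] by simp
  next
    assume "a \<in> N"
    then have "cos (a + 0\<^sub>m 1 k) = cos (0\<^sub>m 1 k)" by (intro cos_N) auto
    then show "E a = (\<lambda>x. 1)" using E0 a by (simp add: E_def)
  qed
  define e where "e = (\<lambda>j. Matrix.mat 1 k (\<lambda>(_, i). if i = j then (1 :: 'g \<Rightarrow>\<^sub>0 int) else 0))"
  have ec: "e j \<in> carrier_mat 1 k" for j by (simp add: e_def)
  define \<phi> where "\<phi> = (\<lambda>j. E (e j))"
  define row where "row = (\<lambda>a. Matrix.mat 1 k (\<lambda>(_, j). a j :: 'g \<Rightarrow>\<^sub>0 int))"
  have rowc: "row a \<in> carrier_mat 1 k" for a by (simp add: row_def)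
  have Erow: "E (row a) = pairing \<phi> act k a" for a
  proof -
    \<comment> \<open>Truncated rows build a row vector one coordinate at a time, so that induction
      on m expresses its image through the generators.\<close>
    define tr where "tr = (\<lambda>m. Matrix.mat 1 k (\<lambda>(_, j). if j < m then a j else 0))"
    have trc: "tr m \<in> carrier_mat 1 k" for m by (simp add: tr_def)
    have "E (tr m) = (\<lambda>x. \<Prod>j<m. \<Prod>t\<in>keys (a j). \<phi> j (act (- t) x) powi lookup (a j) t)" for m
    proof (induction m)
      case 0
      have "tr 0 = 0\<^sub>m 1 k" by (rule eq_matI) (auto simp: tr_def)
      then show ?case using E0 by simp
    next
      case (Suc m)
      have "tr (Suc m) = tr m + a m \<cdot>\<^sub>m e m"
        by (rule eq_matI) (auto simp: tr_def e_def less_Suc_eq)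
      moreover have "a m \<cdot>\<^sub>m e m \<in> carrier_mat 1 k" using ec by simp
      ultimately show ?case using Eadd[OF trc[of m], of "a m \<cdot>\<^sub>m e m"] Esm[OF ec, of "a m" m] Suc
        by (simp add: \<phi>_def)
    qed
    from this[of k] have "E (tr k) = pairing \<phi> act k a" by (simp add: pairing_def fun_eq_iff)
    moreover have "tr k = row a" by (rule eq_matI) (auto simp: tr_def row_def)
    ultimately show ?thesis by simp
  qed
  have rowN: "row a \<in> N \<longleftrightarrow> (\<exists>b. \<forall>j<k. a j = (\<Sum>i<n. b i * A $$ (i, j)))" for a
  proof
    assume "row a \<in> N"
    then obtain b where b: "b \<in> carrier_mat 1 n" "row a = b * A" by (auto simp: N_def)
    have "a j = (\<Sum>i<n. b $$ (0, i) * A $$ (i, j))" if j: "j < k" for j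
      using row_mult_entry[OF b(1) A j] unfolding b(2)[symmetric] using j by (simp add: row_def)
    then show "\<exists>b. \<forall>j<k. a j = (\<Sum>i<n. b i * A $$ (i, j))" by (intro exI[of _ "\<lambda>i. b $$ (0, i)"]) auto
  next
    assume "\<exists>b. \<forall>j<k. a j = (\<Sum>i<n. b i * A $$ (i, j))"
    then obtain b where b: "\<And>j. j < k \<Longrightarrow> a j = (\<Sum>i<n. b i * A $$ (i, j))" by blast
    define b' where "b' = Matrix.mat 1 n (\<lambda>(_, i). b i)"
    have b': "b' \<in> carrier_mat 1 n" by (simp add: b'_def)
    have "row a = b' * A"
    proof (rule eq_matI)
      fix i j assume "i < dim_row (b' * A)" "j < dim_col (b' * A)"
      then have ij: "i = 0" "j < k" using b' A by auto
      show "row a $$ (i, j) = (b' * A) $$ (i, j)"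
        using ij b[OF ij(2)] unfolding ij(1) row_mult_entry[OF b' A ij(2)] by (simp add: row_def b'_def)
    qed (use b' A in \<open>auto simp: row_def\<close>)
    then show "row a \<in> N" using b' by (auto simp: N_def)
  qed
  have "dual_presentation act A \<phi>"
    unfolding dual_presentation_def n_def[symmetric] k_def[symmetric]
  proof (intro conjI allI impI ballI)
    show "\<phi> j \<in> pontryagin_dual" for j unfolding \<phi>_def by (rule Edual[OF ec])
  next
    fix \<kappa> :: "'x \<Rightarrow> complex" assume "\<kappa> \<in> pontryagin_dual"
    then obtain a where a: "a \<in> carrier_mat 1 k" "\<kappa> = E a" using bij unfolding bij_betw_def E_def by blast
    have "row (\<lambda>j. a $$ (0, j)) = a" by (rule eq_matI) (use a in \<open>auto simp: row_def\<close>)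
    then have "\<kappa> = pairing \<phi> act k (\<lambda>j. a $$ (0, j))" using a(2) Erow[of "\<lambda>j. a $$ (0, j)"] by simp
    then show "\<exists>a. \<kappa> = pairing \<phi> act k a" by blast
  next
    fix a
    show "pairing \<phi> act k a = (\<lambda>x. 1) \<longleftrightarrow> (\<exists>b. \<forall>j<k. a j = (\<Sum>i<n. b i * A $$ (i, j)))"
      unfolding Erow[symmetric] Eker[OF rowc] rowN ..
  qed
  then show ?thesis by blast
qed

text \<open>The additive counterpart of one factor of \<open>pairing\<close>: if \<open>y s\<close>
  is a phase of a character at \<open>act s x\<close>, this is a phase at x of the character
  multiplied by f. The sign comes from the inverse in the dual action.\<close>

definition gr_eval :: "('g::group_add \<Rightarrow>\<^sub>0 int) \<Rightarrow> ('g \<Rightarrow> real) \<Rightarrow> real" where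
  "gr_eval f y = (\<Sum>t\<in>keys f. of_int (lookup f t) * y (- t))"

lemma gr_eval_superset:
  assumes "finite T" "keys f \<subseteq> T"
  shows "gr_eval f y = (\<Sum>t\<in>T. of_int (lookup f t) * y (- t))"
  unfolding gr_eval_def by (rule sum.mono_neutral_left) (use assms in \<open>auto simp: in_keys_iff\<close>)

lemma gr_eval_add: "gr_eval (f + g) y = gr_eval f y + gr_eval g y"
proof -
  let ?T = "keys f \<union> keys g"
  have "gr_eval (f + g) y = (\<Sum>t\<in>?T. of_int (lookup (f + g) t) * y (- t))"
    by (rule gr_eval_superset) (auto simp: in_keys_iff lookup_add)
  also have "\<dots> = (\<Sum>t\<in>?T. of_int (lookup f t) * y (- t)) + (\<Sum>t\<in>?T. of_int (lookup g t) * y (- t))"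
    by (simp add: lookup_add algebra_simps sum.distrib)
  finally show ?thesis by (simp add: gr_eval_superset[of ?T f] gr_eval_superset[of ?T g])
qed

lemma gr_eval_sum: "gr_eval (\<Sum>i\<in>I. f i) y = (\<Sum>i\<in>I. gr_eval (f i) y)"
proof (induction I rule: infinite_finite_induct)
  case (insert i I) then show ?case by (simp add: gr_eval_add)
qed (simp_all add: gr_eval_def)

lemma gr_eval_single: "gr_eval (single t c) y = of_int c * y (- t)"
  by (cases "c = 0") (simp_all add: gr_eval_def)

text \<open>Inversion reverses the order of the product, so the left factor b acts through right
  translations of y. This is the form in which \<open>rel_form\<close> appears.\<close>

lemma gr_eval_mult:
  "gr_eval (b * f) y = (\<Sum>s\<in>keys b. of_int (lookup b s) *
     (\<Sum>t\<in>keys f. of_int (lookup f t) * y (- t + - s)))"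
proof -
  have "b * f = (\<Sum>s\<in>keys b. \<Sum>t\<in>keys f.
      single (s + t) (lookup b s * lookup f t))"
    by (subst (1) poly_mapping_sum_single[of b], subst (1) poly_mapping_sum_single[of f])
       (simp add: sum_product mult_single)
  then show ?thesis
    by (simp add: gr_eval_sum gr_eval_single sum_distrib_left mult.assoc minus_add)
qed

lemma powi_prod_superset:
  fixes z :: "'g \<Rightarrow> complex"
  assumes "finite T" "keys f \<subseteq> T"
  shows "(\<Prod>t\<in>keys f. z t powi lookup f t) = (\<Prod>t\<in>T. z t powi lookup f t)"
  by (rule prod.mono_neutral_left) (use assms in \<open>auto simp: in_keys_iff\<close>)

lemma powi_prod_add:
  fixes z :: "'g \<Rightarrow> complex"
  assumes "\<And>t. z t \<noteq> 0"
  shows "(\<Prod>t\<in>keys (f + g). z t powi lookup (f + g) t) =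
    (\<Prod>t\<in>keys f. z t powi lookup f t) * (\<Prod>t\<in>keys g. z t powi lookup g t)"
proof -
  let ?T = "keys f \<union> keys g"
  have "(\<Prod>t\<in>keys (f + g). z t powi lookup (f + g) t) = (\<Prod>t\<in>?T. z t powi lookup (f + g) t)"
    by (rule powi_prod_superset) (auto simp: in_keys_iff lookup_add)
  also have "\<dots> = (\<Prod>t\<in>?T. z t powi lookup f t) * (\<Prod>t\<in>?T. z t powi lookup g t)"
    unfolding prod.distrib[symmetric] lookup_add using assms by (intro prod.cong refl power_int_add) auto
  finally show ?thesis by (simp add: powi_prod_superset[of ?T f] powi_prod_superset[of ?T g])
qed

section \<open>Real phases of unimodular numbers\<close>

lemma cis_powi: "cis x powi m = cis (of_int m * x)"
proof (cases "m \<ge> 0")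
  case True
  then have "cis x powi m = cis x ^ nat m" by (rule power_int_nonneg_exp)
  also have "\<dots> = cis (real (nat m) * x)" by (rule Complex.DeMoivre)
  finally show ?thesis using True by simp
next
  case False
  then have "cis x powi m = inverse (cis x) ^ nat (- m)" by (simp only: power_int_def if_False)
  also have "inverse (cis x) = cis (- x)" by (rule cis_inverse)
  also have "cis (- x) ^ nat (- m) = cis (real (nat (- m)) * (- x))" by (rule Complex.DeMoivre)
  finally show ?thesis using False by simp
qed

lemma cis_sum: "cis (\<Sum>i\<in>I. f i) = (\<Prod>i\<in>I. cis (f i))"
proof (induction I rule: infinite_finite_induct)
  case (insert i I)
  have "cis (f i + sum f I) = cis (f i) * cis (sum f I)" by (rule cis_mult[symmetric])
  then show ?case using insert by simp
qed simp_all

lemma cis_2pi_eq_1_iff: "cis (2 * pi * r) = 1 \<longleftrightarrow> r \<in> \<int>"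
proof
  assume "cis (2 * pi * r) = 1"
  then have "cos (2 * pi * r) = 1" by (simp add: complex_eq_iff)
  then obtain m :: int where "2 * pi * r = of_int m * 2 * pi" unfolding cos_one_2pi_int by blast
  then have "(2 * pi) * (r - of_int m) = 0" unfolding right_diff_distrib by simp
  then have "r = of_int m" by simp
  then show "r \<in> \<int>" by simp
next
  assume "r \<in> \<int>"
  then obtain m :: int where "r = of_int m" by (auto elim: Ints_cases)
  then have "cis (2 * pi * r) = cis (2 * pi) powi m" unfolding cis_powi by (simp only: mult.commute)
  then show "cis (2 * pi * r) = 1" by (simp only: cis_2pi power_int_1_left)
qed

lemma cis_2pi_eq_iff: "cis (2 * pi * r) = cis (2 * pi * r') \<longleftrightarrow> r - r' \<in> \<int>"
proof -
  have "cis (2 * pi * (r - r')) = cis (2 * pi * r) / cis (2 * pi * r')"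
    unfolding cis_divide right_diff_distrib ..
  then show ?thesis unfolding cis_2pi_eq_1_iff[symmetric] by (simp only: divide_eq_1_iff cis_neq_zero simp_thms)
qed

locale presented_action =
  fixes act :: "'g::group_add \<Rightarrow> 'x::topological_ab_group_add \<Rightarrow> 'x" and A :: "('g \<Rightarrow>\<^sub>0 int) mat"
    and \<phi> :: "nat \<Rightarrow> 'x \<Rightarrow> complex" and \<rho> :: "'x \<Rightarrow> 'x \<Rightarrow> real"
  assumes compact_X: "compact (UNIV :: 'x set)"
    and action: "automorphism_action act"
    and metric: "compatible_metric \<rho>"
    and presentation: "dual_presentation act A \<phi>"
begin

abbreviation "n \<equiv> dim_row A"
abbreviation "k \<equiv> dim_col A"

lemma act_add: "act (s + t) x = act s (act t x)" and act_0: "act 0 x = x"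
  and act_hom: "act s (x + y) = act s x + act s y" and act_cont: "continuous_on UNIV (act s)"
  using action unfolding automorphism_action_def by blast+

lemma act_zero [simp]: "act s 0 = 0"
  using act_hom[of s 0 0] by simp

lemma phi_dual: "j < k \<Longrightarrow> \<phi> j \<in> pontryagin_dual"
  using presentation by (simp add: dual_presentation_def)

lemma phi_norm: "j < k \<Longrightarrow> cmod (\<phi> j x) = 1"
  using phi_dual by (auto simp: pontryagin_dual_iff)

lemma phi_nz: "j < k \<Longrightarrow> \<phi> j x \<noteq> 0"
  using phi_norm[of j x] by force

lemma dual_pairing: "\<kappa> \<in> pontryagin_dual \<Longrightarrow> \<exists>a. \<kappa> = pairing \<phi> act k a"
  using presentation by (simp add: dual_presentation_def)

lemma pairing_one_iff:
  "pairing \<phi> act k a = (\<lambda>x. 1) \<longleftrightarrow> (\<exists>b. \<forall>j<k. a j = (\<Sum>i<n. b i * A $$ (i, j)))"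
  using presentation by (simp add: dual_presentation_def)

lemma pairing_add: "pairing \<phi> act k (\<lambda>j. a j + b j) x = pairing \<phi> act k a x * pairing \<phi> act k b x"
  unfolding pairing_def prod.distrib[symmetric]
  by (intro prod.cong refl powi_prod_add) (simp add: phi_nz)

lemma pairing_nz: "pairing \<phi> act k a x \<noteq> 0"
  unfolding pairing_def by (auto simp: phi_nz)

lemma pairing_cis:
  assumes "\<And>j s. j < k \<Longrightarrow> \<phi> j (act s x) = cis (2 * pi * y j s)"
  shows "pairing \<phi> act k a (act s x) = cis (2 * pi * (\<Sum>j<k. gr_eval (a j) (\<lambda>u. y j (u + s))))"
proof -
  have "pairing \<phi> act k a (act s x) = (\<Prod>j<k. \<Prod>t\<in>keys (a j). cis (of_int (lookup (a j) t) * (2 * pi * y j (- t + s))))"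
    unfolding pairing_def act_add[symmetric]
    by (rule prod.cong[OF refl], rule prod.cong[OF refl]) (simp add: assms cis_powi)
  also have "\<dots> = cis (\<Sum>j<k. \<Sum>t\<in>keys (a j). of_int (lookup (a j) t) * (2 * pi * y j (- t + s)))"
    by (simp only: cis_sum)
  also have "(\<Sum>j<k. \<Sum>t\<in>keys (a j). of_int (lookup (a j) t) * (2 * pi * y j (- t + s)))
      = 2 * pi * (\<Sum>j<k. gr_eval (a j) (\<lambda>u. y j (u + s)))"
    by (simp add: gr_eval_def sum_distrib_left algebra_simps)
  finally show ?thesis .
qed

text \<open>Each row of A is a relation among the generators, hence trivial as a character;
  evaluated at \<open>act s x\<close>, its phase is an integer.\<close>

lemma rel_form_integral:
  assumes y: "\<And>j s. j < k \<Longrightarrow> \<phi> j (act s x) = cis (2 * pi * y j s)" and i: "i < n"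
  shows "rel_form A y i s \<in> \<int>"
proof -
  have "pairing \<phi> act k (\<lambda>j. A $$ (i, j)) = (\<lambda>x. 1)"
    unfolding pairing_one_iff
  proof (intro exI[of _ "\<lambda>l. if l = i then 1 else 0"] allI impI)
    fix j assume "j < k"
    have "(\<Sum>l<n. (if l = i then 1 else 0) * A $$ (l, j)) = (\<Sum>l<n. if l = i then A $$ (l, j) else 0)"
      by (intro sum.cong) auto
    then show "A $$ (i, j) = (\<Sum>l<n. (if l = i then 1 else 0) * A $$ (l, j))" using i by simp
  qed
  then have "cis (2 * pi * (\<Sum>j<k. gr_eval (A $$ (i, j)) (\<lambda>u. y j (u + s)))) = 1"
    using pairing_cis[where x=x and y=y and a="\<lambda>j. A $$ (i, j)" and s=s, OF y] by simp
  then show ?thesis unfolding cis_2pi_eq_1_iff by (simp add: rel_form_def gr_eval_def)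
qed

text \<open>This is the well-definedness behind \<open>realise\<close>: coefficients of the same
  character differ by a combination of the rows of A, and its phase is an integral combination of
  values of \<open>rel_form\<close>.\<close>

lemma pairing_eq_imp_int:
  assumes eq: "pairing \<phi> act k a = pairing \<phi> act k a'" and int: "\<And>i s. i < n \<Longrightarrow> rel_form A y i s \<in> \<int>"
  shows "(\<Sum>j<k. gr_eval (a j) (y j)) - (\<Sum>j<k. gr_eval (a' j) (y j)) \<in> \<int>"
proof -
  have "pairing \<phi> act k (\<lambda>j. a j - a' j) x = 1" for x
    using pairing_add[of "\<lambda>j. a j - a' j" a' x] eq pairing_nz[of a' x] by simp
  then have "pairing \<phi> act k (\<lambda>j. a j - a' j) = (\<lambda>x. 1)" by auto
  then obtain b where b: "\<And>j. j < k \<Longrightarrow> a j - a' j = (\<Sum>i<n. b i * A $$ (i, j))" unfolding pairing_one_iff by blast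
  have "gr_eval (a j) (y j) - gr_eval (a' j) (y j) = (\<Sum>i<n. gr_eval (b i * A $$ (i, j)) (y j))" if "j < k" for j
  proof -
    have "gr_eval (a j - a' j + a' j) (y j) = gr_eval (a j - a' j) (y j) + gr_eval (a' j) (y j)" by (rule gr_eval_add)
    moreover have "gr_eval (a j - a' j) (y j) = (\<Sum>i<n. gr_eval (b i * A $$ (i, j)) (y j))"
      unfolding b[OF that] by (rule gr_eval_sum)
    ultimately show ?thesis by simp
  qed
  then have "(\<Sum>j<k. gr_eval (a j) (y j)) - (\<Sum>j<k. gr_eval (a' j) (y j)) = (\<Sum>j<k. \<Sum>i<n. gr_eval (b i * A $$ (i, j)) (y j))"
    unfolding sum_subtractf[symmetric] by (intro sum.cong refl) simp
  also have "\<dots> = (\<Sum>i<n. \<Sum>j<k. \<Sum>s\<in>keys (b i). of_int (lookup (b i) s) *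
     (\<Sum>t\<in>keys (A $$ (i, j)). of_int (lookup (A $$ (i, j)) t) * y j (- t + - s)))"
    unfolding gr_eval_mult by (rule sum.swap)
  also have "\<dots> = (\<Sum>i<n. \<Sum>s\<in>keys (b i). \<Sum>j<k. of_int (lookup (b i) s) *
     (\<Sum>t\<in>keys (A $$ (i, j)). of_int (lookup (A $$ (i, j)) t) * y j (- t + - s)))"
    by (rule sum.cong[OF refl], rule sum.swap)
  also have "\<dots> = (\<Sum>i<n. \<Sum>s\<in>keys (b i). of_int (lookup (b i) s) * rel_form A y i (- s))"
    unfolding rel_form_def sum_distrib_left[symmetric] ..
  also have "\<dots> \<in> \<int>" by (intro Ints_sum Ints_mult Ints_of_int int) auto
  finally show ?thesis .
qed

text \<open>The phases y define a homomorphism from the dual into the circle, and by duality this is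
  evaluation at a point.\<close>

lemma realise:
  assumes int: "\<And>i s. i < n \<Longrightarrow> rel_form A y i s \<in> \<int>"
  shows "\<exists>x. \<forall>j<k. \<forall>s. \<phi> j (act s x) = cis (2 * pi * y j s)"
proof -
  define tot where "tot = (\<lambda>a. \<Sum>j<k. gr_eval (a j) (y j))"
  \<comment> \<open>A character has many coefficient families. An arbitrary one is chosen, since the
    resulting value does not depend on it.\<close>
  define h where "h = (\<lambda>\<kappa>. cis (2 * pi * tot (SOME a. \<kappa> = pairing \<phi> act k a)))"
  have h: "h (pairing \<phi> act k a) = cis (2 * pi * tot a)" for a
  proof -
    have "pairing \<phi> act k a = pairing \<phi> act k (SOME b. pairing \<phi> act k a = pairing \<phi> act k b)"
      by (rule someI[of "\<lambda>b. pairing \<phi> act k a = pairing \<phi> act k b", OF refl])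
    from pairing_eq_imp_int[OF this[symmetric] int] show ?thesis
      unfolding h_def cis_2pi_eq_iff tot_def .
  qed
  have tot_add: "tot (\<lambda>j. a j + b j) = tot a + tot b" for a b
    by (simp add: tot_def gr_eval_add sum.distrib)
  have "\<exists>x. \<forall>\<kappa>\<in>pontryagin_dual. \<kappa> x = h \<kappa>"
  proof (rule pontryagin_surj[OF compact_X])
    fix \<kappa> \<psi> :: "'x \<Rightarrow> complex" assume "\<kappa> \<in> pontryagin_dual" "\<psi> \<in> pontryagin_dual"
    then obtain a b where ab: "\<kappa> = pairing \<phi> act k a" "\<psi> = pairing \<phi> act k b"
      using dual_pairing[of \<kappa>] dual_pairing[of \<psi>] by blast
    have "(\<lambda>x. \<kappa> x * \<psi> x) = pairing \<phi> act k (\<lambda>j. a j + b j)"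
      unfolding ab by (rule ext) (simp only: pairing_add)
    then show "h (\<lambda>x. \<kappa> x * \<psi> x) = h \<kappa> * h \<psi>"
      by (simp only: h tot_add distrib_left cis_mult[symmetric]) (simp only: ab h)
  next
    fix \<kappa> :: "'x \<Rightarrow> complex" show "cmod (h \<kappa>) = 1" by (simp add: h_def)
  qed
  then obtain x where x: "\<And>\<kappa>. \<kappa> \<in> pontryagin_dual \<Longrightarrow> \<kappa> x = h \<kappa>" by blast
  have "\<phi> j (act s x) = cis (2 * pi * y j s)" if j: "j < k" for j s
  proof -
    \<comment> \<open>The module action involves inverses, so evaluation of the j-th generator at
      \<open>act s x\<close> corresponds to the group element \<open>- s\<close>.\<close>
    define a where "a = (\<lambda>l. if l = j then single (- s) (1::int) else 0)"
    have 1: "pairing \<phi> act k a = (\<lambda>x. \<phi> j (act s x))"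
    proof
      fix x
      have "pairing \<phi> act k a x = (\<Prod>l<k. if l = j then \<phi> j (act s x) else 1)"
        unfolding pairing_def by (rule prod.cong[OF refl]) (simp add: a_def)
      then show "pairing \<phi> act k a x = \<phi> j (act s x)" using j by simp
    qed
    have "tot a = (\<Sum>l<k. if l = j then y j s else 0)"
      unfolding tot_def by (rule sum.cong[OF refl]) (simp add: a_def gr_eval_single, simp add: gr_eval_def)
    then have 2: "tot a = y j s" using j by simp
    have "(\<lambda>x. \<phi> j (act s x)) \<in> pontryagin_dual"
    proof -
      have "continuous_on UNIV (\<phi> j)" "\<And>x y. \<phi> j (x + y) = \<phi> j x * \<phi> j y"
        using phi_dual[OF j] by (simp_all only: pontryagin_dual_iff)
      then show ?thesis unfolding pontryagin_dual_iff
        using continuous_on_UNIV_compose[of "\<phi> j" UNIV "act s"] act_cont phi_norm[OF j] by (simp add: act_hom)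
    qed
    from x[OF this] have "\<phi> j (act s x) = h (pairing \<phi> act k a)" by (simp only: 1)
    then show ?thesis by (simp only: h 2)
  qed
  then show ?thesis by blast
qed

text \<open>Every character is a product of powers of translated generators, so agreement of the
  generators along the orbits means agreement of all characters.\<close>

lemma separates:
  assumes "\<And>j s. j < k \<Longrightarrow> \<phi> j (act s x) = \<phi> j (act s y)"
  shows "x = y"
proof (rule ccontr)
  assume "x \<noteq> y"
  then have "x - y \<noteq> 0" by simp
  then obtain \<kappa> where \<kappa>: "\<kappa> \<in> pontryagin_dual" "\<kappa> (x - y) \<noteq> 1" using peter_weyl[OF compact_X metric \<open>x - y \<noteq> 0\<close>] by blast
  obtain a where a: "\<kappa> = pairing \<phi> act k a" using dual_pairing[OF \<kappa>(1)] by blast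
  have "\<kappa> x = \<kappa> y" unfolding a pairing_def
    by (rule prod.cong[OF refl], rule prod.cong[OF refl]) (simp add: assms)
  moreover have "\<kappa> (x - y + y) = \<kappa> (x - y) * \<kappa> y" using \<kappa>(1) by (simp only: pontryagin_dual_iff)
  then have "\<kappa> (x - y) * \<kappa> y = \<kappa> x" by simp
  moreover have "\<kappa> y \<noteq> 0" unfolding a by (rule pairing_nz)
  ultimately show False using \<kappa>(2) by simp
qed

end

section \<open>Linear algebra over finite index sets\<close>

definition ip :: "'i set \<Rightarrow> ('i \<Rightarrow> real) \<Rightarrow> ('i \<Rightarrow> real) \<Rightarrow> real" where
  "ip I v w = (\<Sum>i\<in>I. v i * w i)"

lemma ip_diff: "ip I v (\<lambda>i. w i - w' i) = ip I v w - ip I v w'"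
  by (simp add: ip_def algebra_simps sum_subtractf)

lemma ip_scale: "ip I v (\<lambda>i. a * w i) = a * ip I v w"
  by (simp add: ip_def sum_distrib_left algebra_simps)

lemma ip_sum: "ip I v (\<lambda>i. \<Sum>l\<in>L. a l * u l i) = (\<Sum>l\<in>L. a l * ip I v (u l))"
proof -
  have "ip I v (\<lambda>i. \<Sum>l\<in>L. a l * u l i) = (\<Sum>i\<in>I. \<Sum>l\<in>L. a l * (v i * u l i))"
    by (simp add: ip_def sum_distrib_left algebra_simps)
  also have "\<dots> = (\<Sum>l\<in>L. a l * ip I v (u l))"
    by (subst sum.swap) (simp add: ip_def sum_distrib_left)
  finally show ?thesis .
qed

lemma ip_commute: "ip I v w = ip I w v"
  by (simp add: ip_def mult.commute)

lemma ip_cong: "(\<And>i. i \<in> I \<Longrightarrow> w i = w' i) \<Longrightarrow> ip I v w = ip I v w'"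
  by (simp add: ip_def)

lemma ip_self_nonneg: "ip I v v \<ge> 0"
  by (simp add: ip_def sum_nonneg)

lemma ip_self_eq_0: "finite I \<Longrightarrow> ip I v v = 0 \<longleftrightarrow> (\<forall>i\<in>I. v i = 0)"
  by (simp add: ip_def sum_nonneg_eq_0_iff)

text \<open>Gaussian elimination: a pivot p of equation j removes one equation and one
  unknown.\<close>

lemma homogeneous_system:
  fixes H :: "'j \<Rightarrow> 'i \<Rightarrow> real"
  assumes "finite J" "finite I" "card J < card I"
  shows "\<exists>v. (\<exists>i\<in>I. v i \<noteq> 0) \<and> (\<forall>j\<in>J. ip I (H j) v = 0)"
  using assms
proof (induction J arbitrary: I H rule: finite_induct)
  case empty
  then obtain i where "i \<in> I" by (metis card.empty equals0I less_nat_zero_code)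
  then show ?case by (intro exI[of _ "\<lambda>_. 1"]) auto
next
  case (insert j J)
  show ?case
  proof (cases "\<exists>p\<in>I. H j p \<noteq> 0")
    case False
    have "card J < card I" using insert by auto
    from insert.IH[OF insert.prems(1) this, of H] obtain v where "\<exists>i\<in>I. v i \<noteq> 0" "\<forall>j\<in>J. ip I (H j) v = 0" by blast
    moreover have "ip I (H j) v = 0" using False by (simp add: ip_def)
    ultimately show ?thesis by (intro exI[of _ v]) auto
  next
    case True
    then obtain p where p: "p \<in> I" "H j p \<noteq> 0" by blast
    define H' where "H' = (\<lambda>j' i. H j' i - H j' p / H j p * H j i)"
    have "card J < card (I - {p})" using insert p by auto
    from insert.IH[OF _ this, of H'] insert.prems(1) obtain v' where
      v': "\<exists>i\<in>I - {p}. v' i \<noteq> 0" "\<forall>j\<in>J. ip (I - {p}) (H' j) v' = 0" by auto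
    define v where "v = v'(p := - ip (I - {p}) (H j) v' / H j p)"
    have split: "ip I g v = g p * v p + ip (I - {p}) g v'" for g
    proof -
      have "ip I g v = g p * v p + ip (I - {p}) g v"
        unfolding ip_def by (rule sum.remove[OF insert.prems(1) p(1)])
      also have "ip (I - {p}) g v = ip (I - {p}) g v'" by (rule ip_cong) (simp add: v_def)
      finally show ?thesis .
    qed
    have "ip I (H j') v = 0" if "j' \<in> insert j J" for j'
    proof (cases "j' = j")
      case True then show ?thesis unfolding split using p by (simp add: v_def)
    next
      case False
      have "ip (I - {p}) (H' j') v' = ip (I - {p}) (H j') v' - H j' p / H j p * ip (I - {p}) (H j) v'"
        unfolding ip_commute[of _ _ v'] H'_def ip_diff ip_scale ..
      then show ?thesis unfolding split using v'(2) False that by (simp add: v_def)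
    qed
    moreover have "\<exists>i\<in>I. v i \<noteq> 0" using v'(1) by (auto simp: v_def)
    ultimately show ?thesis by blast
  qed
qed

text \<open>The functionals indexed by \<open>J1\<close> are injective on the common kernel of those
  indexed by \<open>J0\<close>, so the dimension of that kernel is at most their number.\<close>

lemma orthonormal_card_le:
  fixes H :: "'j \<Rightarrow> 'i \<Rightarrow> real" and u :: "nat \<Rightarrow> 'i \<Rightarrow> real"
  assumes fin: "finite I" "finite J1"
    and inj: "\<And>v. (\<forall>j\<in>J0 \<union> J1. ip I (H j) v = 0) \<Longrightarrow> \<forall>i\<in>I. v i = 0"
    and V: "\<And>l j. l < d \<Longrightarrow> j \<in> J0 \<Longrightarrow> ip I (H j) (u l) = 0"
    and on: "\<And>l m. l < d \<Longrightarrow> m < d \<Longrightarrow> ip I (u l) (u m) = (if l = m then 1 else 0)"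
  shows "d \<le> card J1"
proof (rule ccontr)
  assume "\<not> d \<le> card J1"
  then have "card J1 < card {..<d}" by simp
  from homogeneous_system[OF fin(2) _ this, of "\<lambda>j l. ip I (H j) (u l)"] obtain a where
    a: "\<exists>l\<in>{..<d}. a l \<noteq> 0" "\<forall>j\<in>J1. ip {..<d} (\<lambda>l. ip I (H j) (u l)) a = 0" by blast
  define v where "v = (\<lambda>i. \<Sum>l<d. a l * u l i)"
  have "ip I (H j) v = 0" if "j \<in> J0 \<union> J1" for j
  proof -
    have "ip I (H j) v = (\<Sum>l<d. a l * ip I (H j) (u l))" unfolding v_def by (rule ip_sum)
    moreover have "\<dots> = 0"
    proof (cases "j \<in> J0")
      case True then show ?thesis using V by simp
    next
      case False then show ?thesis using that a(2) by (simp add: ip_def mult.commute)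
    qed
    ultimately show ?thesis by simp
  qed
  then have v0: "\<forall>i\<in>I. v i = 0" using inj by blast
  have "a m = 0" if m: "m < d" for m
  proof -
    have "0 = ip I (u m) v" using v0 by (simp add: ip_def)
    also have "\<dots> = (\<Sum>l<d. a l * ip I (u m) (u l))" unfolding v_def by (rule ip_sum)
    also have "\<dots> = (\<Sum>l<d. if l = m then a l else 0)" by (intro sum.cong refl) (use on m in auto)
    also have "\<dots> = a m" using m by simp
    finally show ?thesis by simp
  qed
  then show False using a(1) by auto
qed

text \<open>The diagonal entries of the orthogonal projection onto the kernel of \<open>J0\<close>
  sum to its dimension, which is at most \<open>card J1\<close>. A vector of the kernel with a fixed
  share of its square norm at coordinate i forces the i-th diagonal entry to be at least that
  share.\<close>

lemma leverage_bound:
  fixes H :: "'j \<Rightarrow> 'i \<Rightarrow> real" and v :: "'i \<Rightarrow> 'i \<Rightarrow> real"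
  assumes fin: "finite I" "finite J1"
    and inj: "\<And>v. (\<forall>j\<in>J0 \<union> J1. ip I (H j) v = 0) \<Longrightarrow> \<forall>i\<in>I. v i = 0"
    and sub: "I' \<subseteq> I"
    and V: "\<And>i j. i \<in> I' \<Longrightarrow> j \<in> J0 \<Longrightarrow> ip I (H j) (v i) = 0"
    and big: "\<And>i. i \<in> I' \<Longrightarrow> \<kappa> * ip I (v i) (v i) \<le> (v i i)\<^sup>2" "\<And>i. i \<in> I' \<Longrightarrow> v i i \<noteq> 0"
  shows "\<kappa> * real (card I') \<le> real (card J1)"
proof -
  define ON where "ON = (\<lambda>d (u :: nat \<Rightarrow> 'i \<Rightarrow> real). (\<forall>l<d. \<forall>j\<in>J0. ip I (H j) (u l) = 0)
    \<and> (\<forall>l<d. \<forall>m<d. ip I (u l) (u m) = (if l = m then 1 else 0)))"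
  have bound: "d \<le> card J1" if "ON d u" for d u
    by (rule orthonormal_card_le[OF fin inj, where u=u]) (use that in \<open>auto simp: ON_def\<close>)
  have "ON 0 (\<lambda>_ _. 0)" by (simp add: ON_def)
  then have "\<exists>d. (\<exists>u. ON d u) \<and> (\<forall>d'. (\<exists>u. ON d' u) \<longrightarrow> d' \<le> d)"
    using bound by (intro Nat.ex_has_greatest_nat[of "\<lambda>d. \<exists>u. ON d u" 0 "card J1"]) auto
  then obtain d u where d: "ON d u" "\<And>d' u'. ON d' u' \<Longrightarrow> d' \<le> d" by blast
  have u0: "ip I (H j) (u l) = 0" if "l < d" "j \<in> J0" for l j using d(1) that by (simp add: ON_def)
  have uu: "ip I (u l) (u m) = (if l = m then 1 else 0)" if "l < d" "m < d" for l m using d(1) that by (simp add: ON_def)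
  \<comment> \<open>A maximal orthonormal system spans the kernel: a nonzero remainder, normalised
    as in the Gram-Schmidt process, would extend it.\<close>
  have expand: "w i = (\<Sum>l<d. ip I w (u l) * u l i)" if w: "\<And>j. j \<in> J0 \<Longrightarrow> ip I (H j) w = 0" and i: "i \<in> I" for w i
  proof (rule ccontr)
    assume ne: "w i \<noteq> (\<Sum>l<d. ip I w (u l) * u l i)"
    define r where "r = (\<lambda>i. w i - (\<Sum>l<d. ip I w (u l) * u l i))"
    have "r i \<noteq> 0" using ne by (simp add: r_def)
    then have "ip I r r \<noteq> 0" using ip_self_eq_0[OF fin(1), of r] i by blast
    then have rpos: "ip I r r > 0" using ip_self_nonneg[of I r] by simp
    have r0: "ip I (H j) r = 0" if "j \<in> J0" for j
      unfolding r_def ip_diff ip_sum using w[OF that] u0[OF _ that] by simp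
    have ru: "ip I (u m) r = 0" if m: "m < d" for m
    proof -
      have "(\<Sum>l<d. ip I w (u l) * ip I (u m) (u l)) = (\<Sum>l<d. if l = m then ip I w (u l) else 0)"
        by (intro sum.cong refl) (use uu m in auto)
      also have "\<dots> = ip I (u m) w" using m by (simp add: ip_commute)
      finally show ?thesis unfolding r_def ip_diff ip_sum by simp
    qed
    define u' where "u' = u(d := (\<lambda>i. (1 / sqrt (ip I r r)) * r i))"
    have n1: "ip I (u' d) (u' d) = 1"
    proof -
      have "ip I (u' d) (u' d) = (1 / sqrt (ip I r r)) * ((1 / sqrt (ip I r r)) * ip I r r)"
        unfolding u'_def fun_upd_same ip_scale by (simp only: ip_commute[of I "\<lambda>i. (1 / sqrt (ip I r r)) * r i"] ip_scale)
      also have "\<dots> = 1" using rpos by (simp add: field_simps)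
      finally show ?thesis .
    qed
    have n2: "ip I (u m) (u' d) = 0" if "m < d" for m
      unfolding u'_def fun_upd_same ip_scale using ru[OF that] by simp
    have n3: "ip I (u' d) (u m) = 0" if "m < d" for m
      using n2[OF that] by (simp only: ip_commute)
    have n0: "ip I (H j) (u' d) = 0" if "j \<in> J0" for j
      unfolding u'_def fun_upd_same ip_scale using r0[OF that] by simp
    have u'l: "u' l = u l" if "l < d" for l using that by (simp add: u'_def)
    have "ON (Suc d) u'"
      unfolding ON_def
    proof (intro conjI allI impI ballI)
      fix l j assume "l < Suc d" "j \<in> J0"
      then show "ip I (H j) (u' l) = 0"
        by (cases "l = d") (simp_all add: n0 u'l u0)
    next
      fix l m assume "l < Suc d" "m < Suc d"
      then show "ip I (u' l) (u' m) = (if l = m then 1 else 0)"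
        by (cases "l = d"; cases "m = d") (simp_all add: u'l n1 n2 n3 uu)
    qed
    from d(2)[OF this] show False by simp
  qed
  have lev: "\<kappa> \<le> (\<Sum>l<d. (u l i)\<^sup>2)" if i: "i \<in> I'" for i
  proof -
    have iI: "i \<in> I" using i sub by blast
    \<comment> \<open>The projection of the i-th unit vector. Pairing with it reads off coordinate i
      on the kernel, and its square norm is the diagonal entry to be bounded below.\<close>
    define e where "e = (\<lambda>t. \<Sum>l<d. u l i * u l t)"
    have "v i i = (\<Sum>l<d. ip I (v i) (u l) * u l i)" by (rule expand[OF V[OF i] iI])
    also have "\<dots> = ip I (v i) e" unfolding e_def ip_sum by (simp add: mult.commute)
    finally have 1: "v i i = ip I (v i) e" .
    have "ip I e e = (\<Sum>l<d. u l i * ip I e (u l))" by (subst (2) e_def) (rule ip_sum)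
    also have "\<dots> = (\<Sum>l<d. u l i * u l i)"
    proof (intro sum.cong refl)
      fix l assume "l \<in> {..<d}"
      have "ip I e (u l) = (\<Sum>m<d. u m i * ip I (u l) (u m))" unfolding ip_commute[of I e] unfolding e_def by (rule ip_sum)
      also have "\<dots> = (\<Sum>m<d. if m = l then u m i else 0)" by (intro sum.cong refl) (use uu \<open>l \<in> {..<d}\<close> in auto)
      also have "\<dots> = u l i" using \<open>l \<in> {..<d}\<close> by simp
      finally show "u l i * ip I e (u l) = u l i * u l i" by simp
    qed
    finally have 2: "ip I e e = (\<Sum>l<d. (u l i)\<^sup>2)" by (simp add: power2_eq_square)
    have "(v i i)\<^sup>2 \<le> ip I (v i) (v i) * ip I e e"
      unfolding 1 unfolding ip_def using Cauchy_Schwarz_ineq_sum[of "v i" e I] by (simp add: power2_eq_square)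
    then have "\<kappa> * ip I (v i) (v i) \<le> (\<Sum>l<d. (u l i)\<^sup>2) * ip I (v i) (v i)"
      using big(1)[OF i] unfolding 2 by (simp add: mult.commute)
    moreover have "ip I (v i) (v i) > 0"
      using ip_self_eq_0[OF fin(1), of "v i"] iI big(2)[OF i] ip_self_nonneg[of I "v i"] by force
    ultimately show ?thesis using mult_le_cancel_right_pos by blast
  qed
  \<comment> \<open>The diagonal entries over I' sum to at most the full trace, which equals the
    number d of orthonormal vectors.\<close>
  have 1: "(\<Sum>i\<in>I'. \<kappa>) \<le> (\<Sum>i\<in>I'. \<Sum>l<d. (u l i)\<^sup>2)" by (intro sum_mono lev)
  have 2: "(\<Sum>i\<in>I'. \<Sum>l<d. (u l i)\<^sup>2) \<le> (\<Sum>i\<in>I. \<Sum>l<d. (u l i)\<^sup>2)"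
    by (rule sum_mono2[OF fin(1) sub]) (rule sum_nonneg, simp)
  have 3: "(\<Sum>i\<in>I. \<Sum>l<d. (u l i)\<^sup>2) = (\<Sum>l<d. ip I (u l) (u l))"
    unfolding ip_def power2_eq_square by (rule sum.swap)
  have 4: "(\<Sum>l<d. ip I (u l) (u l)) = (\<Sum>l<d. 1)"
    by (rule sum.cong) (simp_all add: uu)
  show ?thesis using 1 2 bound[OF d(1)] unfolding 3 4 by (simp add: mult.commute)
qed

text \<open>An injective linear map on finitely many coordinates is bounded below on the unit sphere
  of the maximum norm, by compactness. The constant depends on the index sets in an uncontrolled
  way.\<close>

lemma bounded_inverse:
  fixes H :: "'j \<Rightarrow> 'i \<Rightarrow> real"
  assumes fin: "finite I" "finite J"
    and inj: "\<And>v. (\<forall>j\<in>J. ip I (H j) v = 0) \<Longrightarrow> \<forall>i\<in>I. v i = 0"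
  shows "\<exists>D>0. \<forall>v. \<forall>i\<in>I. \<bar>v i\<bar> \<le> D * (\<Sum>j\<in>J. \<bar>ip I (H j) v\<bar>)"
proof (cases "I = {}")
  case True then show ?thesis by (auto intro: exI[of _ 1])
next
  case False
  \<comment> \<open>Coordinates outside I also range over [-1, 1], which makes this a compact subset
    of the full function space.\<close>
  let ?K = "PiE UNIV (\<lambda>i::'i. cball 0 1 :: real set)"
  have "compactin (product_topology (\<lambda>i. euclidean) UNIV) ?K" unfolding compactin_PiE by auto
  then have K: "compact ?K" unfolding euclidean_product_topology by simp
  have cc: "continuous_on UNIV (\<lambda>v::'i \<Rightarrow> real. v i)" for i by (rule continuous_on_product_coordinates)
  let ?S = "?K \<inter> (\<Union>i\<in>I. {v. \<bar>v i\<bar> = 1})"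
  have "closed (\<Union>i\<in>I. {v::'i \<Rightarrow> real. \<bar>v i\<bar> = 1})"
    by (intro closed_UN fin closed_Collect_eq continuous_on_const continuous_on_rabs cc ballI)
  then have S: "compact ?S" by (rule compact_Int_closed[OF K])
  let ?N = "\<lambda>v. \<Sum>j\<in>J. \<bar>ip I (H j) v\<bar>"
  have cN: "continuous_on ?S ?N" unfolding ip_def
    by (intro continuous_on_sum continuous_on_rabs continuous_on_mult_left continuous_on_subset[OF cc]) auto
  have "(\<lambda>_. 1) \<in> ?S" using False by auto
  then have "?S \<noteq> {}" by blast
  from continuous_attains_inf[OF S this cN] obtain v0 where v0: "v0 \<in> ?S" "\<And>v. v \<in> ?S \<Longrightarrow> ?N v0 \<le> ?N v" by blast
  have Npos: "?N v0 > 0"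
  proof (rule ccontr)
    assume "\<not> ?N v0 > 0"
    moreover have "?N v0 \<ge> 0" by (rule sum_nonneg) simp
    ultimately have "?N v0 = 0" by linarith
    then have "\<forall>j\<in>J. ip I (H j) v0 = 0" using fin(2) by (simp add: sum_nonneg_eq_0_iff)
    then have "\<forall>i\<in>I. v0 i = 0" by (rule inj)
    then show False using v0(1) by auto
  qed
  have "\<bar>v i\<bar> \<le> 1 / ?N v0 * ?N v" if i: "i \<in> I" for v i
  proof (cases "v i = 0")
    case True then show ?thesis using Npos by (simp add: sum_nonneg)
  next
    case False
    define M where "M = Max ((\<lambda>i. \<bar>v i\<bar>) ` I)"
    have Mge: "\<bar>v t\<bar> \<le> M" if "t \<in> I" for t unfolding M_def using fin that by simp
    have Mpos: "M > 0" using Mge[OF i] False by linarith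
    have "M \<in> (\<lambda>i. \<bar>v i\<bar>) ` I" unfolding M_def using fin i by (intro Max_in) auto
    then obtain t where t: "t \<in> I" "\<bar>v t\<bar> = M" by blast
    define w where "w = (\<lambda>i. if i \<in> I then (1 / M) * v i else 0)"
    have "w \<in> ?S" using Mge Mpos t by (auto simp: w_def abs_mult)
    then have "?N v0 \<le> ?N w" by (rule v0(2))
    also have "ip I (H j) w = (1 / M) * ip I (H j) v" for j
      unfolding ip_scale[symmetric] by (rule ip_cong) (simp add: w_def)
    then have "?N w = (1 / M) * ?N v" using Mpos by (simp add: abs_mult sum_distrib_left)
    finally have "M * ?N v0 \<le> ?N v" using Mpos by (simp add: field_simps)
    then have "M \<le> 1 / ?N v0 * ?N v" using Npos by (simp add: field_simps)
    then show ?thesis using Mge[OF i] by linarith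
  qed
  then show ?thesis using Npos by (intro exI[of _ "1 / ?N v0"]) auto
qed

text \<open>A crude pigeonhole bound is applied to the sets of all sums \<open>\<Sum>l<p. \<lambda>^l z_l\<close>; letting
  \<open>p\<close> tend to infinity removes the dependence on the constant of \<^term>\<open>bounded_inverse\<close>.\<close>

lemma separated_card_le:
  fixes H :: "'j \<Rightarrow> 'i \<Rightarrow> real" and Z :: "('i \<Rightarrow> real) set"
  assumes fin: "finite I" "finite J0" "finite J1" "finite Z"
    and inj: "\<And>v. (\<forall>j\<in>J0 \<union> J1. ip I (H j) v = 0) \<Longrightarrow> \<forall>i\<in>I. v i = 0"
    and Z0: "\<And>z z' j. z \<in> Z \<Longrightarrow> z' \<in> Z \<Longrightarrow> j \<in> J0 \<Longrightarrow> ip I (H j) z = ip I (H j) z'"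
    and Z1: "\<And>z z' i. z \<in> Z \<Longrightarrow> z' \<in> Z \<Longrightarrow> i \<in> I \<Longrightarrow> \<bar>z i - z' i\<bar> \<le> 1"
    and sep: "\<And>z z'. z \<in> Z \<Longrightarrow> z' \<in> Z \<Longrightarrow> z \<noteq> z' \<Longrightarrow> \<exists>i\<in>I. \<eta> \<le> \<bar>z i - z' i\<bar>"
    and eta: "0 < \<eta>" "\<eta> \<le> 1"
  shows "real (card Z) \<le> (4 / \<eta>) ^ card J1"
proof -
  \<comment> \<open>With this ratio all digits after the first differing one contribute at most half
    of its minimal contribution.\<close>
  define q where "q = \<eta> / 4"
  have q: "0 < q" "q \<le> 1/4" "4 * q = \<eta>" using eta by (auto simp: q_def)
  have "\<exists>D>0. \<forall>v. \<forall>i\<in>I. \<bar>v i\<bar> \<le> D * (\<Sum>j\<in>J0 \<union> J1. \<bar>ip I (H j) v\<bar>)"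
    by (rule bounded_inverse[OF fin(1) finite_UnI[OF fin(2,3)] inj])
  then obtain D where D: "D > 0" "\<And>v i. i \<in> I \<Longrightarrow> \<bar>v i\<bar> \<le> D * (\<Sum>j\<in>J0 \<union> J1. \<bar>ip I (H j) v\<bar>)"
    by blast
  define C where "C = (\<Sum>j\<in>J1. \<Sum>z\<in>Z. \<bar>ip I (H j) z\<bar>)"
  have C: "\<bar>ip I (H j) z\<bar> \<le> C" if "j \<in> J1" "z \<in> Z" for j z
  proof -
    have "\<bar>ip I (H j) z\<bar> \<le> (\<Sum>z\<in>Z. \<bar>ip I (H j) z\<bar>)" by (rule member_le_sum) (use that fin in auto)
    also have "\<dots> \<le> C" unfolding C_def by (rule member_le_sum[of j J1 "\<lambda>j. \<Sum>z\<in>Z. \<bar>ip I (H j) z\<bar>"]) (use that fin in \<open>auto intro: sum_nonneg\<close>)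
    finally show ?thesis .
  qed
  have C0: "C \<ge> 0" unfolding C_def by (intro sum_nonneg) auto
  define N where "N = real (card (J0 \<union> J1)) + 1"
  have N: "N > 0" by (simp add: N_def)
  \<comment> \<open>Chosen so that the number of grid cells per functional in \<open>J1\<close> is
    at most \<open>A / q ^ p\<close>. All dependence on \<open>D\<close> is contained in A, which
    does not depend on p.\<close>
  define A where "A = 16 * C * D * N / \<eta> + 5"
  have A: "A > 0" using C0 D N eta by (simp add: A_def add_nonneg_pos)
  have geo: "(\<Sum>l<p. q ^ l) \<le> 2" for p
  proof -
    have "(\<Sum>l<p. q ^ l) * (1 - q) = 1 - q ^ p" using one_diff_power_eq[of q p] by (simp add: mult.commute)
    then have "(\<Sum>l<p. q ^ l) * (1 - q) \<le> 1" using q(1) by simp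
    moreover have "(\<Sum>l<p. q ^ l) * (1/2) \<le> (\<Sum>l<p. q ^ l) * (1 - q)" using q by (intro mult_left_mono sum_nonneg) auto
    ultimately show ?thesis by linarith
  qed
  have main: "(real (card Z) * q ^ card J1) ^ p \<le> A ^ card J1" for p
  proof -
    let ?W = "PiE {..<p} (\<lambda>_. Z)"
    define u where "u = (\<lambda>(w :: nat \<Rightarrow> 'i \<Rightarrow> real) i. \<Sum>l<p. q ^ l * w l i)"
    \<comment> \<open>A grid this fine confines two sums in the same cell to a distance below
      \<open>q ^ p * \<eta> / 4\<close> at every coordinate, less than two different digit sequences
      allow.\<close>
    define \<tau> where "\<tau> = q ^ p * \<eta> / (4 * D * N)"
    have tau: "\<tau> > 0" using q eta D N by (simp add: \<tau>_def)
    have ipu: "ip I (H j) (u w) = (\<Sum>l<p. q ^ l * ip I (H j) (w l))" for j w unfolding u_def by (rule ip_sum)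
    define m where "m = \<lceil>2 * C / \<tau>\<rceil> + 1"
    define f where "f = (\<lambda>w. \<lambda>j\<in>J1. \<lfloor>ip I (H j) (u w) / \<tau>\<rfloor>)"
    have fW: "f w \<in> PiE J1 (\<lambda>_. {-m..m})" if w: "w \<in> ?W" for w
    proof -
      have "\<lfloor>ip I (H j) (u w) / \<tau>\<rfloor> \<in> {-m..m}" if j: "j \<in> J1" for j
      proof -
        have "\<bar>ip I (H j) (u w)\<bar> \<le> (\<Sum>l<p. \<bar>q ^ l * ip I (H j) (w l)\<bar>)" unfolding ipu by (rule sum_abs)
        also have "\<dots> \<le> (\<Sum>l<p. q ^ l * C)"
          using w q(1) by (intro sum_mono) (auto simp: abs_mult PiE_def Pi_def intro!: mult_left_mono C j)
        also have "\<dots> \<le> 2 * C" unfolding sum_distrib_right[symmetric] using geo C0 by (intro mult_right_mono)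
        finally have "\<bar>ip I (H j) (u w) / \<tau>\<bar> \<le> 2 * C / \<tau>" using tau by (simp add: abs_divide divide_right_mono)
        then have "ip I (H j) (u w) / \<tau> \<le> 2 * C / \<tau>" "- (2 * C / \<tau>) \<le> ip I (H j) (u w) / \<tau>" by linarith+
        then have "\<lfloor>ip I (H j) (u w) / \<tau>\<rfloor> \<le> m" "- m \<le> \<lfloor>ip I (H j) (u w) / \<tau>\<rfloor>" unfolding m_def by linarith+
        then show ?thesis by simp
      qed
      then show ?thesis by (auto simp: f_def)
    qed
    have "inj_on f ?W"
    proof (rule inj_onI, rule ccontr)
      fix w w' assume w: "w \<in> ?W" "w' \<in> ?W" "f w = f w'" "w \<noteq> w'"
      have wZ: "w l \<in> Z" "w' l \<in> Z" if "l < p" for l using w that by auto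
      have ex: "\<exists>l. l < p \<and> w l \<noteq> w' l"
      proof (rule ccontr)
        assume "\<not> ?thesis"
        then have "w = w'" by (intro PiE_ext[OF w(1,2)]) auto
        then show False using w(4) by simp
      qed
      \<comment> \<open>The first differing digit dominates the geometric tail, leaving a difference
        of at least \<open>q ^ l0 * \<eta> / 2\<close> at some coordinate.\<close>
      define l0 where "l0 = (LEAST l. l < p \<and> w l \<noteq> w' l)"
      have l0: "l0 < p" "w l0 \<noteq> w' l0" using LeastI_ex[OF ex] unfolding l0_def by auto
      have l0_min: "w l = w' l" if "l < l0" for l
        using not_less_Least[of l "\<lambda>l. l < p \<and> w l \<noteq> w' l"] that l0(1) unfolding l0_def[symmetric] by simp
      obtain i where i: "i \<in> I" "\<eta> \<le> \<bar>w l0 i - w' l0 i\<bar>" using sep[OF wZ[OF l0(1)] l0(2)] by blast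
      let ?d = "\<lambda>i. u w i - u w' i"
      have small: "\<bar>ip I (H j) ?d\<bar> \<le> \<tau>" if "j \<in> J0 \<union> J1" for j
      proof (cases "j \<in> J0")
        case True
        have "ip I (H j) (u w) = ip I (H j) (u w')" unfolding ipu
          by (intro sum.cong refl arg_cong2[where f="(*)"] Z0) (use wZ True in auto)
        then show ?thesis using tau by (simp add: ip_diff)
      next
        case False
        then have "\<lfloor>ip I (H j) (u w) / \<tau>\<rfloor> = \<lfloor>ip I (H j) (u w') / \<tau>\<rfloor>"
          using that w(3) by (auto simp: f_def fun_eq_iff restrict_def split: if_splits)
        then have "\<bar>ip I (H j) (u w) / \<tau> - ip I (H j) (u w') / \<tau>\<bar> \<le> 1" by linarith
        then show ?thesis using tau by (simp add: ip_diff abs_divide field_simps flip: diff_divide_distrib)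
      qed
      have "\<bar>?d i\<bar> \<le> D * (\<Sum>j\<in>J0 \<union> J1. \<bar>ip I (H j) ?d\<bar>)" by (rule D(2)[OF i(1)])
      also have "\<dots> \<le> D * (\<Sum>j\<in>J0 \<union> J1. \<tau>)" using D(1) by (intro mult_left_mono sum_mono small) auto
      also have "\<dots> < D * (N * \<tau>)" using D(1) tau by (simp add: N_def)
      also have "\<dots> = q ^ p * \<eta> / 4" using D(1) N by (simp add: \<tau>_def)
      finally have upper: "\<bar>?d i\<bar> < q ^ p * \<eta> / 4" .
      have "?d i = (\<Sum>l<p. q ^ l * (w l i - w' l i))"
        unfolding u_def by (simp add: sum_subtractf algebra_simps)
      also have "\<dots> = (\<Sum>l\<in>{l0..<p}. q ^ l * (w l i - w' l i))"
        by (rule sum.mono_neutral_right) (auto simp: l0_min)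
      also have "\<dots> = q ^ l0 * (w l0 i - w' l0 i) + (\<Sum>l\<in>{Suc l0..<p}. q ^ l * (w l i - w' l i))"
        using l0(1) by (simp add: sum.atLeast_Suc_lessThan)
      finally have de: "?d i = q ^ l0 * (w l0 i - w' l0 i) + (\<Sum>l\<in>{Suc l0..<p}. q ^ l * (w l i - w' l i))" .
      have "\<bar>\<Sum>l\<in>{Suc l0..<p}. q ^ l * (w l i - w' l i)\<bar> \<le> (\<Sum>l\<in>{Suc l0..<p}. \<bar>q ^ l * (w l i - w' l i)\<bar>)" by (rule sum_abs)
      also have "\<dots> \<le> (\<Sum>l\<in>{Suc l0..<p}. q ^ l * 1)"
        using q(1) by (intro sum_mono) (auto simp: abs_mult intro!: mult_left_mono Z1 wZ i(1))
      also have "\<dots> = (\<Sum>l<p - Suc l0. q ^ (l + Suc l0))"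
        unfolding mult_1_right by (rule sum.reindex_bij_witness[of _ "\<lambda>l. l + Suc l0" "\<lambda>l. l - Suc l0"]) auto
      also have "\<dots> = q ^ Suc l0 * (\<Sum>l<p - Suc l0. q ^ l)" by (simp add: power_add sum_distrib_left sum_distrib_right algebra_simps)
      also have "\<dots> \<le> q ^ Suc l0 * 2" using q(1) by (intro mult_left_mono geo) auto
      also have "\<dots> = q ^ l0 * (\<eta> / 2)" using q(3) by simp
      finally have tail: "\<bar>\<Sum>l\<in>{Suc l0..<p}. q ^ l * (w l i - w' l i)\<bar> \<le> q ^ l0 * (\<eta> / 2)" .
      have "q ^ l0 * \<eta> \<le> \<bar>q ^ l0 * (w l0 i - w' l0 i)\<bar>" using i(2) q(1) by (simp add: abs_mult)
      then have "q ^ l0 * \<eta> - q ^ l0 * (\<eta> / 2) \<le> \<bar>?d i\<bar>" unfolding de using tail by linarith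
      moreover have "q ^ p * \<eta> \<le> q ^ l0 * \<eta>" using q eta l0(1) by (intro mult_right_mono power_decreasing) auto
      moreover have "q ^ l0 * \<eta> > 0" using q eta by simp
      ultimately show False using upper by (simp add: field_simps)
    qed
    then have "card ?W \<le> card (PiE J1 (\<lambda>_. {-m..m}))"
      by (rule card_inj_on_le) (use fW fin in \<open>auto intro!: finite_PiE\<close>)
    then have 1: "real (card Z ^ p) \<le> real (nat (2 * m + 1) ^ card J1)"
      using fin by (simp add: card_PiE del: of_nat_power) 
    have ct: "0 \<le> 2 * C / \<tau>" using C0 tau by simp
    then have m1: "m \<ge> 1" unfolding m_def by linarith
    have "real (nat (2 * m + 1)) = 2 * real_of_int m + 1" using m1 by simp
    also have "\<dots> \<le> 2 * (2 * C / \<tau> + 2) + 1"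
    proof -
      have "real_of_int (\<lceil>X\<rceil> + 1) \<le> X + 2" for X :: real
        using ceiling_correct[of X] by linarith
      then show ?thesis unfolding m_def by (intro add_mono mult_left_mono) auto
    qed
    also have "\<dots> = 4 * C / \<tau> + 5" by simp
    also have "4 * C / \<tau> = (A - 5) / q ^ p" using q eta D N by (simp add: \<tau>_def A_def field_simps)
    also have "(A - 5) / q ^ p + 5 \<le> A / q ^ p"
    proof -
      have "q ^ p \<le> 1" using q by (intro power_le_one) auto
      then show ?thesis using q(1) by (simp add: field_simps)
    qed
    finally have "real (nat (2 * m + 1)) ^ card J1 \<le> (A / q ^ p) ^ card J1" by (intro power_mono) auto
    then have "real (card Z) ^ p \<le> A ^ card J1 / (q ^ p) ^ card J1" using 1 by (simp add: power_divide)
    then have "real (card Z) ^ p * (q ^ p) ^ card J1 \<le> A ^ card J1" using q(1) by (simp add: field_simps)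
    then show ?thesis by (simp add: power_mult_distrib mult.commute flip: power_mult)
  qed
  \<comment> \<open>A base whose powers are all bounded by the same number cannot exceed 1; here the
    uncontrolled constant disappears.\<close>
  have "real (card Z) * q ^ card J1 \<le> 1"
  proof (rule ccontr)
    assume "\<not> real (card Z) * q ^ card J1 \<le> 1"
    then obtain p where "A ^ card J1 < (real (card Z) * q ^ card J1) ^ p"
      using real_arch_pow[of "real (card Z) * q ^ card J1" "A ^ card J1"] by auto
    then show False using main[of p] by simp
  qed
  then show ?thesis using q(1) eta by (simp add: q_def power_divide field_simps)
qed

section \<open>Expansiveness\<close>

text \<open>Compares chord and phase, so that small values of \<open>Psi\<close> give small lifts.
  The constant 1 is not sharp but suffices.\<close>

lemma abs_le_norm_cis_diff:
  assumes "\<bar>t\<bar> \<le> 1/2"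
  shows "\<bar>t\<bar> \<le> cmod (cis (2 * pi * t) - 1)"
proof -
  have pos: "u \<le> 2 * sin (pi * u)" if u: "0 \<le> u" "u \<le> 1/2" for u :: real
  \<comment> \<open>Up to 1/3 the mean value theorem applies with a cosine of at least 1/2; beyond
    it the sine itself is at least 1/2.\<close>
  proof (cases "u \<le> 1/3")
    case True
    show ?thesis
    proof (cases "u = 0")
      case False
      have "\<exists>z. 0 < z \<and> z < pi * u \<and> sin (pi * u) - sin 0 = (pi * u - 0) * cos z"
        using False u by (intro MVT2) (auto intro!: derivative_eq_intros)
      then obtain z where z: "0 < z" "z < pi * u" "sin (pi * u) = (pi * u) * cos z" by auto
      have "pi * u \<le> pi / 3" using True by simp
      then have "z \<le> pi / 3" using z by linarith
      then have "cos (pi / 3) \<le> cos z" using z by (intro cos_monotone_0_pi_le) auto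
      then have "1/2 \<le> cos z" by (simp add: cos_60)
      then have "(pi * u) * (1/2) \<le> sin (pi * u)" unfolding z(3) using u by (intro mult_left_mono) auto
      moreover have "1 * u \<le> pi * u" using u pi_ge_two by (intro mult_right_mono) auto
      ultimately show ?thesis by simp
    qed simp
  next
    case False
    have "sin (pi / 6) \<le> sin (pi * u)"
      using False u pi_gt_zero by (intro sin_monotone_2pi_le) (auto simp: field_simps)
    then show ?thesis using u by (simp add: sin_30)
  qed
  have "cmod (cis (2 * pi * t) - 1) = 2 * \<bar>sin (pi * t)\<bar>"
    using dist_exp_i_1[of "2 * pi * t"] by (simp add: cis_conv_exp)
  moreover have "\<bar>t\<bar> \<le> 2 * \<bar>sin (pi * t)\<bar>"
  proof (cases "t \<ge> 0")
    case True then show ?thesis using pos[of t] assms by linarith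
  next
    case False
    then have "- t \<le> 2 * sin (pi * (- t))" using assms by (intro pos) auto
    then show ?thesis using False by (simp add: abs_le_iff)
  qed
  ultimately show ?thesis by simp
qed

lemma norm_cis_diff_le: "cmod (cis x - cis y) \<le> \<bar>x - y\<bar>"
proof -
  have "cis x - cis y = cis y * (cis (x - y) - 1)" by (simp add: right_diff_distrib cis_mult)
  then have "cmod (cis x - cis y) = cmod (cis (x - y) - 1)" by (simp add: norm_mult)
  also have "\<dots> = 2 * \<bar>sin ((x - y) / 2)\<bar>" using dist_exp_i_1[of "x - y"] by (simp add: cis_conv_exp)
  also have "\<dots> \<le> 2 * \<bar>(x - y) / 2\<bar>" using abs_sin_x_le_abs_x[of "(x - y) / 2"] by simp
  finally show ?thesis by simp
qed

lemma circle_lift: "cmod z = 1 \<Longrightarrow> \<exists>t. \<bar>t\<bar> \<le> 1/2 \<and> z = cis (2 * pi * t)"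
proof -
  assume z: "cmod z = 1"
  then have "z \<noteq> 0" by force
  then have "cis (Arg z) = sgn z" "- pi < Arg z" "Arg z \<le> pi" using Arg_correct[of z] by auto
  moreover have "sgn z = z" using z by (simp add: sgn_eq)
  ultimately show ?thesis
    by (intro exI[of _ "Arg z / (2 * pi)"]) (auto simp: abs_le_iff field_simps)
qed

section \<open>Interior and boundary of finite sets\<close>

definition msum :: "'g::group_add set \<Rightarrow> 'g set \<Rightarrow> 'g set" where
  "msum K F = {s + t |s t. s \<in> K \<and> t \<in> F}"

lemma finite_msum: "finite K \<Longrightarrow> finite F \<Longrightarrow> finite (msum K F)"
proof -
  assume "finite K" "finite F"
  moreover have "msum K F = (\<lambda>(s, t). s + t) ` (K \<times> F)" by (auto simp: msum_def)
  ultimately show ?thesis by simp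
qed

lemma Folner_small:
  assumes "left_Folner_seq F" "finite K" "e > 0"
  shows "\<forall>\<^sub>F m in sequentially. real (card (msum K (F m) - F m)) \<le> e * real (card (F m))"
proof -
  have "(\<lambda>n. real (card (msum K (F n) - F n)) / real (card (F n))) \<longlonglongrightarrow> 0"
    using assms(1,2) by (simp add: left_Folner_seq_def msum_def)
  then have "\<forall>\<^sub>F m in sequentially. real (card (msum K (F m) - F m)) / real (card (F m)) < e"
    using assms(3) by (rule order_tendstoD(2))
  then show ?thesis
  proof (rule eventually_mono)
    fix m assume m: "real (card (msum K (F m) - F m)) / real (card (F m)) < e"
    have "card (F m) > 0" using assms(1) by (simp add: left_Folner_seq_def card_gt_0_iff)
    then show "real (card (msum K (F m) - F m)) \<le> e * real (card (F m))" using m by (simp add: field_simps)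
  qed
qed

text \<open>The element 0 is included so that interior positions of a set lie in the set.\<close>

definition rel_supp :: "('g::group_add \<Rightarrow>\<^sub>0 int) mat \<Rightarrow> 'g set" where
  "rel_supp A = insert 0 (\<Union>i<dim_row A. \<Union>j<dim_col A. keys (A $$ (i, j)))"

lemma finite_rel_supp: "finite (rel_supp A)" by (simp add: rel_supp_def)

text \<open>Positions s index relations, and the relation at s involves the points
  \<open>- t + s\<close>. Boundary positions are those whose points meet G without all lying in G;
  for interior ones all of them lie in G.\<close>

definition bdry :: "('g::group_add \<Rightarrow>\<^sub>0 int) mat \<Rightarrow> 'g set \<Rightarrow> 'g set" where
  "bdry A G = {s \<in> msum (rel_supp A) G. \<exists>t\<in>rel_supp A. - t + s \<notin> G}"

definition intr :: "('g::group_add \<Rightarrow>\<^sub>0 int) mat \<Rightarrow> 'g set \<Rightarrow> 'g set" where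
  "intr A G = {s \<in> msum (rel_supp A) G. \<forall>t\<in>rel_supp A. - t + s \<in> G}"

lemma finite_bdry: "finite G \<Longrightarrow> finite (bdry A G)"
  using finite_msum[OF finite_rel_supp[of A]] unfolding bdry_def by simp

lemma finite_intr: "finite G \<Longrightarrow> finite (intr A G)"
  using finite_msum[OF finite_rel_supp[of A]] unfolding intr_def by simp

lemma intr_subset: "intr A G \<subseteq> G"
proof
  fix s assume "s \<in> intr A G"
  then have "- 0 + s \<in> G" unfolding intr_def rel_supp_def by blast
  then show "s \<in> G" by simp
qed

definition bdry_kernel :: "('g::group_add \<Rightarrow>\<^sub>0 int) mat \<Rightarrow> 'g set \<Rightarrow> 'g set" where
  "bdry_kernel A E = (\<lambda>(t', t, e). - t' + t + e) ` (rel_supp A \<times> rel_supp A \<times> E)"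

lemma finite_bdry_kernel: "finite E \<Longrightarrow> finite (bdry_kernel A E)"
  by (simp add: bdry_kernel_def finite_rel_supp)

text \<open>A boundary position s of the thickened set has a point \<open>- t' + s\<close> outside
  it, hence outside F because 0 lies in E. This point belongs to
  \<open>msum (bdry_kernel A E) F\<close>, and s is recovered from it and t'.\<close>

lemma card_bdry:
  assumes "finite E" "finite F" "0 \<in> E"
  shows "card (bdry A (msum E F)) \<le> card (rel_supp A) * card (msum (bdry_kernel A E) F - F)"
proof -
  let ?D = "msum (bdry_kernel A E) F - F"
  have finD: "finite ?D" using finite_msum[OF finite_bdry_kernel assms(2)] assms(1) by blast
  have FE: "f \<in> msum E F" if "f \<in> F" for f
  proof -
    have "0 + f \<in> msum E F" unfolding msum_def using assms(3) that by blast
    then show ?thesis by simp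
  qed
  have "bdry A (msum E F) \<subseteq> (\<Union>t\<in>rel_supp A. (\<lambda>v. t + v) ` ?D)"
  proof
    fix s assume "s \<in> bdry A (msum E F)"
    then obtain t e f t' where s: "t \<in> rel_supp A" "e \<in> E" "f \<in> F" "s = t + (e + f)"
      "t' \<in> rel_supp A" "- t' + s \<notin> msum E F" unfolding bdry_def msum_def by blast
    have "- t' + t + e \<in> bdry_kernel A E" unfolding bdry_kernel_def using s by force
    moreover have "- t' + s = (- t' + t + e) + f" by (simp add: s(4) add.assoc)
    ultimately have "- t' + s \<in> msum (bdry_kernel A E) F" unfolding msum_def using s(3) by blast
    moreover have "- t' + s \<notin> F" using FE s(6) by blast
    moreover have "s = t' + (- t' + s)" by simp
    ultimately show "s \<in> (\<Union>t\<in>rel_supp A. (\<lambda>v. t + v) ` ?D)" using s(5) by blast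
  qed
  then have "card (bdry A (msum E F)) \<le> card (\<Union>t\<in>rel_supp A. (\<lambda>v. t + v) ` ?D)"
    by (rule card_mono[rotated]) (use finD finite_rel_supp in blast)
  also have "\<dots> \<le> (\<Sum>t\<in>rel_supp A. card ((\<lambda>v. t + v) ` ?D))"
    by (rule card_UN_le[OF finite_rel_supp])
  also have "\<dots> \<le> (\<Sum>t\<in>rel_supp A. card ?D)"
    by (rule sum_mono) (rule card_image_le[OF finD])
  finally show ?thesis by simp
qed

text \<open>The matrix of \<open>rel_form\<close>: the coefficient index t with
  \<open>- t + s = u\<close> is \<open>s - u\<close>.\<close>

definition rel_coeff :: "('g::group_add \<Rightarrow>\<^sub>0 int) mat \<Rightarrow> nat \<times> 'g \<Rightarrow> nat \<times> 'g \<Rightarrow> real" where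
  "rel_coeff A = (\<lambda>(i, s) (j, u). of_int (lookup (A $$ (i, j)) (s - u)))"

lemma ip_rel_coeff:
  assumes G: "finite G"
  shows "ip ({..<dim_col A} \<times> G) (rel_coeff A (i, s)) v = rel_form A (\<lambda>j u. if u \<in> G then v (j, u) else 0) i s"
proof -
  have "ip ({..<dim_col A} \<times> G) (rel_coeff A (i, s)) v = (\<Sum>j<dim_col A. \<Sum>u\<in>G. of_int (lookup (A $$ (i, j)) (s - u)) * v (j, u))"
    unfolding ip_def by (simp add: sum.cartesian_product rel_coeff_def case_prod_beta)
  also have "\<dots> = rel_form A (\<lambda>j u. if u \<in> G then v (j, u) else 0) i s"
    unfolding rel_form_def
  proof (rule sum.cong[OF refl])
    fix j
    let ?f = "A $$ (i, j)"
    have "(\<Sum>u\<in>G. of_int (lookup ?f (s - u)) * v (j, u))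
      = (\<Sum>u\<in>{u \<in> G. s - u \<in> keys ?f}. of_int (lookup ?f (s - u)) * v (j, u))"
      by (rule sum.mono_neutral_right) (use G in \<open>auto simp: in_keys_iff\<close>)
    also have "\<dots> = (\<Sum>t\<in>{t \<in> keys ?f. - t + s \<in> G}. of_int (lookup ?f t) * v (j, - t + s))"
      by (rule sum.reindex_bij_witness[of _ "\<lambda>t. - t + s" "\<lambda>u. s - u"]) (auto simp: minus_diff_eq diff_add_eq_diff_diff_swap)
    also have "\<dots> = (\<Sum>t\<in>{t \<in> keys ?f. - t + s \<in> G}. of_int (lookup ?f t) * (if - t + s \<in> G then v (j, - t + s) else 0))"
      by (rule sum.cong) auto
    also have "\<dots> = (\<Sum>t\<in>keys ?f. of_int (lookup ?f t) * (if - t + s \<in> G then v (j, - t + s) else 0))"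
      by (rule sum.mono_neutral_left) auto
    finally show "(\<Sum>u\<in>G. of_int (lookup ?f (s - u)) * v (j, u))
      = (\<Sum>t\<in>keys ?f. of_int (lookup ?f t) * (if - t + s \<in> G then v (j, - t + s) else 0))" .
  qed
  finally show ?thesis .
qed

lemma ip_rel_coeff_intr:
  assumes G: "finite G" and i: "i < dim_row A" and s: "s \<in> intr A G"
  shows "ip ({..<dim_col A} \<times> G) (rel_coeff A (i, s)) v = rel_form A (\<lambda>j u. v (j, u)) i s"
  unfolding ip_rel_coeff[OF G]
proof (rule rel_form_cong)
  fix j t assume "j < dim_col A" "t \<in> keys (A $$ (i, j))"
  then have "t \<in> rel_supp A" using i unfolding rel_supp_def by blast
  then have "- t + s \<in> G" using s unfolding intr_def by blast
  then show "(if - t + s \<in> G then v (j, - t + s) else 0) = v (j, - t + s)" by simp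
qed

text \<open>A vector on G extends by zero to a finitely supported family. Relations at positions
  neither interior nor boundary do not meet G and hold automatically.\<close>

lemma rel_coeff_injective:
  assumes inj: "rel_injective A" and G: "finite G"
    and v: "\<forall>p\<in>{..<dim_row A} \<times> intr A G \<union> {..<dim_row A} \<times> bdry A G. ip ({..<dim_col A} \<times> G) (rel_coeff A p) v = 0"
  shows "\<forall>q\<in>{..<dim_col A} \<times> G. v q = 0"
proof -
  define y where "y = (\<lambda>j u. if u \<in> G then v (j, u) else 0)"
  have "{u. y j u \<noteq> 0} \<subseteq> G" for j unfolding y_def by auto
  then have fs: "fin_supp (dim_col A) y" unfolding fin_supp_def using finite_subset G by blast
  have rel: "rel_form A y i s = 0" if i: "i < dim_row A" for i s
  proof (cases "s \<in> msum (rel_supp A) G")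
    case True
    then have "s \<in> intr A G \<or> s \<in> bdry A G" unfolding intr_def bdry_def by blast
    then have "ip ({..<dim_col A} \<times> G) (rel_coeff A (i, s)) v = 0" using v i by blast
    then show ?thesis unfolding ip_rel_coeff[OF G] y_def .
  next
    case False
    have "rel_form A y i s = rel_form A (\<lambda>_ _. 0) i s"
    proof (rule rel_form_cong)
      fix j t assume "j < dim_col A" "t \<in> keys (A $$ (i, j))"
      then have t: "t \<in> rel_supp A" using i unfolding rel_supp_def by blast
      have "- t + s \<notin> G"
      proof
        assume "- t + s \<in> G"
        then have "t + (- t + s) \<in> msum (rel_supp A) G" unfolding msum_def using t by blast
        then show False using False by simp
      qed
      then show "y j (- t + s) = 0" by (simp add: y_def)
    qed
    then show ?thesis by (simp add: rel_form_def)
  qed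
  have "\<forall>j<dim_col A. \<forall>s. y j s = 0" using inj fs rel unfolding rel_injective_def by blast
  then have "y (fst q) (snd q) = 0" if "q \<in> {..<dim_col A} \<times> G" for q using that by auto
  then show ?thesis unfolding y_def by auto
qed

section \<open>The norms for p = 1 and p = 2\<close>

lemma lp_norm_1:
  "lp_norm 1 f = (if (\<lambda>s. cmod (f s)) summable_on UNIV then ennreal (\<Sum>\<^sub>\<infinity>s. cmod (f s)) else \<infinity>)"
proof -
  have "(\<Sum>\<^sub>\<infinity>s. cmod (f s)) \<ge> 0" by (rule infsum_nonneg) simp
  then show ?thesis by (simp add: lp_norm_def powr_one)
qed

lemma lp_norm_2:
  "lp_norm 2 f = (if (\<lambda>s. (cmod (f s))\<^sup>2) summable_on UNIV then ennreal (sqrt (\<Sum>\<^sub>\<infinity>s. (cmod (f s))\<^sup>2)) else \<infinity>)"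
proof -
  have "(\<Sum>\<^sub>\<infinity>s. (cmod (f s))\<^sup>2) \<ge> 0" by (rule infsum_nonneg) simp
  then have "(\<Sum>\<^sub>\<infinity>s. (cmod (f s))\<^sup>2) powr (1 / 2) = sqrt (\<Sum>\<^sub>\<infinity>s. (cmod (f s))\<^sup>2)" by (rule powr_half_sqrt)
  moreover have "cmod (f s) powr 2 = (cmod (f s))\<^sup>2" for s by (simp add: powr_numeral)
  ultimately show ?thesis by (simp add: lp_norm_def)
qed

lemma single_le_infsum:
  fixes f :: "'g \<Rightarrow> real"
  assumes "f summable_on UNIV" "\<And>s. f s \<ge> 0"
  shows "f s \<le> infsum f UNIV"
  using finite_sum_le_infsum[OF assms(1), of "{s}"] assms(2) by simp

lemma lp_norm_2_le_1: "lp_norm 2 f \<le> lp_norm 1 f"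
proof (cases "(\<lambda>s. cmod (f s)) summable_on UNIV")
  case False then show ?thesis by (simp add: lp_norm_1)
next
  case True
  define L where "L = (\<Sum>\<^sub>\<infinity>s. cmod (f s))"
  have le: "cmod (f s) \<le> L" for s unfolding L_def by (rule single_le_infsum[OF True]) simp
  have L0: "L \<ge> 0" using le[of undefined] norm_ge_zero[of "f undefined"] by linarith
  have sq: "(cmod (f s))\<^sup>2 \<le> L * cmod (f s)" for s
    unfolding power2_eq_square by (rule mult_right_mono[OF le]) simp
  have sumL: "(\<lambda>s. L * cmod (f s)) summable_on UNIV" by (rule summable_on_cmult_right[OF True])
  have sum2: "(\<lambda>s. (cmod (f s))\<^sup>2) summable_on UNIV"
    by (rule summable_on_comparison_test[OF sumL]) (auto simp: sq)
  have "(\<Sum>\<^sub>\<infinity>s. (cmod (f s))\<^sup>2) \<le> (\<Sum>\<^sub>\<infinity>s. L * cmod (f s))"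
    by (rule infsum_mono[OF sum2 sumL]) (rule sq)
  also have "\<dots> = L\<^sup>2" unfolding infsum_cmult_right'[of L] L_def[symmetric] power2_eq_square ..
  finally have "sqrt (\<Sum>\<^sub>\<infinity>s. (cmod (f s))\<^sup>2) \<le> L" using L0 by (rule real_le_lsqrt[rotated])
  then show ?thesis using True sum2 by (simp add: lp_norm_1 lp_norm_2 L_def[symmetric] ennreal_leI)
qed

lemma lp_norm_2_less:
  assumes "lp_norm 2 f < ennreal e"
  shows "(\<lambda>s. (cmod (f s))\<^sup>2) summable_on UNIV" "cmod (f s) < e"
proof -
  show sum: "(\<lambda>s. (cmod (f s))\<^sup>2) summable_on UNIV"
    using assms by (auto simp: lp_norm_2 split: if_splits)
  have "sqrt (\<Sum>\<^sub>\<infinity>s. (cmod (f s))\<^sup>2) < e"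
    using assms sum by (simp add: lp_norm_2 ennreal_less_iff infsum_nonneg)
  moreover have "cmod (f s) \<le> sqrt (\<Sum>\<^sub>\<infinity>s. (cmod (f s))\<^sup>2)"
    using single_le_infsum[OF sum, of s] by (intro real_le_rsqrt) auto
  ultimately show "cmod (f s) < e" by linarith
qed

section \<open>Expansiveness and injectivity\<close>

context presented_action
begin

lemma phi_zero: "j < k \<Longrightarrow> \<phi> j 0 = 1"
  using dual_zero[OF phi_dual] by blast

lemma Psi_zero: "\<kappa> \<in> pontryagin_dual \<Longrightarrow> Psi act 0 \<kappa> = (\<lambda>s. 0)"
  using dual_zero[of \<kappa>] by (simp add: Psi_def fun_eq_iff)

lemma lp_norm_Psi_zero:
  assumes "W \<subseteq> pontryagin_dual"
  shows "(\<Sum>\<kappa>\<in>W. lp_norm 1 (Psi act 0 \<kappa>)) = 0" "(\<Sum>\<kappa>\<in>W. lp_norm 2 (Psi act 0 \<kappa>)) = 0"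
proof -
  have "lp_norm 1 (Psi act 0 \<kappa>) = 0" "lp_norm 2 (Psi act 0 \<kappa>) = 0" if "\<kappa> \<in> W" for \<kappa>
  proof -
    have "Psi act 0 \<kappa> = (\<lambda>s. 0)" using assms that Psi_zero by blast
    then show "lp_norm 1 (Psi act 0 \<kappa>) = 0" "lp_norm 2 (Psi act 0 \<kappa>) = 0"
      by (simp_all add: lp_norm_1 lp_norm_2)
  qed
  then show "(\<Sum>\<kappa>\<in>W. lp_norm 1 (Psi act 0 \<kappa>)) = 0" "(\<Sum>\<kappa>\<in>W. lp_norm 2 (Psi act 0 \<kappa>)) = 0" by simp_all
qed

lemma two_expansive_imp_one: "p_expansive act 2 \<Longrightarrow> p_expansive act 1"
proof -
  assume "p_expansive act 2"
  then obtain W and e :: real where W: "W \<subseteq> pontryagin_dual" "finite W" "e > 0"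
    "{x. (\<Sum>\<kappa>\<in>W. lp_norm 2 (Psi act x \<kappa>)) < ennreal e} = {0}" unfolding p_expansive_def by blast
  have le: "(\<Sum>\<kappa>\<in>W. lp_norm 2 (Psi act x \<kappa>)) \<le> (\<Sum>\<kappa>\<in>W. lp_norm 1 (Psi act x \<kappa>))" for x
    by (rule sum_mono) (rule lp_norm_2_le_1)
  have "{x. (\<Sum>\<kappa>\<in>W. lp_norm 1 (Psi act x \<kappa>)) < ennreal e} \<subseteq> {x. (\<Sum>\<kappa>\<in>W. lp_norm 2 (Psi act x \<kappa>)) < ennreal e}"
    using le order_le_less_trans by blast
  moreover have "0 \<in> {x. (\<Sum>\<kappa>\<in>W. lp_norm 1 (Psi act x \<kappa>)) < ennreal e}"
    using lp_norm_Psi_zero(1)[OF W(1)] W(3) by simp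
  ultimately have "{x. (\<Sum>\<kappa>\<in>W. lp_norm 1 (Psi act x \<kappa>)) < ennreal e} = {0}" unfolding W(4) by blast
  then show ?thesis unfolding p_expansive_def using W(1,2,3) by blast
qed

lemma lift_exists:
  "\<exists>y. \<forall>j<k. \<forall>s. \<bar>y j s\<bar> \<le> 1/2 \<and> \<phi> j (act s x) = cis (2 * pi * y j s) \<and> \<bar>y j s\<bar> \<le> cmod (\<phi> j (act s x) - 1)"
proof -
  have "\<exists>t. j < k \<longrightarrow> \<bar>t\<bar> \<le> 1/2 \<and> \<phi> j (act s x) = cis (2 * pi * t)" for j s
    using circle_lift phi_norm by blast
  then have "\<forall>j. \<exists>f. \<forall>s. j < k \<longrightarrow> \<bar>f s\<bar> \<le> 1/2 \<and> \<phi> j (act s x) = cis (2 * pi * f s)"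
    by (intro allI choice) blast
  then obtain y where y: "\<forall>j. \<forall>s. j < k \<longrightarrow> \<bar>y j s\<bar> \<le> 1/2 \<and> \<phi> j (act s x) = cis (2 * pi * y j s)"
    by (rule choice[THEN exE])
  then show ?thesis using abs_le_norm_cis_diff by (intro exI[of _ y]) simp
qed

text \<open>The leverage bound replaces the von Neumann dimension: restrictions to \<open>F\<close> of translates of an
  \<open>\<ell>\<^sup>2\<close>-solution span a space of dimension at least proportional to \<open>card F\<close>, whereas injectivity on
  finitely supported vectors bounds that dimension by the size of the boundary of \<open>F\<close>.\<close>

lemma square_summable_solution_zero:
  assumes inj: "rel_injective A" and Fol: "left_Folner_seq (F :: nat \<Rightarrow> 'g set)"
    and sq: "\<And>j. j < k \<Longrightarrow> (\<lambda>s. (y j s)\<^sup>2) summable_on UNIV"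
    and rel: "\<And>i s. i < n \<Longrightarrow> rel_form A y i s = 0"
    and j0: "j0 < k"
  shows "y j0 s0 = 0"
proof (rule ccontr)
  assume ne: "y j0 s0 \<noteq> 0"
  define Q where "Q = (\<Sum>j<k. \<Sum>\<^sub>\<infinity>s. (y j s)\<^sup>2)"
  have Qj: "(\<Sum>\<^sub>\<infinity>s. (y j s)\<^sup>2) \<ge> 0" for j by (rule infsum_nonneg) simp
  have "(y j0 s0)\<^sup>2 \<le> (\<Sum>\<^sub>\<infinity>s. (y j0 s)\<^sup>2)" by (rule single_le_infsum[OF sq[OF j0]]) simp
  also have "\<dots> \<le> Q" unfolding Q_def
    by (rule member_le_sum[of j0 "{..<k}" "\<lambda>j. \<Sum>\<^sub>\<infinity>s. (y j s)\<^sup>2"]) (use j0 Qj in auto)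
  finally have yQ: "(y j0 s0)\<^sup>2 \<le> Q" .
  have ypos: "(y j0 s0)\<^sup>2 > 0" using ne by simp
  then have Qpos: "Q > 0" using yQ by linarith
  \<comment> \<open>The share of the total square norm carried by the nonzero value, used as the
    lower bound for all diagonal entries.\<close>
  define \<delta> where "\<delta> = (y j0 s0)\<^sup>2 / Q"
  have dpos: "\<delta> > 0" using ypos Qpos by (simp add: \<delta>_def)
  have key: "\<delta> * real (card (F m)) \<le> real (n * (card (rel_supp A) * card (msum (bdry_kernel A {0}) (F m) - F m)))" for m
  proof -
    let ?G = "F m"
    have G: "finite ?G" using Fol by (simp add: left_Folner_seq_def)
    let ?I = "{..<k} \<times> ?G"
    have bd: "\<delta> * real (card ({j0} \<times> ?G)) \<le> real (card ({..<n} \<times> bdry A ?G))"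
    \<comment> \<open>For each point of the Folner set the solution is translated so that its value
      at \<open>s0\<close> sits at that point. Translates satisfy all interior relations, and their
      restrictions have square norm at most \<open>Q\<close>.\<close>
    proof (rule leverage_bound[where I="?I" and ?J1.0="{..<n} \<times> bdry A ?G" and ?J0.0="{..<n} \<times> intr A ?G" and H="rel_coeff A"
          and I'="{j0} \<times> ?G" and v="\<lambda>q. \<lambda>(j, u). y j (u + (- snd q + s0))"])
      show "finite ?I" using G by simp
      show "finite ({..<n} \<times> bdry A ?G)" using finite_bdry[OF G] by simp
      show "\<forall>i\<in>?I. v i = 0" if "\<forall>p\<in>{..<n} \<times> intr A ?G \<union> {..<n} \<times> bdry A ?G. ip ?I (rel_coeff A p) v = 0" for v
        by (rule rel_coeff_injective[OF inj G that])
      show "{j0} \<times> ?G \<subseteq> ?I" using j0 by auto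
      show "ip ?I (rel_coeff A p) (case_prod (\<lambda>j u. y j (u + (- snd q + s0)))) = 0"
        if "q \<in> {j0} \<times> ?G" and p_in: "p \<in> {..<n} \<times> intr A ?G" for p q
      proof -
        obtain i s where p: "p = (i, s)" "i < n" "s \<in> intr A ?G" using p_in by auto
        show ?thesis unfolding p(1) ip_rel_coeff_intr[OF G p(2,3)]
          using rel_form_shift[of A y "- snd q + s0" i s] rel[OF p(2)] by simp
      qed
      show "\<delta> * ip ?I (case_prod (\<lambda>j u. y j (u + (- snd q + s0)))) (case_prod (\<lambda>j u. y j (u + (- snd q + s0))))
          \<le> (case q of (j, u) \<Rightarrow> y j (u + (- snd q + s0)))\<^sup>2" if q: "q \<in> {j0} \<times> ?G" for q
      proof -
        have "(\<Sum>u\<in>?G. (y j (u + (- snd q + s0)))\<^sup>2) \<le> (\<Sum>\<^sub>\<infinity>s. (y j s)\<^sup>2)" if j: "j < k" for j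
        proof -
          have "(\<Sum>u\<in>?G. (y j (u + (- snd q + s0)))\<^sup>2) = (\<Sum>s\<in>(\<lambda>u. u + (- snd q + s0)) ` ?G. (y j s)\<^sup>2)"
            by (subst sum.reindex) (auto simp: inj_on_def)
          also have "\<dots> \<le> (\<Sum>\<^sub>\<infinity>s. (y j s)\<^sup>2)" by (rule finite_sum_le_infsum[OF sq[OF j]]) (use G in auto)
          finally show ?thesis .
        qed
        then have "(\<Sum>j<k. \<Sum>u\<in>?G. (y j (u + (- snd q + s0)))\<^sup>2) \<le> Q" unfolding Q_def by (intro sum_mono) auto
        then have "ip ?I (case_prod (\<lambda>j u. y j (u + (- snd q + s0)))) (case_prod (\<lambda>j u. y j (u + (- snd q + s0)))) \<le> Q"
          unfolding ip_def by (simp add: sum.cartesian_product power2_eq_square case_prod_beta)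
        then have "\<delta> * ip ?I (case_prod (\<lambda>j u. y j (u + (- snd q + s0)))) (case_prod (\<lambda>j u. y j (u + (- snd q + s0)))) \<le> \<delta> * Q"
          using dpos by (intro mult_left_mono) auto
        also have "\<delta> * Q = (y j0 s0)\<^sup>2" using Qpos by (simp add: \<delta>_def)
        also have "\<dots> = (case q of (j, u) \<Rightarrow> y j (u + (- snd q + s0)))\<^sup>2"
        proof -
          obtain u where "q = (j0, u)" using q by auto
          then show ?thesis by (simp add: add.assoc[symmetric])
        qed
        finally show ?thesis .
      qed
      show "(case q of (j, u) \<Rightarrow> y j (u + (- snd q + s0))) \<noteq> 0" if q: "q \<in> {j0} \<times> ?G" for q
      proof -
        obtain u where "q = (j0, u)" using q by auto
        then show ?thesis using ne by (simp add: add.assoc[symmetric])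
      qed
    qed
    have ms: "msum {0} ?G = ?G" by (simp add: msum_def)
    have "card (bdry A ?G) \<le> card (rel_supp A) * card (msum (bdry_kernel A {0}) ?G - ?G)"
      using card_bdry[of "{0}" ?G A] G unfolding ms by simp
    then have "card ({..<n} \<times> bdry A ?G) \<le> n * (card (rel_supp A) * card (msum (bdry_kernel A {0}) ?G - ?G))"
      by (simp add: card_cartesian_product)
    then have "real (card ({..<n} \<times> bdry A ?G)) \<le> real (n * (card (rel_supp A) * card (msum (bdry_kernel A {0}) ?G - ?G)))"
      by (simp only: of_nat_le_iff)
    then show ?thesis using bd by (simp add: card_cartesian_product)
  qed
  define M where "M = real n * real (card (rel_supp A))"
  have M0: "M \<ge> 0" by (simp add: M_def)
  \<comment> \<open>This tolerance keeps the boundary count below half of what the trace inequality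
    demands; the added 1 guards against M = 0.\<close>
  have "\<delta> / (2 * (M + 1)) > 0" using dpos M0 by simp
  then have "\<forall>\<^sub>F m in sequentially. real (card (msum (bdry_kernel A {0}) (F m) - F m)) \<le> \<delta> / (2 * (M + 1)) * real (card (F m))"
    by (intro Folner_small[OF Fol] finite_bdry_kernel) auto
  then obtain m where m: "real (card (msum (bdry_kernel A {0}) (F m) - F m)) \<le> \<delta> / (2 * (M + 1)) * real (card (F m))"
    using eventually_happens'[OF sequentially_bot] by blast
  have cF: "real (card (F m)) > 0" using Fol by (simp add: left_Folner_seq_def card_gt_0_iff)
  have "\<delta> * real (card (F m)) \<le> M * real (card (msum (bdry_kernel A {0}) (F m) - F m))"
    using key[of m] by (simp add: M_def mult.assoc)
  also have "\<dots> \<le> M * (\<delta> / (2 * (M + 1)) * real (card (F m)))" by (rule mult_left_mono[OF m M0])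
  also have "\<dots> = (M / (2 * (M + 1))) * (\<delta> * real (card (F m)))" by simp
  also have "\<dots> \<le> (1/2) * (\<delta> * real (card (F m)))"
    using M0 dpos cF by (intro mult_right_mono) (auto simp: field_simps)
  finally show False using dpos cF by simp
qed

lemma injective_imp_two_expansive:
  assumes inj: "rel_injective A" and Fol: "left_Folner_seq (F :: nat \<Rightarrow> 'g set)"
  shows "p_expansive act 2"
proof -
  \<comment> \<open>Below this size every relation has modulus less than 1, and being an integer on
    the lift of a point it vanishes.\<close>
  define e where "e = 1 / (2 * rel_bound A)"
  have e: "e > 0" "rel_bound A * e < 1" using rel_bound_ge_1[of A] by (auto simp: e_def)
  define W where "W = \<phi> ` {..<k}"
  have W: "W \<subseteq> pontryagin_dual" "finite W" using phi_dual by (auto simp: W_def)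
  have "x = 0" if x: "(\<Sum>\<kappa>\<in>W. lp_norm 2 (Psi act x \<kappa>)) < ennreal e" for x
  proof -
    have lp: "lp_norm 2 (Psi act x (\<phi> j)) < ennreal e" if "j < k" for j
    proof -
      have "lp_norm 2 (Psi act x (\<phi> j)) \<le> (\<Sum>\<kappa>\<in>W. lp_norm 2 (Psi act x \<kappa>))"
        by (rule member_le_sum) (use that W(2) in \<open>auto simp: W_def\<close>)
      then show ?thesis using x by (rule order_le_less_trans)
    qed
    obtain y where y: "\<And>j s. j < k \<Longrightarrow> \<phi> j (act s x) = cis (2 * pi * y j s)" "\<And>j s. j < k \<Longrightarrow> \<bar>y j s\<bar> \<le> cmod (Psi act x (\<phi> j) s)"
      using lift_exists[of x] unfolding Psi_def by blast
    have small: "\<bar>y j s\<bar> \<le> e" if "j < k" for j s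
      using y(2)[OF that, of s] lp_norm_2_less(2)[OF lp[OF that], of s] by linarith
    have rel: "rel_form A y i s = 0" if i: "i < n" for i s
    proof -
      have "\<bar>rel_form A y i s\<bar> \<le> rel_bound A * e" by (rule rel_form_bound[OF i _ small]) (use e in auto)
      then have "\<bar>rel_form A y i s\<bar> < 1" using e(2) by linarith
      then show ?thesis using rel_form_integral[OF y(1) i] by (rule Ints_nonzero_abs_less1[rotated])
    qed
    have sq: "(\<lambda>s. (y j s)\<^sup>2) summable_on UNIV" if j: "j < k" for j
    proof (rule summable_on_comparison_test[OF lp_norm_2_less(1)[OF lp[OF j]]])
      show "(y j s)\<^sup>2 \<le> (cmod (Psi act x (\<phi> j) s))\<^sup>2" for s
        using power_mono[OF y(2)[OF j, of s], of 2] by simp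
    qed simp
    have "y j s = 0" if "j < k" for j s
      by (rule square_summable_solution_zero[OF inj Fol sq rel that])
    then have "\<phi> j (act s x) = \<phi> j (act s 0)" if "j < k" for j s using y(1)[OF that, of s] phi_zero[OF that] that by simp
    then show "x = 0" by (rule separates)
  qed
  moreover have "(\<Sum>\<kappa>\<in>W. lp_norm 2 (Psi act 0 \<kappa>)) < ennreal e"
    using lp_norm_Psi_zero(2)[OF W(1)] e by simp
  ultimately have "{x. (\<Sum>\<kappa>\<in>W. lp_norm 2 (Psi act x \<kappa>)) < ennreal e} = {0}" by blast
  then show ?thesis unfolding p_expansive_def using W e(1) by blast
qed

text \<open>A finitely supported solution gives finitely supported phases for every character in the
  finite set W, so scaling it down makes all the norms small while one phase stays off the
  integers.\<close>

lemma one_expansive_imp_injective: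
  assumes "p_expansive act 1"
  shows "rel_injective A"
proof (rule ccontr)
  assume "\<not> rel_injective A"
  then obtain y j0 s0 where y: "fin_supp k y" "\<And>i s. i < n \<Longrightarrow> rel_form A y i s = 0" "j0 < k" "y j0 s0 \<noteq> 0"
    unfolding rel_injective_def by blast
  obtain W and e :: real where W: "W \<subseteq> pontryagin_dual" "finite W" "e > 0"
    "{x. (\<Sum>\<kappa>\<in>W. lp_norm 1 (Psi act x \<kappa>)) < ennreal e} = {0}" using assms unfolding p_expansive_def by blast
  have "\<forall>\<kappa>\<in>W. \<exists>a. \<kappa> = pairing \<phi> act k a" using dual_pairing W(1) by blast
  then obtain a where a: "\<And>\<kappa>. \<kappa> \<in> W \<Longrightarrow> \<kappa> = pairing \<phi> act k (a \<kappa>)" by metis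
  \<comment> \<open>The phases of \<kappa> along the orbit before scaling.\<close>
  define b where "b = (\<lambda>\<kappa> s. \<Sum>j<k. gr_eval (a \<kappa> j) (\<lambda>u. y j (u + s)))"
  have fin: "finite {s. b \<kappa> s \<noteq> 0}" for \<kappa>
  proof -
    have "{s. b \<kappa> s \<noteq> 0} \<subseteq> (\<Union>j<k. \<Union>t\<in>keys (a \<kappa> j). (\<lambda>u. t + u) ` {u. y j u \<noteq> 0})"
    proof
      fix s assume "s \<in> {s. b \<kappa> s \<noteq> 0}"
      then obtain j where j: "j < k" "gr_eval (a \<kappa> j) (\<lambda>u. y j (u + s)) \<noteq> 0" unfolding b_def
        by (metis (mono_tags, lifting) lessThan_iff mem_Collect_eq sum.neutral)
      then obtain t where t: "t \<in> keys (a \<kappa> j)" "y j (- t + s) \<noteq> 0" unfolding gr_eval_def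
        by (metis (mono_tags, lifting) mult_zero_right sum.neutral)
      have "s = t + (- t + s)" by simp
      then show "s \<in> (\<Union>j<k. \<Union>t\<in>keys (a \<kappa> j). (\<lambda>u. t + u) ` {u. y j u \<noteq> 0})" using j t by blast
    qed
    moreover have "finite (\<Union>j<k. \<Union>t\<in>keys (a \<kappa> j). (\<lambda>u. t + u) ` {u. y j u \<noteq> 0})"
      using y(1) by (auto simp: fin_supp_def)
    ultimately show ?thesis by (rule finite_subset)
  qed
  define B where "B = (\<Sum>\<kappa>\<in>W. \<Sum>s\<in>{s. b \<kappa> s \<noteq> 0}. \<bar>b \<kappa> s\<bar>)"
  have B0: "B \<ge> 0" unfolding B_def by (intro sum_nonneg) auto
  \<comment> \<open>The first bound brings the sum of the norms below e; the second keeps the phase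
    at \<open>(j0, s0)\<close> at most 1/2, so that it is not a nonzero integer.\<close>
  define l where "l = min (e / (2 * pi * (B + 1))) (1 / (2 * \<bar>y j0 s0\<bar>))"
  have l: "l > 0" "l \<le> e / (2 * pi * (B + 1))" "l \<le> 1 / (2 * \<bar>y j0 s0\<bar>)" using W(3) B0 y(4) by (auto simp: l_def)
  have "rel_form A (\<lambda>j s. l * y j s) i s \<in> \<int>" if "i < n" for i s
    unfolding rel_form_scale using y(2)[OF that] by simp
  then obtain x where x: "\<And>j s. j < k \<Longrightarrow> \<phi> j (act s x) = cis (2 * pi * (l * y j s))"
    using realise[of "\<lambda>j s. l * y j s"] by blast
  have lp: "lp_norm 1 (Psi act x \<kappa>) \<le> ennreal (2 * pi * l * (\<Sum>s\<in>{s. b \<kappa> s \<noteq> 0}. \<bar>b \<kappa> s\<bar>))" if \<kappa>: "\<kappa> \<in> W" for \<kappa>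
  proof -
    let ?P = "\<lambda>s. cmod (Psi act x \<kappa> s)"
    have P: "Psi act x \<kappa> s = cis (2 * pi * (l * b \<kappa> s)) - 1" for s
    proof -
      have "\<kappa> (act s x) = pairing \<phi> act k (a \<kappa>) (act s x)" using a[OF \<kappa>] by simp
      also have "\<dots> = cis (2 * pi * (\<Sum>j<k. gr_eval (a \<kappa> j) (\<lambda>u. l * y j (u + s))))"
        by (rule pairing_cis) (rule x)
      also have "(\<Sum>j<k. gr_eval (a \<kappa> j) (\<lambda>u. l * y j (u + s))) = l * b \<kappa> s"
        unfolding b_def gr_eval_def sum_distrib_left by (intro sum.cong refl) simp
      finally show ?thesis by (simp add: Psi_def)
    qed
    have le: "?P s \<le> 2 * pi * l * \<bar>b \<kappa> s\<bar>" for s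
      using norm_cis_diff_le[of "2 * pi * (l * b \<kappa> s)" 0] l(1) by (simp add: P abs_mult)
    have z: "?P s = 0" if "s \<notin> {s. b \<kappa> s \<noteq> 0}" for s using that by (simp add: P)
    have hs: "(?P has_sum (\<Sum>s\<in>{s. b \<kappa> s \<noteq> 0}. ?P s)) UNIV"
      by (rule has_sum_finite_neutralI[OF fin]) (use z in auto)
    have "(\<Sum>s\<in>{s. b \<kappa> s \<noteq> 0}. ?P s) \<le> 2 * pi * l * (\<Sum>s\<in>{s. b \<kappa> s \<noteq> 0}. \<bar>b \<kappa> s\<bar>)"
      unfolding sum_distrib_left by (rule sum_mono) (rule le)
    then show ?thesis using hs by (simp add: lp_norm_1 has_sum_imp_summable infsumI ennreal_leI)
  qed
  have "(\<Sum>\<kappa>\<in>W. lp_norm 1 (Psi act x \<kappa>)) \<le> (\<Sum>\<kappa>\<in>W. ennreal (2 * pi * l * (\<Sum>s\<in>{s. b \<kappa> s \<noteq> 0}. \<bar>b \<kappa> s\<bar>)))"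
    by (rule sum_mono) (rule lp)
  also have "\<dots> = ennreal (\<Sum>\<kappa>\<in>W. 2 * pi * l * (\<Sum>s\<in>{s. b \<kappa> s \<noteq> 0}. \<bar>b \<kappa> s\<bar>))"
    using l(1) by (intro sum_ennreal mult_nonneg_nonneg sum_nonneg) auto
  also have "(\<Sum>\<kappa>\<in>W. 2 * pi * l * (\<Sum>s\<in>{s. b \<kappa> s \<noteq> 0}. \<bar>b \<kappa> s\<bar>)) = 2 * pi * l * B"
    unfolding B_def sum_distrib_left ..
  also have "ennreal (2 * pi * l * B) < ennreal e"
  proof (rule ennreal_lessI[OF W(3)])
    have "2 * pi * l * B < 2 * pi * l * (B + 1)" using l(1) by (intro mult_strict_left_mono) auto
    also have "\<dots> = l * (2 * pi * (B + 1))" by simp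
    also have "\<dots> \<le> e"
    proof -
      have "2 * pi * (B + 1) > 0" using B0 by simp
      then show ?thesis using l(2) by (simp only: pos_le_divide_eq)
    qed
    finally show "2 * pi * l * B < e" .
  qed
  finally have "x = 0" using W(4) by blast
  then have "cis (2 * pi * (l * y j0 s0)) = 1" using x[OF y(3), of s0] phi_zero[OF y(3)] by simp
  then have "l * y j0 s0 \<in> \<int>" unfolding cis_2pi_eq_1_iff .
  moreover have "\<bar>l * y j0 s0\<bar> < 1"
  proof -
    have "l * \<bar>y j0 s0\<bar> \<le> 1 / (2 * \<bar>y j0 s0\<bar>) * \<bar>y j0 s0\<bar>" using l(3) by (intro mult_right_mono) auto
    then show ?thesis using l(1) y(4) by (simp add: abs_mult)
  qed
  ultimately have "l * y j0 s0 = 0" by (rule Ints_nonzero_abs_less1)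
  then show False using l(1) y(4) by simp
qed

end

section \<open>Entropy\<close>

lemma rel_form_add: "rel_form A (\<lambda>j s. y j s + y' j s) i s = rel_form A y i s + rel_form A y' i s"
  by (simp add: rel_form_def algebra_simps sum.distrib)

lemma card_le_fibres:
  assumes "finite Z" "\<And>c. c \<in> f ` Z \<Longrightarrow> real (card {z \<in> Z. f z = c}) \<le> M"
  shows "real (card Z) \<le> real (card (f ` Z)) * M"
proof -
  have "real (card Z) = (\<Sum>z\<in>Z. 1)" by simp
  also have "\<dots> = (\<Sum>c\<in>f ` Z. \<Sum>z\<in>{z \<in> Z. f z = c}. 1)" by (rule sum.image_gen[OF assms(1)])
  also have "\<dots> \<le> (\<Sum>c\<in>f ` Z. M)" by (rule sum_mono) (use assms(2) in simp)
  finally show ?thesis by simp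
qed

text \<open>For a maximal subset P without differences in D, every point of F is reached from P by
  0, an element of D or the negative of one; these are at most \<open>2 * card D + 1\<close>
  displacements.\<close>

lemma sparse_subset:
  fixes F D :: "'g::group_add set"
  assumes F: "finite F" and D: "finite D"
  shows "\<exists>P\<subseteq>F. (\<forall>w\<in>P. \<forall>w'\<in>P. w \<noteq> w' \<longrightarrow> w - w' \<notin> D) \<and> card F \<le> card P * (2 * card D + 1)"
proof -
  define ok where "ok = (\<lambda>P. P \<subseteq> F \<and> (\<forall>w\<in>P. \<forall>w'\<in>P. w \<noteq> w' \<longrightarrow> w - w' \<notin> D))"
  have "finite {P. ok P}" using F by (intro finite_subset[of "{P. ok P}" "Pow F"]) (auto simp: ok_def)
  moreover have "{} \<in> {P. ok P}" by (simp add: ok_def)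
  then have "{P. ok P} \<noteq> {}" by blast
  ultimately have "\<exists>P\<in>{P. ok P}. \<forall>P'\<in>{P. ok P}. P \<subseteq> P' \<longrightarrow> P = P'" by (rule finite_has_maximal)
  then obtain P where P: "ok P" "\<And>P'. ok P' \<Longrightarrow> P \<subseteq> P' \<Longrightarrow> P = P'" by blast
  have PF: "P \<subseteq> F" "finite P" using P(1) F finite_subset by (auto simp: ok_def)
  let ?C = "insert 0 (D \<union> uminus ` D)"
  have "F \<subseteq> (\<lambda>(d, p). d + p) ` (?C \<times> P)"
  proof
    fix f assume f: "f \<in> F"
    show "f \<in> (\<lambda>(d, p). d + p) ` (?C \<times> P)"
    proof (cases "f \<in> P")
      case True
      then have "(0, f) \<in> ?C \<times> P" by simp
      moreover have "f = (case (0, f) of (d, p) \<Rightarrow> d + p)" by simp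
      ultimately show ?thesis by (rule image_eqI[rotated])
    next
      case False
      then have "\<not> ok (insert f P)" using P(2)[of "insert f P"] by blast
      then obtain w w' where w: "w \<in> insert f P" "w' \<in> insert f P" "w \<noteq> w'" "w - w' \<in> D"
        using PF(1) f unfolding ok_def by blast
      moreover have "\<not> (w \<in> P \<and> w' \<in> P)" using P(1) w(3,4) unfolding ok_def by blast
      ultimately obtain p where p: "p \<in> P" "f - p \<in> D \<or> p - f \<in> D" by blast
      have "f - p \<in> ?C"
      proof (cases "f - p \<in> D")
        case False
        then have "- (p - f) \<in> uminus ` D" using p(2) by blast
        then show ?thesis by simp
      qed simp
      then have "(f - p, p) \<in> ?C \<times> P" using p(1) by (rule SigmaI)
      moreover have "f = (case (f - p, p) of (d, p) \<Rightarrow> d + p)" by simp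
      ultimately show ?thesis by (rule image_eqI[rotated])
    qed
  qed
  then have "card F \<le> card ((\<lambda>(d, p). d + p) ` (?C \<times> P))" using D PF by (intro card_mono) auto
  also have "\<dots> \<le> card (?C \<times> P)" using D PF by (intro card_image_le) auto
  also have "\<dots> = card ?C * card P" by (rule card_cartesian_product)
  also have "\<dots> \<le> (2 * card D + 1) * card P"
  proof (rule mult_right_mono)
    have "card ?C \<le> Suc (card (D \<union> uminus ` D))" using D by (simp add: card_insert_if)
    also have "\<dots> \<le> Suc (card D + card (uminus ` D))" using card_Un_le[of D "uminus ` D"] by simp
    also have "\<dots> \<le> 2 * card D + 1" using card_image_le[OF D, of uminus] by simp
    finally show "card ?C \<le> 2 * card D + 1" .
  qed simp
  finally have "card F \<le> card P * (2 * card D + 1)" by (simp add: mult.commute)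
  moreover have "P \<subseteq> F" "\<forall>w\<in>P. \<forall>w'\<in>P. w \<noteq> w' \<longrightarrow> w - w' \<notin> D" using P(1) by (simp_all add: ok_def)
  ultimately show ?thesis by (intro exI[of _ P] conjI)
qed

section \<open>Separated sets and entropy bounds\<close>

context presented_action
begin

lemma cont_phi: "j < k \<Longrightarrow> continuous_on UNIV (\<phi> j)"
  using phi_dual[of j] unfolding pontryagin_dual_iff by blast

lemma cont_phi_diff:
  assumes "j < k"
  shows "continuous_on UNIV (\<lambda>p. cmod (\<phi> j (act t (fst p)) - \<phi> j (act t (snd p))))"
proof -
  have cc: "continuous_on UNIV (\<lambda>x. \<phi> j (act t x))"
    by (rule continuous_on_UNIV_compose[OF cont_phi[OF assms] act_cont])
  show ?thesis
    by (intro continuous_on_norm continuous_on_diff continuous_on_UNIV_compose[OF cc continuous_on_fst[OF continuous_on_id]]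
        continuous_on_UNIV_compose[OF cc continuous_on_snd[OF continuous_on_id]])
qed

text \<open>Pairs at distance at least e form a compact set, and each such pair is separated by some
  translated generator. Finitely many of these strict inequalities cover the set.\<close>

lemma characters_control_metric:
  assumes e: "e > 0"
  shows "\<exists>E d. finite E \<and> 0 \<in> E \<and> d > 0 \<and>
    (\<forall>x y. \<rho> x y \<ge> e \<longrightarrow> (\<exists>j<k. \<exists>t\<in>E. cmod (\<phi> j (act t x) - \<phi> j (act t y)) \<ge> d))"
proof -
  let ?C = "{p. \<rho> (fst p) (snd p) \<ge> e}"
  have "closed ?C"
    by (intro closed_Collect_le continuous_on_const compatible_metric_continuous[OF metric]
        continuous_on_fst continuous_on_snd continuous_on_id)
  then have C: "compact ?C" using compact_Int_closed[OF compact_UNIV_prod[OF compact_X compact_X], of ?C] by simp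
  let ?U = "\<lambda>(j, t, m). {p. cmod (\<phi> j (act t (fst p)) - \<phi> j (act t (snd p))) > inverse (real (Suc m))}"
  let ?Ix = "{..<k} \<times> (UNIV :: 'g set) \<times> (UNIV :: nat set)"
  have op: "open (?U q)" if "q \<in> ?Ix" for q
    using that by (auto intro!: open_Collect_less continuous_on_const cont_phi_diff)
  have cov: "?C \<subseteq> (\<Union>q\<in>?Ix. ?U q)"
  proof
    fix p assume p: "p \<in> ?C"
    then have "fst p \<noteq> snd p" using compatible_metric_simps(3)[OF metric, of "fst p" "snd p"] e by auto
    then have "\<not> (\<forall>j t. j < k \<longrightarrow> \<phi> j (act t (fst p)) = \<phi> j (act t (snd p)))"
      using separates[of "fst p" "snd p"] by blast
    then obtain j t where jt: "j < k" "\<phi> j (act t (fst p)) \<noteq> \<phi> j (act t (snd p))" by blast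
    then have "cmod (\<phi> j (act t (fst p)) - \<phi> j (act t (snd p))) > 0" by simp
    then obtain m where "inverse (real (Suc m)) < cmod (\<phi> j (act t (fst p)) - \<phi> j (act t (snd p)))" using reals_Archimedean by blast
    then have "p \<in> ?U (j, t, m)" by simp
    then show "p \<in> (\<Union>q\<in>?Ix. ?U q)" using jt(1) by blast
  qed
  obtain Q where Q: "Q \<subseteq> ?Ix" "finite Q" "?C \<subseteq> (\<Union>q\<in>Q. ?U q)"
    by (rule compactE_image[OF C op cov])
  \<comment> \<open>The element 0 is added for the later use of \<open>card_bdry\<close>.\<close>
  define E where "E = insert 0 ((\<lambda>q. fst (snd q)) ` Q)"
  define d where "d = Min (insert 1 ((\<lambda>q. inverse (real (Suc (snd (snd q))))) ` Q))"
  have "d > 0" unfolding d_def using Q(2) by (subst Min_gr_iff) auto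
  moreover have "\<exists>j<k. \<exists>t\<in>E. cmod (\<phi> j (act t x) - \<phi> j (act t y)) \<ge> d" if "\<rho> x y \<ge> e" for x y
  proof -
    have "(x, y) \<in> ?C" using that by simp
    then obtain q where q: "q \<in> Q" "(x, y) \<in> ?U q" using Q(3) by blast
    obtain j t m where jtm: "q = (j, t, m)" by (cases q)
    have "d \<le> inverse (real (Suc m))" unfolding d_def using Q(2) q(1) jtm by (intro Min_le) force+
    moreover have "inverse (real (Suc m)) < cmod (\<phi> j (act t x) - \<phi> j (act t y))" using q(2) jtm by simp
    moreover have "j < k" using Q(1) q(1) jtm by auto
    moreover have "t \<in> E" unfolding E_def using q(1) jtm by force
    ultimately show ?thesis by (intro exI[of _ j] conjI bexI[of _ t]) auto
  qed
  ultimately show ?thesis using Q(2) by (intro exI[of _ E] exI[of _ d]) (auto simp: E_def)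
qed

lemma metric_controls_character:
  assumes j: "j < k" and d: "d > 0"
  shows "\<exists>e>0. \<forall>x y. cmod (\<phi> j x - \<phi> j y) \<ge> d \<longrightarrow> \<rho> x y > e"
proof -
  let ?C = "{p. d \<le> cmod (\<phi> j (act 0 (fst p)) - \<phi> j (act 0 (snd p)))}"
  have "closed ?C" by (intro closed_Collect_le continuous_on_const cont_phi_diff[OF j])
  then have C: "compact ?C" using compact_Int_closed[OF compact_UNIV_prod[OF compact_X compact_X], of ?C] by simp
  show ?thesis
  proof (cases "?C = {}")
    case True
    then have "\<not> cmod (\<phi> j x - \<phi> j y) \<ge> d" for x y by (auto simp: act_0)
    then show ?thesis by (intro exI[of _ 1]) auto
  next
    case False
    have "continuous_on ?C (\<lambda>p. \<rho> (fst p) (snd p))"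
      by (rule continuous_on_subset[OF compatible_metric_continuous[OF metric continuous_on_fst[OF continuous_on_id] continuous_on_snd[OF continuous_on_id]]]) simp
    from continuous_attains_inf[OF C False this] obtain p where
      p: "p \<in> ?C" "\<And>q. q \<in> ?C \<Longrightarrow> \<rho> (fst p) (snd p) \<le> \<rho> (fst q) (snd q)" by blast
    have "fst p \<noteq> snd p" using p(1) d by auto
    then have pos: "\<rho> (fst p) (snd p) > 0"
      using compatible_metric_simps(1)[OF metric, of "fst p" "snd p"] compatible_metric_simps(3)[OF metric, of "fst p" "snd p"] by linarith
    have "\<rho> x y > \<rho> (fst p) (snd p) / 2" if "cmod (\<phi> j x - \<phi> j y) \<ge> d" for x y
      using p(2)[of "(x, y)"] that pos by (simp add: act_0)
    then show ?thesis using pos by (intro exI[of _ "\<rho> (fst p) (snd p) / 2"]) auto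
  qed
qed

lemma separated_iff:
  assumes "finite F" "F \<noteq> {}"
  shows "separated_set act \<rho> F e Z \<longleftrightarrow> (\<forall>y\<in>Z. \<forall>z\<in>Z. y \<noteq> z \<longrightarrow> (\<exists>s\<in>F. \<rho> (act s y) (act s z) > e))"
  unfolding separated_set_def using assms by (simp add: Max_gr_iff)

text \<open>This gives the maximum in \<open>sep_number\<close> a meaning: the space has a finite
  cover by dynamical balls of radius e/2, each containing at most one point of a separated
  set.\<close>

lemma separated_bounded:
  assumes F: "finite F" "F \<noteq> {}" and e: "e > 0"
  shows "\<exists>B. \<forall>Z. finite Z \<and> separated_set act \<rho> F e Z \<longrightarrow> card Z \<le> B"
proof -
  let ?U = "\<lambda>x. {y. \<forall>s\<in>F. \<rho> (act s x) (act s y) < e / 2}"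
  have "?U x = (\<Inter>s\<in>F. {y. \<rho> (act s x) (act s y) < e / 2})" for x by auto
  moreover have "open (\<Inter>s\<in>F. {y. \<rho> (act s x) (act s y) < e / 2})" for x
    by (intro open_INT F(1) ballI open_Collect_less compatible_metric_continuous[OF metric] continuous_on_const act_cont)
  ultimately have op: "open (?U x)" for x by simp
  have "UNIV \<subseteq> (\<Union>x\<in>UNIV. ?U x)"
  proof
    fix x
    have "\<rho> u u = 0" for u using compatible_metric_simps(3)[OF metric, of u u] by simp
    then have "x \<in> ?U x" using e by simp
    then show "x \<in> (\<Union>x\<in>UNIV. ?U x)" by blast
  qed
  then obtain C where C: "finite C" "UNIV \<subseteq> (\<Union>x\<in>C. ?U x)"
    by (rule compactE_image[OF compact_X op])
  have "card Z \<le> card C" if Z: "finite Z" "separated_set act \<rho> F e Z" for Z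
  proof -
    have "\<forall>z. \<exists>x\<in>C. z \<in> ?U x" using C(2) by blast
    then have "\<exists>c. \<forall>z. c z \<in> C \<and> z \<in> ?U (c z)" by (intro choice) blast
    then obtain c where c: "\<And>z. c z \<in> C" "\<And>z. z \<in> ?U (c z)" by blast
    have "inj_on c Z"
    proof (rule inj_onI, rule ccontr)
      fix y z assume yz: "y \<in> Z" "z \<in> Z" "c y = c z" "y \<noteq> z"
      then obtain s where s: "s \<in> F" "\<rho> (act s y) (act s z) > e" using Z(2) unfolding separated_iff[OF F] by blast
      have "\<rho> (act s (c y)) (act s y) < e / 2" "\<rho> (act s (c y)) (act s z) < e / 2" using c(2)[of y] c(2)[of z] s(1) yz(3) by auto
      then show False using s(2) compatible_metric_simps(4)[OF metric, of "act s y" "act s z" "act s (c y)"]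
        compatible_metric_simps(2)[OF metric, of "act s y" "act s (c y)"] by linarith
    qed
    then show ?thesis by (rule card_inj_on_le) (use c(1) C(1) in auto)
  qed
  then show ?thesis by blast
qed

lemma sep_number_props:
  assumes F: "finite F" "F \<noteq> {}" and e: "e > 0"
  shows "finite Z \<Longrightarrow> separated_set act \<rho> F e Z \<Longrightarrow> card Z \<le> sep_number act \<rho> F e"
    and "\<exists>Z. finite Z \<and> separated_set act \<rho> F e Z \<and> card Z = sep_number act \<rho> F e"
proof -
  let ?S = "card ` {Z. finite Z \<and> separated_set act \<rho> F e Z}"
  obtain B where B: "\<forall>Z. finite Z \<and> separated_set act \<rho> F e Z \<longrightarrow> card Z \<le> B"
    using separated_bounded[OF F e] by blast
  have fin: "finite ?S" by (rule finite_subset[of _ "{..B}"]) (use B in auto)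
  have "separated_set act \<rho> F e {}" by (simp add: separated_set_def)
  then have ne: "?S \<noteq> {}" by blast
  show "finite Z \<Longrightarrow> separated_set act \<rho> F e Z \<Longrightarrow> card Z \<le> sep_number act \<rho> F e"
    unfolding sep_number_def using fin by (intro Max_ge) auto
  show "\<exists>Z. finite Z \<and> separated_set act \<rho> F e Z \<and> card Z = sep_number act \<rho> F e"
    using Max_in[OF fin ne] unfolding sep_number_def by auto
qed

text \<open>The points of \<open>Z\<close> are lifted to real vectors on the finite set \<open>msum E F\<close> and classified by the
  integers into which the relations map the lift at interior points; within one class the
  differences lie in a space on which the boundary relations are injective.\<close>

lemma card_separated_le:
  assumes inj: "rel_injective A" and F: "finite F" "F \<noteq> {}"
    and E: "finite E" and d: "d > 0"
    and Ed: "\<And>x y. \<rho> x y \<ge> e \<Longrightarrow> \<exists>j<k. \<exists>t\<in>E. cmod (\<phi> j (act t x) - \<phi> j (act t y)) \<ge> d"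
    and Z: "finite Z" "separated_set act \<rho> F e Z"
  shows "real (card Z) \<le> (2 * rel_bound A + 3) ^ (n * card (msum E F)) * (4 / min 1 (d / (2 * pi))) ^ (n * card (bdry A (msum E F)))"
proof -
  \<comment> \<open>A chord of length d requires a phase difference of at least
    \<open>d / (2 * pi)\<close>; the cap at 1 is a hypothesis of
    \<open>separated_card_le\<close>.\<close>
  define \<eta> where "\<eta> = min 1 (d / (2 * pi))"
  have eta: "0 < \<eta>" "\<eta> \<le> 1" "2 * pi * \<eta> \<le> d" using d by (auto simp: \<eta>_def min_def field_simps)
  define G where "G = msum E F"
  have G: "finite G" unfolding G_def by (rule finite_msum[OF E F(1)])
  let ?I = "{..<k} \<times> G"
  have "\<forall>z. \<exists>y. \<forall>j<k. \<forall>s. \<bar>y j s\<bar> \<le> 1/2 \<and> \<phi> j (act s z) = cis (2 * pi * y j s) \<and> \<bar>y j s\<bar> \<le> cmod (\<phi> j (act s z) - 1)"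
    using lift_exists by blast
  then obtain Y where "\<forall>z. \<forall>j<k. \<forall>s. \<bar>Y z j s\<bar> \<le> 1/2 \<and> \<phi> j (act s z) = cis (2 * pi * Y z j s) \<and> \<bar>Y z j s\<bar> \<le> cmod (\<phi> j (act s z) - 1)"
    by (rule choice[THEN exE])
  then have Y: "\<bar>Y z j s\<bar> \<le> 1/2" "\<phi> j (act s z) = cis (2 * pi * Y z j s)" if "j < k" for z j s using that by blast+
  define vec where "vec = (\<lambda>z. case_prod (Y z))"
  have sep: "\<exists>q\<in>?I. \<eta> \<le> \<bar>vec z q - vec z' q\<bar>" if z: "z \<in> Z" "z' \<in> Z" "z \<noteq> z'" for z z'
  proof -
    obtain s where s: "s \<in> F" "\<rho> (act s z) (act s z') > e" using Z(2) z unfolding separated_iff[OF F] by blast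
    then obtain j t where jt: "j < k" "t \<in> E" "cmod (\<phi> j (act t (act s z)) - \<phi> j (act t (act s z'))) \<ge> d"
      using Ed[of "act s z" "act s z'"] by auto
    have "2 * pi * \<eta> \<le> cmod (cis (2 * pi * Y z j (t + s)) - cis (2 * pi * Y z' j (t + s)))"
      using jt(3) eta(3) unfolding act_add[symmetric] Y(2)[OF jt(1)] by linarith
    also have "\<dots> \<le> \<bar>2 * pi * Y z j (t + s) - 2 * pi * Y z' j (t + s)\<bar>" by (rule norm_cis_diff_le)
    also have "\<dots> = 2 * pi * \<bar>Y z j (t + s) - Y z' j (t + s)\<bar>"
      unfolding right_diff_distrib[symmetric] abs_mult by simp
    finally have "\<eta> \<le> \<bar>Y z j (t + s) - Y z' j (t + s)\<bar>" by simp
    moreover have "(j, t + s) \<in> ?I" using jt s(1) by (auto simp: G_def msum_def)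
    ultimately show ?thesis unfolding vec_def by (intro bexI[of _ "(j, t + s)"]) auto
  qed
  define m where "m = \<lceil>rel_bound A\<rceil>"
  have m1: "m \<ge> 1" using rel_bound_ge_1[of A] unfolding m_def by linarith
  \<comment> \<open>The relations are integers on lifts, so the floor loses nothing and only makes
    the classifying values elements of a finite integer box.\<close>
  define cls where "cls = (\<lambda>z. \<lambda>p\<in>{..<n} \<times> intr A G. \<lfloor>rel_form A (Y z) (fst p) (snd p)\<rfloor>)"
  have int: "rel_form A (Y z) i s \<in> \<int>" if "i < n" for z i s by (rule rel_form_integral[OF Y(2) that])
  have cls_in: "cls z \<in> PiE ({..<n} \<times> intr A G) (\<lambda>_. {-m..m})" for z
  proof -
    have "\<lfloor>rel_form A (Y z) i s\<rfloor> \<in> {-m..m}" if i: "i < n" for i s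
    proof -
      have "\<bar>rel_form A (Y z) i s\<bar> \<le> rel_bound A * (1/2)" by (rule rel_form_bound[OF i _ Y(1)]) auto
      then have "\<bar>rel_form A (Y z) i s\<bar> \<le> rel_bound A" using rel_bound_ge_1[of A] by linarith
      then have "rel_form A (Y z) i s \<le> of_int m" "- of_int m \<le> rel_form A (Y z) i s" unfolding m_def by linarith+
      then show ?thesis by (simp add: le_floor_iff) linarith
    qed
    then show ?thesis by (auto simp: cls_def)
  qed
  have fibre: "real (card {z \<in> Z. cls z = c}) \<le> (4 / \<eta>) ^ card ({..<n} \<times> bdry A G)" for c
  proof -
    let ?Zc = "{z \<in> Z. cls z = c}"
    have "inj_on vec ?Zc"
    proof (rule inj_onI, rule ccontr)
      fix z z' assume z: "z \<in> ?Zc" "z' \<in> ?Zc" "vec z = vec z'" "z \<noteq> z'"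
      then obtain q where "\<eta> \<le> \<bar>vec z q - vec z' q\<bar>" using sep[of z z'] by blast
      then show False using z(3) eta(1) by simp
    qed
    then have "card ?Zc = card (vec ` ?Zc)" by (simp add: card_image)
    also have "real \<dots> \<le> (4 / \<eta>) ^ card ({..<n} \<times> bdry A G)"
    proof (rule separated_card_le[where I="?I" and ?J0.0="{..<n} \<times> intr A G" and H="rel_coeff A"])
      show "finite ?I" "finite ({..<n} \<times> intr A G)" "finite ({..<n} \<times> bdry A G)" "finite (vec ` ?Zc)"
        using G finite_intr[OF G] finite_bdry[OF G] Z(1) by auto
      show "\<forall>i\<in>?I. v i = 0" if "\<forall>p\<in>{..<n} \<times> intr A G \<union> {..<n} \<times> bdry A G. ip ?I (rel_coeff A p) v = 0" for v
        by (rule rel_coeff_injective[OF inj G that])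
      show "0 < \<eta>" "\<eta> \<le> 1" by (rule eta)+
    next
      fix v v' p assume v: "v \<in> vec ` ?Zc" "v' \<in> vec ` ?Zc" and p: "p \<in> {..<n} \<times> intr A G"
      obtain z z' where z: "v = vec z" "v' = vec z'" "cls z = cls z'" using v by auto
      obtain i s where ps: "p = (i, s)" "i < n" "s \<in> intr A G" using p by auto
      have "\<lfloor>rel_form A (Y z) i s\<rfloor> = \<lfloor>rel_form A (Y z') i s\<rfloor>"
        using fun_cong[OF z(3), of p] p ps(1) by (simp add: cls_def)
      then have "rel_form A (Y z) i s = rel_form A (Y z') i s"
        using int[OF ps(2), of z s] int[OF ps(2), of z' s] by (auto elim!: Ints_cases)
      then show "ip ?I (rel_coeff A p) v = ip ?I (rel_coeff A p) v'"
        unfolding ps(1) ip_rel_coeff_intr[OF G ps(2,3)] z(1,2) vec_def by simp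
    next
      fix v v' q assume v: "v \<in> vec ` ?Zc" "v' \<in> vec ` ?Zc" and q: "q \<in> ?I"
      obtain z z' where z: "v = vec z" "v' = vec z'" using v by auto
      obtain j u where ju: "q = (j, u)" "j < k" using q by auto
      show "\<bar>v q - v' q\<bar> \<le> 1" using Y(1)[OF ju(2), of z u] Y(1)[OF ju(2), of z' u] unfolding z ju(1) vec_def by auto
    next
      fix v v' assume v: "v \<in> vec ` ?Zc" "v' \<in> vec ` ?Zc" "v \<noteq> v'"
      then obtain z z' where z: "v = vec z" "v' = vec z'" "z \<in> Z" "z' \<in> Z" "z \<noteq> z'" by auto
      show "\<exists>q\<in>?I. \<eta> \<le> \<bar>v q - v' q\<bar>" unfolding z(1,2) by (rule sep[OF z(3,4,5)])
    qed
    finally show ?thesis .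
  qed
  have "card (cls ` Z) \<le> card (PiE ({..<n} \<times> intr A G) (\<lambda>_. {-m..m}))"
    by (rule card_mono) (use cls_in finite_intr[OF G] in \<open>auto intro!: finite_PiE\<close>)
  also have "\<dots> = nat (2 * m + 1) ^ (n * card (intr A G))"
    using finite_intr[OF G] m1 by (simp add: card_PiE card_cartesian_product)
  finally have "real (card (cls ` Z)) \<le> real (nat (2 * m + 1)) ^ (n * card (intr A G))"
    by (simp only: of_nat_le_iff flip: of_nat_power)
  also have "\<dots> \<le> (2 * rel_bound A + 3) ^ (n * card (intr A G))"
  proof (rule power_mono)
    \<comment> \<open>Since m is less than \<open>rel_bound A + 1\<close>, the number of integers in
      the box side is at most \<open>2 * rel_bound A + 3\<close>.\<close>
    have "real (nat (2 * m + 1)) = 2 * of_int m + 1" using m1 by simp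
    also have "\<dots> \<le> 2 * rel_bound A + 3" using ceiling_correct[of "rel_bound A"] unfolding m_def by linarith
    finally show "real (nat (2 * m + 1)) \<le> 2 * rel_bound A + 3" .
  qed simp
  also have "\<dots> \<le> (2 * rel_bound A + 3) ^ (n * card G)"
    using rel_bound_ge_1[of A] card_mono[OF G intr_subset] by (intro power_increasing mult_left_mono) auto
  finally have c1: "real (card (cls ` Z)) \<le> (2 * rel_bound A + 3) ^ (n * card G)" .
  have "real (card Z) \<le> real (card (cls ` Z)) * (4 / \<eta>) ^ card ({..<n} \<times> bdry A G)"
    by (rule card_le_fibres[OF Z(1) fibre])
  also have "\<dots> \<le> (2 * rel_bound A + 3) ^ (n * card G) * (4 / \<eta>) ^ card ({..<n} \<times> bdry A G)"
    using c1 eta by (intro mult_right_mono) auto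
  finally show ?thesis unfolding G_def \<eta>_def by (simp add: card_cartesian_product)
qed

lemma injective_imp_finite_entropy:
  assumes inj: "rel_injective A" and Fol: "left_Folner_seq (F :: nat \<Rightarrow> 'g set)"
  shows "top_entropy act \<rho> F < \<infinity>"
proof -
  have F: "finite (F m)" "F m \<noteq> {}" for m using Fol by (simp_all add: left_Folner_seq_def)
  \<comment> \<open>Independent of the scale e: the factor 2 bounds the thickened Folner set
    relative to the original one, and the summand 1 absorbs the boundary contribution.\<close>
  define C where "C = 2 * real n * ln (2 * rel_bound A + 3) + 1"
  have lnR: "ln (2 * rel_bound A + 3) \<ge> 0" using rel_bound_ge_1[of A] by (intro ln_ge_zero) auto
  have "limsup (\<lambda>m. ereal (ln (real (sep_number act \<rho> (F m) e)) / real (card (F m)))) \<le> ereal C" if e: "e > 0" for e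
  proof (rule Limsup_bounded)
    obtain E d where Ed: "finite E" "0 \<in> E" "d > 0"
      "\<And>x y. \<rho> x y \<ge> e \<Longrightarrow> \<exists>j<k. \<exists>t\<in>E. cmod (\<phi> j (act t x) - \<phi> j (act t y)) \<ge> d"
      using characters_control_metric[OF e] by blast
    define \<Lambda> where "\<Lambda> = 4 / min 1 (d / (2 * pi))"
    have mpos: "min 1 (d / (2 * pi)) > 0" using Ed(3) by simp
    have L: "\<Lambda> \<ge> 1" unfolding \<Lambda>_def using mpos by (simp add: le_divide_eq) 
    have lnL: "ln \<Lambda> \<ge> 0" using L by (rule ln_ge_zero)
    \<comment> \<open>The scale-dependent cost of one boundary position is hidden in M. A boundary
      of relative size \<open>1 / M\<close> then contributes at most 1 per element of the Folner
      set.\<close>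
    define M where "M = real n * real (card (rel_supp A)) * ln \<Lambda> + 1"
    have M: "M \<ge> 1" using lnL by (simp add: M_def)
    have "\<forall>\<^sub>F m in sequentially. real (card (msum E (F m) - F m)) \<le> 1 * real (card (F m))"
      by (rule Folner_small[OF Fol Ed(1)]) simp
    moreover have "\<forall>\<^sub>F m in sequentially. real (card (msum (bdry_kernel A E) (F m) - F m)) \<le> (1 / M) * real (card (F m))"
      by (rule Folner_small[OF Fol finite_bdry_kernel[OF Ed(1)]]) (use M in simp)
    ultimately show "\<forall>\<^sub>F m in sequentially. ereal (ln (real (sep_number act \<rho> (F m) e)) / real (card (F m))) \<le> ereal C"
    proof eventually_elim
      case (elim m)
      let ?c = "real (card (F m))"
      have cF: "?c > 0" using F[of m] by (simp add: card_gt_0_iff)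
      obtain Z where Z: "finite Z" "separated_set act \<rho> (F m) e Z" "card Z = sep_number act \<rho> (F m) e"
        using sep_number_props(2)[OF F e] by blast
      let ?G = "msum E (F m)"
      have "card ?G \<le> card (F m \<union> (?G - F m))" using F finite_msum[OF Ed(1) F(1)] by (intro card_mono) auto
      also have "\<dots> \<le> card (F m) + card (?G - F m)" by (rule card_Un_le)
      finally have cG: "real (card ?G) \<le> 2 * ?c" using elim(1) by linarith
      have "real (card (bdry A ?G)) \<le> real (card (rel_supp A)) * real (card (msum (bdry_kernel A E) (F m) - F m))"
        using card_bdry[OF Ed(1) F(1) Ed(2), of A m] unfolding of_nat_mult[symmetric] of_nat_le_iff .
      also have "\<dots> \<le> real (card (rel_supp A)) * ((1 / M) * ?c)" by (rule mult_left_mono[OF elim(2)]) simp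
      finally have cB: "real (card (bdry A ?G)) \<le> real (card (rel_supp A)) * ((1 / M) * ?c)" .
      have bound: "real (card Z) \<le> (2 * rel_bound A + 3) ^ (n * card ?G) * \<Lambda> ^ (n * card (bdry A ?G))"
        unfolding \<Lambda>_def by (rule card_separated_le[OF inj F Ed(1,3,4) Z(1,2)])
      have "ln (real (card Z)) \<le> real n * real (card ?G) * ln (2 * rel_bound A + 3) + real n * real (card (bdry A ?G)) * ln \<Lambda>"
      proof (cases "card Z = 0")
        case True then show ?thesis using lnR lnL by simp
      next
        case False
        then have "ln (real (card Z)) \<le> ln ((2 * rel_bound A + 3) ^ (n * card ?G) * \<Lambda> ^ (n * card (bdry A ?G)))"
          by (intro ln_mono bound) auto
        also have "\<dots> = ln ((2 * rel_bound A + 3) ^ (n * card ?G)) + ln (\<Lambda> ^ (n * card (bdry A ?G)))"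
          using L rel_bound_ge_1[of A] by (intro ln_mult_pos zero_less_power) auto
        also have "\<dots> = real n * real (card ?G) * ln (2 * rel_bound A + 3) + real n * real (card (bdry A ?G)) * ln \<Lambda>"
          using L rel_bound_ge_1[of A] by (simp add: ln_realpow)
        finally show ?thesis .
      qed
      also have "\<dots> \<le> real n * (2 * ?c) * ln (2 * rel_bound A + 3) + real n * (real (card (rel_supp A)) * ((1 / M) * ?c)) * ln \<Lambda>"
        using cG cB lnR lnL by (intro add_mono mult_right_mono mult_left_mono) auto
      also have "\<dots> = (2 * real n * ln (2 * rel_bound A + 3) + (real n * real (card (rel_supp A)) * ln \<Lambda>) / M) * ?c"
        by (simp add: algebra_simps)
      also have "\<dots> \<le> C * ?c"
      proof (rule mult_right_mono)
        have "(real n * real (card (rel_supp A)) * ln \<Lambda>) / M \<le> 1" using M by (simp add: M_def divide_le_eq)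
        then show "2 * real n * ln (2 * rel_bound A + 3) + (real n * real (card (rel_supp A)) * ln \<Lambda>) / M \<le> C" by (simp add: C_def)
      qed simp
      finally show ?case using cF by (simp add: Z(3) divide_le_eq)
    qed
  qed
  then have "top_entropy act \<rho> F \<le> ereal C" unfolding top_entropy_def by (intro SUP_least) auto
  then show ?thesis by (rule order_le_less_trans) simp
qed

text \<open>Translates of the solution, centred at the points of a sparse set, are superposed with
  independent coefficients from N levels. Sparseness makes the phase at each centre depend on its
  own coefficient only, so all \<open>N ^ card P\<close> points are separated at a scale that does
  not depend on F.\<close>

lemma infinite_entropy_lower_bound:
  assumes y: "fin_supp k y" "\<And>i s. i < n \<Longrightarrow> rel_form A y i s = 0" "j0 < k" "\<bar>y j0 s0\<bar> = 1/2"
    and F: "finite F" "F \<noteq> {}" and N: "N > 0" and e: "e > 0"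
    and ctrl: "\<And>x x'. cmod (\<phi> j0 x - \<phi> j0 x') \<ge> 1 / (2 * real N) \<Longrightarrow> \<rho> x x' > e"
    and D: "D = (\<lambda>u. u - s0) ` {u. y j0 u \<noteq> 0}"
  shows "real (card F) * ln (real N) \<le> real (2 * card D + 1) * ln (real (sep_number act \<rho> F e))"
proof -
  have finD: "finite D" using y(1,3) unfolding D by (simp add: fin_supp_def)
  obtain P where P: "P \<subseteq> F" "\<And>w w'. w \<in> P \<Longrightarrow> w' \<in> P \<Longrightarrow> w \<noteq> w' \<Longrightarrow> w - w' \<notin> D"
    "card F \<le> card P * (2 * card D + 1)" using sparse_subset[OF F(1) finD] by blast
  have finP: "finite P" using P(1) F(1) finite_subset by blast
  define Y where "Y = (\<lambda>(l :: 'g \<Rightarrow> nat) j u. \<Sum>w\<in>P. (real (l w) / real N) * y j (u + (- w + s0)))"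
  have relY: "rel_form A (Y l) i s = 0" if i: "i < n" for l i s
  proof -
    have "rel_form A (\<lambda>j u. \<Sum>w\<in>P'. (real (l w) / real N) * y j (u + (- w + s0))) i s = 0" if "finite P'" for P'
      using that
    proof (induction P' rule: finite_induct)
      case empty then show ?case by (simp add: rel_form_def)
    next
      case (insert w P')
      have "rel_form A (\<lambda>j u. (real (l w) / real N) * y j (u + (- w + s0))) i s = 0"
        unfolding rel_form_scale[of A _ "\<lambda>j u. y j (u + (- w + s0))"] rel_form_shift y(2)[OF i] by simp
      then show ?case unfolding sum.insert[OF insert.hyps(1,2)] rel_form_add using insert.IH by simp
    qed
    then show ?thesis unfolding Y_def using finP by blast
  qed
  have "\<forall>l. \<exists>x. \<forall>j<k. \<forall>s. \<phi> j (act s x) = cis (2 * pi * Y l j s)"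
  proof
    fix l
    have "rel_form A (Y l) i s \<in> \<int>" if "i < n" for i s using relY[OF that] by simp
    then show "\<exists>x. \<forall>j<k. \<forall>s. \<phi> j (act s x) = cis (2 * pi * Y l j s)" by (rule realise)
  qed
  then obtain X where "\<forall>l. \<forall>j<k. \<forall>s. \<phi> j (act s (X l)) = cis (2 * pi * Y l j s)" by (rule choice[THEN exE])
  then have X: "\<phi> j0 (act s (X l)) = cis (2 * pi * Y l j0 s)" for l s using y(3) by blast
  have Yw: "Y l j0 w = (real (l w) / real N) * y j0 s0" if w: "w \<in> P" for l w
  proof -
    \<comment> \<open>D consists of the support of \<open>y j0\<close> relative to
      \<open>s0\<close>, so sparseness excludes interference between distinct centres.\<close>
    have "y j0 (w + (- w' + s0)) = 0" if w': "w' \<in> P" "w' \<noteq> w" for w'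
    proof (rule ccontr)
      assume "y j0 (w + (- w' + s0)) \<noteq> 0"
      then have "w + (- w' + s0) - s0 \<in> D" unfolding D by blast
      moreover have "w + (- w' + s0) - s0 = w - w'" by (simp add: add.assoc[symmetric])
      ultimately show False using P(2)[OF w w'(1)] w'(2) by auto
    qed
    then have "Y l j0 w = (\<Sum>w'\<in>P. if w' = w then (real (l w) / real N) * y j0 (w + (- w + s0)) else 0)"
      unfolding Y_def by (intro sum.cong) auto
    also have "\<dots> = (real (l w) / real N) * y j0 (w + (- w + s0))" using w finP by simp
    finally show ?thesis by (simp add: add.assoc[symmetric])
  qed
  let ?L = "PiE P (\<lambda>_. {..<N})"
  have sepX: "\<exists>s\<in>F. \<rho> (act s (X l)) (act s (X l')) > e" if l: "l \<in> ?L" "l' \<in> ?L" "l \<noteq> l'" for l l'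
  proof -
    have "\<exists>w\<in>P. l w \<noteq> l' w"
    proof (rule ccontr)
      assume "\<not> ?thesis"
      then have "l = l'" by (intro PiE_ext[OF l(1,2)]) auto
      then show False using l(3) by simp
    qed
    then obtain w where w: "w \<in> P" "l w \<noteq> l' w" by blast
    have lN: "l w < N" "l' w < N" using l w(1) by auto
    define t where "t = (real (l w) / real N) * y j0 s0 - (real (l' w) / real N) * y j0 s0"
    have "\<bar>t\<bar> = \<bar>real (l w) - real (l' w)\<bar> / (2 * real N)"
    proof -
      have "t = (real (l w) - real (l' w)) / real N * y j0 s0" by (simp add: t_def diff_divide_distrib algebra_simps)
      then have "\<bar>t\<bar> = \<bar>real (l w) - real (l' w)\<bar> / \<bar>real N\<bar> * (1/2)" by (simp only: abs_mult abs_divide y(4))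
      then show ?thesis by simp
    qed
    moreover have "1 / (2 * real N) \<le> \<bar>real (l w) - real (l' w)\<bar> / (2 * real N)"
      by (rule divide_right_mono) (use w(2) in linarith, simp)
    moreover have "\<bar>real (l w) - real (l' w)\<bar> / (2 * real N) \<le> real N / (2 * real N)"
      by (rule divide_right_mono) (use lN in linarith, simp)
    \<comment> \<open>The normalisation of y to modulus 1/2 keeps phase differences within 1/2,
      where chords bound phases, while distinct levels still differ by
      \<open>1 / (2 * N)\<close>.\<close>
    ultimately have t: "1 / (2 * real N) \<le> \<bar>t\<bar>" "\<bar>t\<bar> \<le> 1/2" using N by auto
    have "\<phi> j0 (act w (X l)) - \<phi> j0 (act w (X l')) = cis (2 * pi * Y l' j0 w) * (cis (2 * pi * t) - 1)"
      unfolding X Yw[OF w(1)] t_def by (simp add: right_diff_distrib cis_mult)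
    then have "cmod (\<phi> j0 (act w (X l)) - \<phi> j0 (act w (X l'))) = cmod (cis (2 * pi * t) - 1)" by (simp add: norm_mult)
    then have "1 / (2 * real N) \<le> cmod (\<phi> j0 (act w (X l)) - \<phi> j0 (act w (X l')))"
      using abs_le_norm_cis_diff[OF t(2)] t(1) by linarith
    then show ?thesis using ctrl w(1) P(1) by blast
  qed
  have "inj_on X ?L"
  proof (rule inj_onI, rule ccontr)
    fix l l' assume l: "l \<in> ?L" "l' \<in> ?L" "X l = X l'" "l \<noteq> l'"
    obtain s where "\<rho> (act s (X l)) (act s (X l')) > e" using sepX[OF l(1,2,4)] by blast
    then show False using e compatible_metric_simps(3)[OF metric, of "act s (X l)" "act s (X l')"] l(3) by simp
  qed
  then have "card (X ` ?L) = N ^ card P" using finP by (simp add: card_image card_PiE)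
  moreover have "card (X ` ?L) \<le> sep_number act \<rho> F e"
  proof (rule sep_number_props(1)[OF F e])
    show "finite (X ` ?L)" using finP by (intro finite_imageI finite_PiE) auto
    show "separated_set act \<rho> F e (X ` ?L)" unfolding separated_iff[OF F]
    proof (intro ballI impI)
      fix x x' assume "x \<in> X ` ?L" "x' \<in> X ` ?L" "x \<noteq> x'"
      then show "\<exists>s\<in>F. e < \<rho> (act s x) (act s x')" using sepX by blast
    qed
  qed
  ultimately have "N ^ card P \<le> sep_number act \<rho> F e" by simp
  then have le: "real N ^ card P \<le> real (sep_number act \<rho> F e)" unfolding of_nat_power[symmetric] of_nat_le_iff .
  have "real (card P) * ln (real N) = ln (real N ^ card P)" using N by (simp add: ln_realpow)
  also have "\<dots> \<le> ln (real (sep_number act \<rho> F e))" by (rule ln_mono) (use le N in auto)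
  finally have 1: "real (card P) * ln (real N) \<le> ln (real (sep_number act \<rho> F e))" .
  have lnN: "ln (real N) \<ge> 0" using N by simp
  have "real (card F) \<le> real (card P) * real (2 * card D + 1)" using P(3) unfolding of_nat_mult[symmetric] of_nat_le_iff .
  then have "real (card F) * ln (real N) \<le> (real (card P) * real (2 * card D + 1)) * ln (real N)" using lnN by (rule mult_right_mono)
  also have "\<dots> = real (2 * card D + 1) * (real (card P) * ln (real N))" by simp
  also have "\<dots> \<le> real (2 * card D + 1) * ln (real (sep_number act \<rho> F e))" using 1 by (intro mult_left_mono) auto
  finally show ?thesis .
qed

text \<open>The density constant c depends only on the solution, while the number N of levels is
  arbitrary; refining the scale with N makes the entropy exceed every
  \<open>ln N / c\<close>.\<close>

lemma finite_entropy_imp_injective: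
  assumes fin: "top_entropy act \<rho> F < \<infinity>" and Fol: "left_Folner_seq (F :: nat \<Rightarrow> 'g set)"
  shows "rel_injective A"
proof (rule ccontr)
  assume "\<not> rel_injective A"
  then obtain y0 j0 s0 where y0: "fin_supp k y0" "\<And>i s. i < n \<Longrightarrow> rel_form A y0 i s = 0" "j0 < k" "y0 j0 s0 \<noteq> 0"
    unfolding rel_injective_def by blast
  define y where "y = (\<lambda>j s. (1 / (2 * y0 j0 s0)) * y0 j s)"
  have y: "fin_supp k y" "\<And>i s. i < n \<Longrightarrow> rel_form A y i s = 0" "\<bar>y j0 s0\<bar> = 1/2"
    using y0 unfolding y_def rel_form_scale by (auto simp: fin_supp_def)
  define D where "D = (\<lambda>u. u - s0) ` {u. y j0 u \<noteq> 0}"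
  define c where "c = real (2 * card D + 1)"
  have c: "c > 0" by (simp add: c_def)
  have F: "finite (F m)" "F m \<noteq> {}" for m using Fol by (simp_all add: left_Folner_seq_def)
  have lower: "ereal (ln (real N) / c) \<le> top_entropy act \<rho> F" if N: "N > 0" for N :: nat
  proof -
    have "1 / (2 * real N) > 0" using N by simp
    from metric_controls_character[OF y0(3) this] obtain e where
      e: "e > 0" "\<And>x x'. cmod (\<phi> j0 x - \<phi> j0 x') \<ge> 1 / (2 * real N) \<Longrightarrow> \<rho> x x' > e" by blast
    have "ln (real N) / c \<le> ln (real (sep_number act \<rho> (F m) e)) / real (card (F m))" for m
    proof -
      have "real (card (F m)) * ln (real N) \<le> c * ln (real (sep_number act \<rho> (F m) e))"
        unfolding c_def by (rule infinite_entropy_lower_bound[OF y(1,2) y0(3) y(3) F N e D_def])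
      moreover have "real (card (F m)) > 0" using F[of m] by (simp add: card_gt_0_iff)
      ultimately show ?thesis using c by (simp add: field_simps)
    qed
    then have "ereal (ln (real N) / c) \<le> limsup (\<lambda>m. ereal (ln (real (sep_number act \<rho> (F m) e)) / real (card (F m))))"
      by (intro le_Limsup always_eventually allI) (simp_all del: ereal_less_eq add: ereal_less_eq(3))
    also have "\<dots> \<le> top_entropy act \<rho> F" unfolding top_entropy_def by (rule SUP_upper) (use e in simp)
    finally show ?thesis .
  qed
  obtain r where r: "top_entropy act \<rho> F \<le> ereal r" using fin by (cases "top_entropy act \<rho> F") auto
  obtain N :: nat where N: "real N > exp (c * r)" using reals_Archimedean2 by blast
  then have "real N > 0" using exp_gt_zero[of "c * r"] by linarith
  then have "N > 0" by simp
  have "ln (exp (c * r)) < ln (real N)" using N \<open>real N > 0\<close> by (subst ln_less_cancel_iff) auto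
  then have "ln (real N) > c * r" by simp
  then have "ln (real N) / c > r" using c by (simp add: field_simps)
  moreover have "ereal (ln (real N) / c) \<le> ereal r" using lower[OF \<open>N > 0\<close>] r by (rule order_trans)
  ultimately show False by simp
qed

end

theorem theorem4p11:
  fixes act :: "'g::{group_add,countable} \<Rightarrow> 'x::topological_ab_group_add \<Rightarrow> 'x"
    and \<rho> :: "'x \<Rightarrow> 'x \<Rightarrow> real"
    and F :: "nat \<Rightarrow> 'g set"
    and k n :: nat
    and A :: "('g \<Rightarrow>\<^sub>0 int) mat"
  assumes "amenable TYPE('g)"
    and "compact (UNIV :: 'x set)"
    and "metrizable_space (euclidean :: 'x topology)"
    and "automorphism_action act"
    and "compatible_metric \<rho>"
    and "left_Folner_seq F"
    and "A \<in> carrier_mat n k"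
    and "left_module_iso (presented_module A) (dual_module act) \<noteq> {}"
  shows "(top_entropy act \<rho> F < \<infinity> \<longleftrightarrow> p_expansive act 1) \<and>
    (p_expansive act 1 \<longleftrightarrow> p_expansive act 2) \<and>
    (p_expansive act 2 \<longleftrightarrow>
       inj_on (\<lambda>a. a * real_mat (mat_star A)) (carrier_mat 1 k)) \<and>
    (inj_on (\<lambda>a. a * real_mat (mat_star A)) (carrier_mat 1 k) \<longleftrightarrow>
       inj_on (\<lambda>a. a * mat_star A) (carrier_mat 1 k))"
proof -
  obtain \<phi> where "dual_presentation act A \<phi>" using dual_presentation_exists[OF assms(8)] by blast
  then interpret presented_action act A \<phi> \<rho>
    by (rule presented_action.intro[OF assms(2,4,5)])
  have "top_entropy act \<rho> F < \<infinity> \<longleftrightarrow> rel_injective A"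
    using injective_imp_finite_entropy[OF _ assms(6)] finite_entropy_imp_injective[OF _ assms(6)] by blast
  moreover have "p_expansive act 1 \<longleftrightarrow> rel_injective A" "p_expansive act 2 \<longleftrightarrow> rel_injective A"
    using injective_imp_two_expansive[OF _ assms(6)] two_expansive_imp_one one_expansive_imp_injective by blast+
  ultimately show ?thesis
    unfolding real_inj_iff[OF assms(7)] int_inj_iff[OF assms(7)] rel_injective_iff_int by simp
qed

end
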